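(* Let $F\colon\mathcal{K}\to\mathcal{L}$ be a weak equivalence of $\infty$-cosmoi. Then the induced 2-functor $\mathfrak{h}F\colon\mathfrak{h}\mathcal{K}\to\mathfrak{h}\mathcal{L}$: (i) defines a biequivalence: it is surjective on objects up to equivalence and defines an equivalence of categories $\hom(A,B)\to\hom(FA,FB)$ for all $A,B\in\mathcal{K}$; (ii) induces a bijection between isomorphism classes of parallel functors: for all $A,B\in\mathcal{K}$, the functor $\hom(A,B)\to\hom(FA,FB)$ induces a bijection on isomorphism classes of objects; (iii) preserves and reflects groupoidal objects: $A\in\mathcal{K}$ is groupoidal if and only if $FA\in\mathcal{L}$ is groupoidal; (iv) preserves and reflects equivalence: $A\simeq B$ in $\mathcal{K}$ if and only if $FA\simeq FB$ in $\mathcal{L}$; (v) preserves and reflects equivalences: $f\colon A\to B$ in $\mathcal{K}$ is an equivalence if and only if $Ff\colon FA\to FB$ in $\mathcal{L}$ is an equivalence; (vi) preserves and reflects comma objects: given an isofibration $E\to C\times B$ and functors $C\xrightarrow{g}A\xleftarrow{f}B$ in $\mathcal{K}$, one has $E\simeq f\downarrow g$ over $C\times B$ if and only if $FE\simeq Ff\downarrow Fg\cong F(f\downarrow g)$ over $FC\times FB$.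
   Context: Quasi-categories. A quasi-category is a simplicial set in which every inner horn $\Lambda^{n,k}\to\Delta^n$, $0<k<n$, has a filler. Let $\mathbb{I}$ be the nerve of the category with two objects and a unique isomorphism between them. An isofibration of quasi-categories is a map with the right lifting property against inner horn inclusions and against the inclusion $\Delta^0\to\mathbb{I}$ of either endpoint. A map $f\colon A\to B$ of quasi-categories is an equivalence if there are $g\colon B\to A$ and maps $A\to A^{\mathbb{I}}$, $B\to B^{\mathbb{I}}$ restricting along the two vertices of $\mathbb{I}$ to $\mathrm{id}_A, gf$ and to $fg,\mathrm{id}_B$ respectively. $\infty$-cosmoi. An $\infty$-cosmos is a simplicially enriched category $\mathcal{K}$ (objects are called $\infty$-categories, vertices of hom simplicial sets are called functors) whose hom simplicial sets $\mathrm{Fun}(A,B)$ are all quasi-categories, equipped with a specified subcategory of isofibrations, such that: (a) in the simplicially enriched sense $\mathcal{K}$ has a terminal object $1$, cotensors $A^U$ of objects $A$ by simplicial sets $U$, and pullbacks of isofibrations along any functor; (b) isofibrations include the isomorphisms and all functors $A\to 1$, are stable under pullback along all functors, and for every isofibration $p\colon E\to B$ and inclusion of simplicial sets $U\hookrightarrow V$ the induced map $E^V\to E^U\times_{B^U}B^V$ is an isofibration; moreover for every object $X$ and isofibration $p\colon E\to B$, $\mathrm{Fun}(X,p)$ is an isofibration of quasi-categories. A functor $f\colon A\to B$ is an equivalence if $\mathrm{Fun}(X,f)$ is an equivalence of quasi-categories for all $X\in\mathcal{K}$; $A\simeq B$ means there is an equivalence between them. Homotopy 2-category. $\mathfrak{h}\mathcal{K}$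 is the strict 2-category with the same objects as $\mathcal{K}$ and hom-categories $\hom(A,B):=\mathrm{ho}(\mathrm{Fun}(A,B))$, the homotopy categories of the mapping quasi-categories. Functors and weak equivalences of $\infty$-cosmoi. A functor of $\infty$-cosmoi $F\colon\mathcal{K}\to\mathcal{L}$ is a simplicial functor preserving isofibrations and the limits listed in (a); it induces a 2-functor $\mathfrak{h}F\colon\mathfrak{h}\mathcal{K}\to\mathfrak{h}\mathcal{L}$. It is a weak equivalence if for every $X\in\mathcal{L}$ there is $A\in\mathcal{K}$ with $FA\simeq X$ in $\mathcal{L}$, and for all $A,B\in\mathcal{K}$ the map $\mathrm{Fun}(A,B)\to\mathrm{Fun}(FA,FB)$ is an equivalence of quasi-categories. Groupoidal objects. An object $E$ of $\mathcal{K}$ is groupoidal if every 2-cell of $\mathfrak{h}\mathcal{K}$ with codomain $E$ is invertible, i.e., $\hom(X,E)$ is a groupoid for all $X$. Commas. For $A\in\mathcal{K}$, write $A^{\mathbf{2}}:=A^{\Delta^1}$, with isofibration $(p_1,p_0)\colon A^{\mathbf{2}}\to A\times A$ induced by $\partial\Delta^1\hookrightarrow\Delta^1$ ($p_1$ codomain, $p_0$ domain projection). For functors $g\colon C\to A$, $f\colon B\to A$, the comma $\infty$-category $(p_1,p_0)\colon f\downarrow g\to C\times B$ is the pullback of $(p_1,p_0)\colon A^{\mathbf{2}}\to A\times A$ along $g\times f\colon C\times B\to A\times A$. For isofibrations $E\to Z$, $E'\to Z$, "$E\simeq E'$ over $Z$" means that there is an equivalence $E\to E'$ commuting strictly with the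 maps to $Z$. *)

theory Defs
  imports "HOL-Library.FuncSet" "HOL-Library.Infinite_Typeclass"
begin

section \<open>Simplicial sets\<close>

text \<open>The list \<open>[a\<^sub>0, \<dots>, a\<^sub>m]\<close> encodes the operator \<open>[m] \<rightarrow> [n]\<close>, \<open>i \<mapsto> a\<^sub>i\<close>.\<close>

definition ops :: "nat \<Rightarrow> nat \<Rightarrow> nat list set" where
  "ops m n = {a. length a = Suc m \<and> sorted a \<and> set a \<subseteq> {..n}}"

definition op_id :: "nat \<Rightarrow> nat list" where
  "op_id n = [0..<Suc n]"

definition op_comp :: "nat list \<Rightarrow> nat list \<Rightarrow> nat list" where
  "op_comp a b = map (\<lambda>i. a ! i) b"

definition op_const :: "nat \<Rightarrow> nat list" where
  "op_const m = replicate (Suc m) 0"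

text \<open>For \<open>a : [m] \<rightarrow> [n]\<close> the function \<open>act X n a\<close> is \<open>X(a) : X\<^sub>n \<rightarrow> X\<^sub>m\<close>. The sets of simplices in
  different dimensions need not be disjoint, which is why \<open>n\<close> is an argument.\<close>

record 'x sset =
  simplices :: "nat \<Rightarrow> 'x set"
  act :: "nat \<Rightarrow> nat list \<Rightarrow> 'x \<Rightarrow> 'x"

definition is_sset :: "'x sset \<Rightarrow> bool" where
  "is_sset X \<longleftrightarrow>
     (\<forall>m n a. a \<in> ops m n \<longrightarrow> act X n a \<in> simplices X n \<rightarrow> simplices X m) \<and>
     (\<forall>n. \<forall>x\<in>simplices X n. act X n (op_id n) x = x) \<and>
     (\<forall>k m n a b. a \<in> ops m n \<longrightarrow> b \<in> ops k m \<longrightarrow>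
        (\<forall>x\<in>simplices X n. act X m b (act X n a x) = act X n (op_comp a b) x))"

text \<open>Only the values of a simplicial map on simplices of its domain matter; two maps are the same
  if they agree there.\<close>

definition smap :: "'x sset \<Rightarrow> 'y sset \<Rightarrow> (nat \<Rightarrow> 'x \<Rightarrow> 'y) \<Rightarrow> bool" where
  "smap X Y f \<longleftrightarrow>
     (\<forall>n. f n \<in> simplices X n \<rightarrow> simplices Y n) \<and>
     (\<forall>m n a. a \<in> ops m n \<longrightarrow> (\<forall>x\<in>simplices X n. f m (act X n a x) = act Y n a (f n x)))"

definition sub_sset :: "'x sset \<Rightarrow> 'x sset \<Rightarrow> bool" where
  "sub_sset U V \<longleftrightarrow> is_sset U \<and> is_sset V \<and> (\<forall>n. simplices U n \<subseteq> simplices V n) \<and>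
     smap U V (\<lambda>n x. x)"

definition std_simplex :: "nat \<Rightarrow> nat list sset" where
  "std_simplex n = \<lparr>simplices = (\<lambda>m. ops m n), act = (\<lambda>m a x. op_comp x a)\<rparr>"

definition horn :: "nat \<Rightarrow> nat \<Rightarrow> nat list sset" where
  "horn n k = \<lparr>simplices = (\<lambda>m. {x \<in> ops m n. \<exists>i\<le>n. i \<noteq> k \<and> i \<notin> set x}),
               act = (\<lambda>m a x. op_comp x a)\<rparr>"

text \<open>The nerve of the category with objects \<open>0\<close>, \<open>1\<close> and exactly one morphism in each of its four
  hom-sets: a functor from \<open>[m]\<close> to it is an arbitrary sequence of \<open>m + 1\<close> objects.\<close>

definition walking_iso :: "nat list sset" where
  "walking_iso = \<lparr>simplices = (\<lambda>m. {x. length x = Suc m \<and> set x \<subseteq> {0, 1}}),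
                  act = (\<lambda>m a x. op_comp x a)\<rparr>"

definition sset_prod :: "'x sset \<Rightarrow> 'y sset \<Rightarrow> ('x \<times> 'y) sset" where
  "sset_prod X Y = \<lparr>simplices = (\<lambda>n. simplices X n \<times> simplices Y n),
                    act = (\<lambda>n a (x, y). (act X n a x, act Y n a y))\<rparr>"

text \<open>\<open>X\<^sup>U\<close>: its \<open>n\<close>-simplices are the simplicial maps \<open>U \<times> \<Delta>\<^sup>n \<rightarrow> X\<close>, made extensional so that equal
  maps are equal simplices. An operator \<open>a : [m] \<rightarrow> [n]\<close> acts by precomposition with \<open>U \<times> \<Delta>\<^sup>a\<close>.\<close>

definition sset_exp :: "'x sset \<Rightarrow> 'u sset \<Rightarrow> (nat \<Rightarrow> 'u \<times> nat list \<Rightarrow> 'x) sset" where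
  "sset_exp X U =
     \<lparr>simplices = (\<lambda>n. {\<phi>. smap (sset_prod U (std_simplex n)) X \<phi> \<and>
                          (\<forall>k. \<phi> k \<in> extensional (simplices (sset_prod U (std_simplex n)) k))}),
      act = (\<lambda>n a \<phi> k. \<lambda>(u, b) \<in> simplices (sset_prod U (std_simplex (length a - 1))) k.
                          \<phi> k (u, op_comp a b))\<rparr>"

text \<open>The restriction \<open>X\<^sup>U \<rightarrow> X\<^bsup>\<Delta>\<^sup>0\<^esup> = X\<close> along a vertex \<open>v\<close> of \<open>U\<close>.\<close>

definition sset_eval :: "'u sset \<Rightarrow> 'u \<Rightarrow> nat \<Rightarrow> (nat \<Rightarrow> 'u \<times> nat list \<Rightarrow> 'x) \<Rightarrow> 'x" where
  "sset_eval U v n \<phi> = \<phi> n (act U 0 (op_const n) v, op_id n)"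


section \<open>Quasi-categories\<close>

definition quasi_category :: "'x sset \<Rightarrow> bool" where
  "quasi_category X \<longleftrightarrow> is_sset X \<and>
     (\<forall>n k u. 0 < k \<longrightarrow> k < n \<longrightarrow> smap (horn n k) X u \<longrightarrow>
        (\<exists>w. smap (std_simplex n) X w \<and> (\<forall>m. \<forall>s\<in>simplices (horn n k) m. w m s = u m s)))"

text \<open>The right lifting property of \<open>p : X \<rightarrow> Y\<close> against \<open>i : U \<rightarrow> V\<close>.\<close>

definition has_rlp :: "'u sset \<Rightarrow> 'v sset \<Rightarrow> (nat \<Rightarrow> 'u \<Rightarrow> 'v) \<Rightarrow>
    'x sset \<Rightarrow> 'y sset \<Rightarrow> (nat \<Rightarrow> 'x \<Rightarrow> 'y) \<Rightarrow> bool" where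
  "has_rlp U V i X Y p \<longleftrightarrow>
     (\<forall>u v. smap U X u \<longrightarrow> smap V Y v \<longrightarrow>
        (\<forall>n. \<forall>s\<in>simplices U n. p n (u n s) = v n (i n s)) \<longrightarrow>
        (\<exists>w. smap V X w \<and>
           (\<forall>n. \<forall>s\<in>simplices U n. w n (i n s) = u n s) \<and>
           (\<forall>n. \<forall>s\<in>simplices V n. p n (w n s) = v n s)))"

definition qc_isofibration :: "'x sset \<Rightarrow> 'y sset \<Rightarrow> (nat \<Rightarrow> 'x \<Rightarrow> 'y) \<Rightarrow> bool" where
  "qc_isofibration X Y p \<longleftrightarrow> quasi_category X \<and> quasi_category Y \<and> smap X Y p \<and>
     (\<forall>n k. 0 < k \<longrightarrow> k < n \<longrightarrow> has_rlp (horn n k) (std_simplex n) (\<lambda>m s. s) X Y p) \<and>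
     (\<forall>v\<in>{0, 1}. has_rlp (std_simplex 0) walking_iso (\<lambda>m s. map (\<lambda>_. v) s) X Y p)"

definition qc_equivalence :: "'x sset \<Rightarrow> 'y sset \<Rightarrow> (nat \<Rightarrow> 'x \<Rightarrow> 'y) \<Rightarrow> bool" where
  "qc_equivalence A B f \<longleftrightarrow> quasi_category A \<and> quasi_category B \<and> smap A B f \<and>
     (\<exists>g h k. smap B A g \<and>
        smap A (sset_exp A walking_iso) h \<and> smap B (sset_exp B walking_iso) k \<and>
        (\<forall>n. \<forall>x\<in>simplices A n. sset_eval walking_iso [0] n (h n x) = x \<and>
                               sset_eval walking_iso [1] n (h n x) = g n (f n x)) \<and>
        (\<forall>n. \<forall>y\<in>simplices B n. sset_eval walking_iso [0] n (k n y) = f n (g n y) \<and>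
                               sset_eval walking_iso [1] n (k n y) = y))"


section \<open>Categories\<close>

record ('o, 'm) cat =
  cobj :: "'o set"
  chom :: "'o \<Rightarrow> 'o \<Rightarrow> 'm set"
  cid :: "'o \<Rightarrow> 'm"
  ccomp :: "'m \<Rightarrow> 'm \<Rightarrow> 'm"

definition is_category :: "('o, 'm) cat \<Rightarrow> bool" where
  "is_category C \<longleftrightarrow>
     (\<forall>x\<in>cobj C. cid C x \<in> chom C x x) \<and>
     (\<forall>x\<in>cobj C. \<forall>y\<in>cobj C. \<forall>z\<in>cobj C. \<forall>f\<in>chom C x y. \<forall>g\<in>chom C y z.
        ccomp C g f \<in> chom C x z) \<and>
     (\<forall>x\<in>cobj C. \<forall>y\<in>cobj C. \<forall>f\<in>chom C x y.
        ccomp C f (cid C x) = f \<and> ccomp C (cid C y) f = f) \<and>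
     (\<forall>w\<in>cobj C. \<forall>x\<in>cobj C. \<forall>y\<in>cobj C. \<forall>z\<in>cobj C.
        \<forall>f\<in>chom C w x. \<forall>g\<in>chom C x y. \<forall>h\<in>chom C y z.
        ccomp C h (ccomp C g f) = ccomp C (ccomp C h g) f)"

definition cat_iso :: "('o, 'm) cat \<Rightarrow> 'o \<Rightarrow> 'o \<Rightarrow> 'm \<Rightarrow> bool" where
  "cat_iso C x y f \<longleftrightarrow> f \<in> chom C x y \<and>
     (\<exists>g\<in>chom C y x. ccomp C g f = cid C x \<and> ccomp C f g = cid C y)"

definition iso_rel :: "('o, 'm) cat \<Rightarrow> 'o rel" where
  "iso_rel C = {(x, y). x \<in> cobj C \<and> y \<in> cobj C \<and> (\<exists>f. cat_iso C x y f)}"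

definition is_groupoid :: "('o, 'm) cat \<Rightarrow> bool" where
  "is_groupoid C \<longleftrightarrow> is_category C \<and>
     (\<forall>x\<in>cobj C. \<forall>y\<in>cobj C. \<forall>f\<in>chom C x y. cat_iso C x y f)"

definition cat_functor ::
  "('o, 'm) cat \<Rightarrow> ('p, 'n) cat \<Rightarrow> ('o \<Rightarrow> 'p) \<Rightarrow> ('m \<Rightarrow> 'n) \<Rightarrow> bool" where
  "cat_functor C D Fo Fm \<longleftrightarrow> is_category C \<and> is_category D \<and>
     Fo \<in> cobj C \<rightarrow> cobj D \<and>
     (\<forall>x\<in>cobj C. \<forall>y\<in>cobj C. Fm \<in> chom C x y \<rightarrow> chom D (Fo x) (Fo y)) \<and>
     (\<forall>x\<in>cobj C. Fm (cid C x) = cid D (Fo x)) \<and>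
     (\<forall>x\<in>cobj C. \<forall>y\<in>cobj C. \<forall>z\<in>cobj C. \<forall>f\<in>chom C x y. \<forall>g\<in>chom C y z.
        Fm (ccomp C g f) = ccomp D (Fm g) (Fm f))"

definition nat_iso :: "('o, 'm) cat \<Rightarrow> ('p, 'n) cat \<Rightarrow>
    ('o \<Rightarrow> 'p) \<Rightarrow> ('m \<Rightarrow> 'n) \<Rightarrow> ('o \<Rightarrow> 'p) \<Rightarrow> ('m \<Rightarrow> 'n) \<Rightarrow> ('o \<Rightarrow> 'n) \<Rightarrow> bool" where
  "nat_iso C D Fo Fm Go Gm t \<longleftrightarrow>
     (\<forall>x\<in>cobj C. cat_iso D (Fo x) (Go x) (t x)) \<and>
     (\<forall>x\<in>cobj C. \<forall>y\<in>cobj C. \<forall>f\<in>chom C x y. ccomp D (t y) (Fm f) = ccomp D (Gm f) (t x))"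

definition cat_equivalence ::
  "('o, 'm) cat \<Rightarrow> ('p, 'n) cat \<Rightarrow> ('o \<Rightarrow> 'p) \<Rightarrow> ('m \<Rightarrow> 'n) \<Rightarrow> bool" where
  "cat_equivalence C D Fo Fm \<longleftrightarrow> cat_functor C D Fo Fm \<and>
     (\<exists>Go Gm s t. cat_functor D C Go Gm \<and>
        nat_iso C C id id (Go \<circ> Fo) (Gm \<circ> Fm) s \<and>
        nat_iso D D (Fo \<circ> Go) (Fm \<circ> Gm) id id t)"

text \<open>The induced map on isomorphism classes; the class of \<open>x\<close> is sent to the class of \<open>Fo x\<close>. If the
  map were not well defined, some union would fail to be an isomorphism class.\<close>

definition bij_on_iso_classes :: "('o, 'm) cat \<Rightarrow> ('p, 'n) cat \<Rightarrow> ('o \<Rightarrow> 'p) \<Rightarrow> bool" where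
  "bij_on_iso_classes C D Fo \<longleftrightarrow>
     bij_betw (\<lambda>c. \<Union>x\<in>c. iso_rel D `` {Fo x}) (cobj C // iso_rel C) (cobj D // iso_rel D)"


section \<open>Strict 2-categories\<close>

text \<open>The hom-categories carry the vertical composition; \<open>tcomp1\<close> and \<open>tcomp2\<close> compose 1-cells and
  (horizontally) 2-cells.\<close>

record ('o, 'f, 'c) two_cat =
  tobj :: "'o set"
  thom :: "'o \<Rightarrow> 'o \<Rightarrow> ('f, 'c) cat"
  tid :: "'o \<Rightarrow> 'f"
  tcomp1 :: "'o \<Rightarrow> 'o \<Rightarrow> 'o \<Rightarrow> 'f \<Rightarrow> 'f \<Rightarrow> 'f"
  tcomp2 :: "'o \<Rightarrow> 'o \<Rightarrow> 'o \<Rightarrow> 'c \<Rightarrow> 'c \<Rightarrow> 'c"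

abbreviation cells1 :: "('o, 'f, 'c) two_cat \<Rightarrow> 'o \<Rightarrow> 'o \<Rightarrow> 'f set" where
  "cells1 T A B \<equiv> cobj (thom T A B)"

abbreviation cells2 :: "('o, 'f, 'c) two_cat \<Rightarrow> 'o \<Rightarrow> 'o \<Rightarrow> 'f \<Rightarrow> 'f \<Rightarrow> 'c set" where
  "cells2 T A B \<equiv> chom (thom T A B)"

definition strict_2_category :: "('o, 'f, 'c) two_cat \<Rightarrow> bool" where
  "strict_2_category T \<longleftrightarrow>
     (\<forall>A\<in>tobj T. \<forall>B\<in>tobj T. is_category (thom T A B)) \<and>
     (\<forall>A\<in>tobj T. tid T A \<in> cells1 T A A) \<and>
     (\<forall>A\<in>tobj T. \<forall>B\<in>tobj T. \<forall>C\<in>tobj T. \<forall>f\<in>cells1 T A B. \<forall>g\<in>cells1 T B C.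
        tcomp1 T A B C g f \<in> cells1 T A C \<and>
        tcomp2 T A B C (cid (thom T B C) g) (cid (thom T A B) f) =
          cid (thom T A C) (tcomp1 T A B C g f)) \<and>
     (\<forall>A\<in>tobj T. \<forall>B\<in>tobj T. \<forall>C\<in>tobj T.
        \<forall>f\<in>cells1 T A B. \<forall>f'\<in>cells1 T A B. \<forall>g\<in>cells1 T B C. \<forall>g'\<in>cells1 T B C.
        \<forall>a\<in>cells2 T A B f f'. \<forall>b\<in>cells2 T B C g g'.
        tcomp2 T A B C b a \<in> cells2 T A C (tcomp1 T A B C g f) (tcomp1 T A B C g' f')) \<and>
     (\<forall>A\<in>tobj T. \<forall>B\<in>tobj T. \<forall>C\<in>tobj T.
        \<forall>f\<in>cells1 T A B. \<forall>f'\<in>cells1 T A B. \<forall>f''\<in>cells1 T A B.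
        \<forall>g\<in>cells1 T B C. \<forall>g'\<in>cells1 T B C. \<forall>g''\<in>cells1 T B C.
        \<forall>a\<in>cells2 T A B f f'. \<forall>a'\<in>cells2 T A B f' f''.
        \<forall>b\<in>cells2 T B C g g'. \<forall>b'\<in>cells2 T B C g' g''.
        tcomp2 T A B C (ccomp (thom T B C) b' b) (ccomp (thom T A B) a' a) =
          ccomp (thom T A C) (tcomp2 T A B C b' a') (tcomp2 T A B C b a)) \<and>
     (\<forall>A\<in>tobj T. \<forall>B\<in>tobj T. \<forall>f\<in>cells1 T A B.
        tcomp1 T A A B f (tid T A) = f \<and> tcomp1 T A B B (tid T B) f = f) \<and>
     (\<forall>A\<in>tobj T. \<forall>B\<in>tobj T. \<forall>f\<in>cells1 T A B. \<forall>f'\<in>cells1 T A B. \<forall>a\<in>cells2 T A B f f'.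
        tcomp2 T A A B a (cid (thom T A A) (tid T A)) = a \<and>
        tcomp2 T A B B (cid (thom T B B) (tid T B)) a = a) \<and>
     (\<forall>A\<in>tobj T. \<forall>B\<in>tobj T. \<forall>C\<in>tobj T. \<forall>D\<in>tobj T.
        \<forall>f\<in>cells1 T A B. \<forall>g\<in>cells1 T B C. \<forall>h\<in>cells1 T C D.
        tcomp1 T A C D h (tcomp1 T A B C g f) = tcomp1 T A B D (tcomp1 T B C D h g) f) \<and>
     (\<forall>A\<in>tobj T. \<forall>B\<in>tobj T. \<forall>C\<in>tobj T. \<forall>D\<in>tobj T.
        \<forall>f\<in>cells1 T A B. \<forall>f'\<in>cells1 T A B. \<forall>g\<in>cells1 T B C. \<forall>g'\<in>cells1 T B C.
        \<forall>h\<in>cells1 T C D. \<forall>h'\<in>cells1 T C D.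
        \<forall>a\<in>cells2 T A B f f'. \<forall>b\<in>cells2 T B C g g'. \<forall>c\<in>cells2 T C D h h'.
        tcomp2 T A C D c (tcomp2 T A B C b a) = tcomp2 T A B D (tcomp2 T B C D c b) a)"

text \<open>Internal equivalence of two objects of a 2-category.\<close>

definition two_cat_equivalent :: "('o, 'f, 'c) two_cat \<Rightarrow> 'o \<Rightarrow> 'o \<Rightarrow> bool" where
  "two_cat_equivalent T A B \<longleftrightarrow>
     (\<exists>f\<in>cells1 T A B. \<exists>g\<in>cells1 T B A. \<exists>a b.
        cat_iso (thom T A A) (tid T A) (tcomp1 T A B A g f) a \<and>
        cat_iso (thom T B B) (tcomp1 T B A B f g) (tid T B) b)"

record ('o, 'f, 'c, 'p, 'g, 'd) two_fun =
  tfobj :: "'o \<Rightarrow> 'p"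
  tfun1 :: "'o \<Rightarrow> 'o \<Rightarrow> 'f \<Rightarrow> 'g"
  tfun2 :: "'o \<Rightarrow> 'o \<Rightarrow> 'c \<Rightarrow> 'd"

definition strict_2_functor :: "('o, 'f, 'c) two_cat \<Rightarrow> ('p, 'g, 'd) two_cat \<Rightarrow>
    ('o, 'f, 'c, 'p, 'g, 'd) two_fun \<Rightarrow> bool" where
  "strict_2_functor S T F \<longleftrightarrow> strict_2_category S \<and> strict_2_category T \<and>
     tfobj F \<in> tobj S \<rightarrow> tobj T \<and>
     (\<forall>A\<in>tobj S. \<forall>B\<in>tobj S. cat_functor (thom S A B) (thom T (tfobj F A) (tfobj F B))
                               (tfun1 F A B) (tfun2 F A B)) \<and>
     (\<forall>A\<in>tobj S. tfun1 F A A (tid S A) = tid T (tfobj F A)) \<and>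
     (\<forall>A\<in>tobj S. \<forall>B\<in>tobj S. \<forall>C\<in>tobj S. \<forall>f\<in>cells1 S A B. \<forall>g\<in>cells1 S B C.
        tfun1 F A C (tcomp1 S A B C g f) =
          tcomp1 T (tfobj F A) (tfobj F B) (tfobj F C) (tfun1 F B C g) (tfun1 F A B f)) \<and>
     (\<forall>A\<in>tobj S. \<forall>B\<in>tobj S. \<forall>C\<in>tobj S.
        \<forall>f\<in>cells1 S A B. \<forall>f'\<in>cells1 S A B. \<forall>g\<in>cells1 S B C. \<forall>g'\<in>cells1 S B C.
        \<forall>a\<in>cells2 S A B f f'. \<forall>b\<in>cells2 S B C g g'.
        tfun2 F A C (tcomp2 S A B C b a) =
          tcomp2 T (tfobj F A) (tfobj F B) (tfobj F C) (tfun2 F B C b) (tfun2 F A B a))"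

definition biequivalence :: "('o, 'f, 'c) two_cat \<Rightarrow> ('p, 'g, 'd) two_cat \<Rightarrow>
    ('o, 'f, 'c, 'p, 'g, 'd) two_fun \<Rightarrow> bool" where
  "biequivalence S T F \<longleftrightarrow> strict_2_functor S T F \<and>
     (\<forall>X\<in>tobj T. \<exists>A\<in>tobj S. two_cat_equivalent T (tfobj F A) X) \<and>
     (\<forall>A\<in>tobj S. \<forall>B\<in>tobj S. cat_equivalence (thom S A B) (thom T (tfobj F A) (tfobj F B))
                               (tfun1 F A B) (tfun2 F A B))"


section \<open>The homotopy category of a quasi-category\<close>

text \<open>Two edges are homotopic if there is a 2-simplex with \<open>d\<^sub>2 = f\<close>, \<open>d\<^sub>1 = g\<close> and degenerate \<open>d\<^sub>0\<close>. In a
  quasi-category this is an equivalence relation on edges, and the morphisms of the homotopy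
  category are its classes.\<close>

definition edge_homotopic :: "'x sset \<Rightarrow> 'x \<Rightarrow> 'x \<Rightarrow> bool" where
  "edge_homotopic X f g \<longleftrightarrow>
     (\<exists>s\<in>simplices X 2. act X 2 [0, 1] s = f \<and> act X 2 [0, 2] s = g \<and>
        act X 2 [1, 2] s = act X 1 [1, 1] f)"

definition edge_class :: "'x sset \<Rightarrow> 'x \<Rightarrow> 'x set" where
  "edge_class X f = {g. edge_homotopic X f g}"

text \<open>The composite of two classes is the set of all composites \<open>d\<^sub>1 s\<close> exhibited by 2-simplices \<open>s\<close>
  with \<open>d\<^sub>2 s\<close> and \<open>d\<^sub>0 s\<close> in the given classes; in a quasi-category this is a single class.\<close>

definition ho :: "'x sset \<Rightarrow> ('x, 'x set) cat" where
  "ho X = \<lparr>cobj = simplices X 0,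
           chom = (\<lambda>x y. {edge_class X f | f.
                     f \<in> simplices X 1 \<and> act X 1 [0] f = x \<and> act X 1 [1] f = y}),
           cid = (\<lambda>x. edge_class X (act X 0 [0, 0] x)),
           ccomp = (\<lambda>G F. {act X 2 [0, 2] s | s.
                     s \<in> simplices X 2 \<and> act X 2 [0, 1] s \<in> F \<and> act X 2 [1, 2] s \<in> G})\<rparr>"

text \<open>The action on morphisms of the functor \<open>ho X \<rightarrow> ho Y\<close> induced by \<open>f : X \<rightarrow> Y\<close>.\<close>

definition ho_map :: "'y sset \<Rightarrow> (nat \<Rightarrow> 'x \<Rightarrow> 'y) \<Rightarrow> 'x set \<Rightarrow> 'y set" where
  "ho_map Y f c = (\<Union>x\<in>c. edge_class Y (f 1 x))"


section \<open>Simplicially enriched categories\<close>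

text \<open>\<open>ecomp K A B C n\<close> is the composition \<open>Fun(B,C)\<^sub>n \<times> Fun(A,B)\<^sub>n \<rightarrow> Fun(A,C)\<^sub>n\<close>, in the order
  \<open>g, f\<close>; \<open>isofib K A B\<close> is the set of those functors \<open>A \<rightarrow> B\<close> that are specified as isofibrations.\<close>

record ('o, 'h) cosmos =
  obj :: "'o set"
  Fun :: "'o \<Rightarrow> 'o \<Rightarrow> 'h sset"
  ident :: "'o \<Rightarrow> 'h"
  ecomp :: "'o \<Rightarrow> 'o \<Rightarrow> 'o \<Rightarrow> nat \<Rightarrow> 'h \<Rightarrow> 'h \<Rightarrow> 'h"
  isofib :: "'o \<Rightarrow> 'o \<Rightarrow> 'h set"

abbreviation functors :: "('o, 'h) cosmos \<Rightarrow> 'o \<Rightarrow> 'o \<Rightarrow> 'h set" where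
  "functors K A B \<equiv> simplices (Fun K A B) 0"

text \<open>The totally degenerate \<open>n\<close>-simplex on a functor.\<close>

definition dgn :: "('o, 'h) cosmos \<Rightarrow> 'o \<Rightarrow> 'o \<Rightarrow> nat \<Rightarrow> 'h \<Rightarrow> 'h" where
  "dgn K A B n f = act (Fun K A B) 0 (op_const n) f"

abbreviation comp0 :: "('o, 'h) cosmos \<Rightarrow> 'o \<Rightarrow> 'o \<Rightarrow> 'o \<Rightarrow> 'h \<Rightarrow> 'h \<Rightarrow> 'h" where
  "comp0 K A B C g f \<equiv> ecomp K A B C 0 g f"

text \<open>\<open>Fun(X, f) : Fun(X, A) \<rightarrow> Fun(X, B)\<close> for a functor \<open>f : A \<rightarrow> B\<close>.\<close>

definition post :: "('o, 'h) cosmos \<Rightarrow> 'o \<Rightarrow> 'o \<Rightarrow> 'o \<Rightarrow> 'h \<Rightarrow> nat \<Rightarrow> 'h \<Rightarrow> 'h" where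
  "post K X A B f n x = ecomp K X A B n (dgn K A B n f) x"

definition simplicial_category :: "('o, 'h) cosmos \<Rightarrow> bool" where
  "simplicial_category K \<longleftrightarrow>
     (\<forall>A\<in>obj K. \<forall>B\<in>obj K. is_sset (Fun K A B)) \<and>
     (\<forall>A\<in>obj K. ident K A \<in> functors K A A) \<and>
     (\<forall>A\<in>obj K. \<forall>B\<in>obj K. \<forall>C\<in>obj K.
        smap (sset_prod (Fun K B C) (Fun K A B)) (Fun K A C) (\<lambda>n (g, f). ecomp K A B C n g f)) \<and>
     (\<forall>A\<in>obj K. \<forall>B\<in>obj K. \<forall>n. \<forall>f\<in>simplices (Fun K A B) n.
        ecomp K A A B n f (dgn K A A n (ident K A)) = f \<and>
        ecomp K A B B n (dgn K B B n (ident K B)) f = f) \<and>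
     (\<forall>A\<in>obj K. \<forall>B\<in>obj K. \<forall>C\<in>obj K. \<forall>D\<in>obj K. \<forall>n.
        \<forall>f\<in>simplices (Fun K A B) n. \<forall>g\<in>simplices (Fun K B C) n. \<forall>h\<in>simplices (Fun K C D) n.
        ecomp K A C D n h (ecomp K A B C n g f) = ecomp K A B D n (ecomp K B C D n h g) f)"

definition is_iso :: "('o, 'h) cosmos \<Rightarrow> 'o \<Rightarrow> 'o \<Rightarrow> 'h \<Rightarrow> bool" where
  "is_iso K A B f \<longleftrightarrow> f \<in> functors K A B \<and>
     (\<exists>g\<in>functors K B A. comp0 K A B A g f = ident K A \<and> comp0 K B A B f g = ident K B)"

text \<open>Limits in the simplicially enriched sense: the universal property is an isomorphism of
  simplicial sets, that is, a bijection in every dimension \<open>n\<close>.\<close>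

definition is_terminal :: "('o, 'h) cosmos \<Rightarrow> 'o \<Rightarrow> bool" where
  "is_terminal K T \<longleftrightarrow> T \<in> obj K \<and> (\<forall>X\<in>obj K. \<forall>n. \<exists>!t. t \<in> simplices (Fun K X T) n)"

definition is_product :: "('o, 'h) cosmos \<Rightarrow> 'o \<Rightarrow> 'o \<Rightarrow> 'o \<Rightarrow> 'h \<Rightarrow> 'h \<Rightarrow> bool" where
  "is_product K A B P a b \<longleftrightarrow> A \<in> obj K \<and> B \<in> obj K \<and> P \<in> obj K \<and>
     a \<in> functors K P A \<and> b \<in> functors K P B \<and>
     (\<forall>X\<in>obj K. \<forall>n. bij_betw (\<lambda>z. (post K X P A a n z, post K X P B b n z))
        (simplices (Fun K X P) n) (simplices (Fun K X A) n \<times> simplices (Fun K X B) n))"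

text \<open>\<open>P\<close> with \<open>a : P \<rightarrow> A\<close> and \<open>e : P \<rightarrow> E\<close> is a pullback of \<open>p : E \<rightarrow> B\<close> along \<open>f : A \<rightarrow> B\<close>.\<close>

definition is_pullback :: "('o, 'h) cosmos \<Rightarrow> 'o \<Rightarrow> 'o \<Rightarrow> 'o \<Rightarrow> 'h \<Rightarrow> 'h \<Rightarrow>
    'o \<Rightarrow> 'h \<Rightarrow> 'h \<Rightarrow> bool" where
  "is_pullback K A E B f p P a e \<longleftrightarrow>
     A \<in> obj K \<and> E \<in> obj K \<and> B \<in> obj K \<and> P \<in> obj K \<and>
     f \<in> functors K A B \<and> p \<in> functors K E B \<and> a \<in> functors K P A \<and> e \<in> functors K P E \<and>
     comp0 K P A B f a = comp0 K P E B p e \<and>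
     (\<forall>X\<in>obj K. \<forall>n. bij_betw (\<lambda>z. (post K X P A a n z, post K X P E e n z))
        (simplices (Fun K X P) n)
        {(x, y). x \<in> simplices (Fun K X A) n \<and> y \<in> simplices (Fun K X E) n \<and>
                 post K X A B f n x = post K X E B p n y})"

text \<open>\<open>P\<close> with \<open>t : U \<rightarrow> Fun(P, A)\<close> is a cotensor \<open>A\<^sup>U\<close>: the map \<open>Fun(X, P) \<rightarrow> Fun(X, A)\<^sup>U\<close> obtained
  from \<open>t\<close> and composition is an isomorphism for all \<open>X\<close>.\<close>

definition cotensor_compare :: "('o, 'h) cosmos \<Rightarrow> 'u sset \<Rightarrow> 'o \<Rightarrow> 'o \<Rightarrow> (nat \<Rightarrow> 'u \<Rightarrow> 'h) \<Rightarrow>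
    'o \<Rightarrow> nat \<Rightarrow> 'h \<Rightarrow> nat \<Rightarrow> 'u \<times> nat list \<Rightarrow> 'h" where
  "cotensor_compare K U A P t X n z = (\<lambda>k. \<lambda>(u, b) \<in> simplices (sset_prod U (std_simplex n)) k.
     ecomp K X P A k (t k u) (act (Fun K X P) n b z))"

definition is_cotensor ::
  "('o, 'h) cosmos \<Rightarrow> 'u sset \<Rightarrow> 'o \<Rightarrow> 'o \<Rightarrow> (nat \<Rightarrow> 'u \<Rightarrow> 'h) \<Rightarrow> bool" where
  "is_cotensor K U A P t \<longleftrightarrow> A \<in> obj K \<and> P \<in> obj K \<and> smap U (Fun K P A) t \<and>
     (\<forall>X\<in>obj K. \<forall>n. bij_betw (cotensor_compare K U A P t X n)
        (simplices (Fun K X P) n) (simplices (sset_exp (Fun K X A) U) n))"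

text \<open>\<open>q\<close> is the functor \<open>p\<^sup>U : E\<^sup>U \<rightarrow> B\<^sup>U\<close> between the cotensors \<open>(EU, s)\<close> and \<open>(BU, t)\<close>.\<close>

definition cotensor_post :: "('o, 'h) cosmos \<Rightarrow> 'u sset \<Rightarrow> 'o \<Rightarrow> 'o \<Rightarrow> 'h \<Rightarrow>
    'o \<Rightarrow> (nat \<Rightarrow> 'u \<Rightarrow> 'h) \<Rightarrow> 'o \<Rightarrow> (nat \<Rightarrow> 'u \<Rightarrow> 'h) \<Rightarrow> 'h \<Rightarrow> bool" where
  "cotensor_post K U E B p EU s BU t q \<longleftrightarrow> q \<in> functors K EU BU \<and>
     (\<forall>n. \<forall>u\<in>simplices U n. ecomp K EU BU B n (t n u) (dgn K EU BU n q) =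
                             ecomp K EU E B n (dgn K E B n p) (s n u))"

text \<open>For \<open>U \<subseteq> V\<close>, \<open>r\<close> is the restriction \<open>A\<^sup>V \<rightarrow> A\<^sup>U\<close> between the cotensors \<open>(AV, s)\<close> and \<open>(AU, t)\<close>.\<close>

definition cotensor_restrict :: "('o, 'h) cosmos \<Rightarrow> 'u sset \<Rightarrow> 'o \<Rightarrow>
    'o \<Rightarrow> (nat \<Rightarrow> 'u \<Rightarrow> 'h) \<Rightarrow> 'o \<Rightarrow> (nat \<Rightarrow> 'u \<Rightarrow> 'h) \<Rightarrow> 'h \<Rightarrow> bool" where
  "cotensor_restrict K U A AV s AU t r \<longleftrightarrow> r \<in> functors K AV AU \<and>
     (\<forall>n. \<forall>u\<in>simplices U n. ecomp K AV AU A n (t n u) (dgn K AV AU n r) = s n u)"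


section \<open>\<infinity>-cosmoi\<close>

text \<open>HOL cannot quantify over all types inside a definition, so the size of the simplicial sets by
  which one cotensors is a parameter: they are the simplicial sets with simplices in an arbitrary
  infinite type \<open>'u\<close>, hence up to isomorphism all simplicial sets of at most that cardinality (in
  particular \<open>\<Delta>\<^sup>n\<close> and the nerve of the walking isomorphism).

  In the last condition on cotensors, \<open>P\<close> is \<open>E\<^sup>U \<times>\<^bsub>B\<^sup>U\<^esub> B\<^sup>V\<close> and \<open>l : E\<^sup>V \<rightarrow> P\<close> is the induced functor.\<close>

definition infinity_cosmos :: "'u::infinite itself \<Rightarrow> ('o, 'h) cosmos \<Rightarrow> bool" where
  "infinity_cosmos _ K \<longleftrightarrow> simplicial_category K \<and>
     (\<forall>A\<in>obj K. \<forall>B\<in>obj K. quasi_category (Fun K A B)) \<and>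
     (\<forall>A\<in>obj K. \<forall>B\<in>obj K. isofib K A B \<subseteq> functors K A B) \<and>
     (\<forall>A\<in>obj K. \<forall>B\<in>obj K. \<forall>C\<in>obj K. \<forall>f\<in>isofib K A B. \<forall>g\<in>isofib K B C.
        comp0 K A B C g f \<in> isofib K A C) \<and>
     (\<exists>T. is_terminal K T) \<and>
     (\<forall>U :: 'u sset. \<forall>A\<in>obj K. is_sset U \<longrightarrow> (\<exists>P t. is_cotensor K U A P t)) \<and>
     (\<forall>A\<in>obj K. \<forall>E\<in>obj K. \<forall>B\<in>obj K. \<forall>f\<in>functors K A B. \<forall>p\<in>isofib K E B.
        \<exists>P a e. is_pullback K A E B f p P a e) \<and>
     (\<forall>A\<in>obj K. \<forall>B\<in>obj K. \<forall>f. is_iso K A B f \<longrightarrow> f \<in> isofib K A B) \<and>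
     (\<forall>A\<in>obj K. \<forall>T. is_terminal K T \<longrightarrow> functors K A T \<subseteq> isofib K A T) \<and>
     (\<forall>A E B f p P a e. is_pullback K A E B f p P a e \<longrightarrow> p \<in> isofib K E B \<longrightarrow>
        a \<in> isofib K P A) \<and>
     (\<forall>E\<in>obj K. \<forall>B\<in>obj K. \<forall>p\<in>isofib K E B. \<forall>(U :: 'u sset) V. sub_sset U V \<longrightarrow>
        (\<forall>EV sV EU sU BV tV BU tU pV pU rE rB P a e l.
           is_cotensor K V E EV sV \<longrightarrow> is_cotensor K U E EU sU \<longrightarrow>
           is_cotensor K V B BV tV \<longrightarrow> is_cotensor K U B BU tU \<longrightarrow>
           cotensor_post K V E B p EV sV BV tV pV \<longrightarrow> cotensor_post K U E B p EU sU BU tU pU \<longrightarrow>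
           cotensor_restrict K U E EV sV EU sU rE \<longrightarrow> cotensor_restrict K U B BV tV BU tU rB \<longrightarrow>
           is_pullback K BV EU BU rB pU P a e \<longrightarrow>
           l \<in> functors K EV P \<longrightarrow> comp0 K EV P EU e l = rE \<longrightarrow> comp0 K EV P BV a l = pV \<longrightarrow>
           l \<in> isofib K EV P)) \<and>
     (\<forall>X\<in>obj K. \<forall>E\<in>obj K. \<forall>B\<in>obj K. \<forall>p\<in>isofib K E B.
        qc_isofibration (Fun K X E) (Fun K X B) (post K X E B p))"

definition is_equivalence :: "('o, 'h) cosmos \<Rightarrow> 'o \<Rightarrow> 'o \<Rightarrow> 'h \<Rightarrow> bool" where
  "is_equivalence K A B f \<longleftrightarrow> f \<in> functors K A B \<and>
     (\<forall>X\<in>obj K. qc_equivalence (Fun K X A) (Fun K X B) (post K X A B f))"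

definition equivalent :: "('o, 'h) cosmos \<Rightarrow> 'o \<Rightarrow> 'o \<Rightarrow> bool" where
  "equivalent K A B \<longleftrightarrow> (\<exists>f. is_equivalence K A B f)"

text \<open>Equivalence and isomorphism over \<open>Z\<close> of \<open>e : E \<rightarrow> Z\<close> and \<open>d : D \<rightarrow> Z\<close>.\<close>

definition equivalent_over ::
  "('o, 'h) cosmos \<Rightarrow> 'o \<Rightarrow> 'o \<Rightarrow> 'h \<Rightarrow> 'o \<Rightarrow> 'h \<Rightarrow> bool" where
  "equivalent_over K Z E e D d \<longleftrightarrow> (\<exists>w. is_equivalence K E D w \<and> comp0 K E D Z d w = e)"

definition isomorphic_over ::
  "('o, 'h) cosmos \<Rightarrow> 'o \<Rightarrow> 'o \<Rightarrow> 'h \<Rightarrow> 'o \<Rightarrow> 'h \<Rightarrow> bool" where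
  "isomorphic_over K Z E e D d \<longleftrightarrow> (\<exists>w. is_iso K E D w \<and> comp0 K E D Z d w = e)"

definition homotopy_2_category :: "('o, 'h) cosmos \<Rightarrow> ('o, 'h, 'h set) two_cat" where
  "homotopy_2_category K =
     \<lparr>tobj = obj K,
      thom = (\<lambda>A B. ho (Fun K A B)),
      tid = ident K,
      tcomp1 = (\<lambda>A B C g f. comp0 K A B C g f),
      tcomp2 = (\<lambda>A B C b a. \<Union>y\<in>b. \<Union>x\<in>a. edge_class (Fun K A C) (ecomp K A B C 1 y x))\<rparr>"

definition groupoidal :: "('o, 'h) cosmos \<Rightarrow> 'o \<Rightarrow> bool" where
  "groupoidal K E \<longleftrightarrow> (\<forall>X\<in>obj K. is_groupoid (thom (homotopy_2_category K) X E))"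

text \<open>Let \<open>(Z, c, b)\<close> be a product \<open>C \<times> B\<close>. Then \<open>d : D \<rightarrow> Z\<close> is a comma \<open>(p\<^sub>1, p\<^sub>0) : f \<down> g \<rightarrow> C \<times> B\<close> of
  \<open>g : C \<rightarrow> A\<close> and \<open>f : B \<rightarrow> A\<close> if it is the pullback of \<open>p : A\<^sup>2 \<rightarrow> A \<times> A\<close> along \<open>h = g \<times> f\<close>, where
  \<open>(Y, y1, y0)\<close> is a product \<open>A \<times> A\<close>, \<open>(A2, t)\<close> a cotensor of \<open>A\<close> by \<open>\<Delta>\<^sup>1\<close>, and the components of
  \<open>p\<close> are the evaluations at the vertices \<open>1\<close> (codomain) and \<open>0\<close> (domain).\<close>

definition is_comma :: "('o, 'h) cosmos \<Rightarrow> 'o \<Rightarrow> 'o \<Rightarrow> 'o \<Rightarrow> 'h \<Rightarrow> 'h \<Rightarrow>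
    'o \<Rightarrow> 'h \<Rightarrow> 'h \<Rightarrow> 'o \<Rightarrow> 'h \<Rightarrow> bool" where
  "is_comma K A B C f g Z c b D d \<longleftrightarrow> is_product K C B Z c b \<and>
     (\<exists>Y y1 y0 A2 t p h q.
        is_product K A A Y y1 y0 \<and>
        is_cotensor K (std_simplex 1) A A2 t \<and>
        p \<in> functors K A2 Y \<and> comp0 K A2 Y A y1 p = t 0 [1] \<and> comp0 K A2 Y A y0 p = t 0 [0] \<and>
        h \<in> functors K Z Y \<and> comp0 K Z Y A y1 h = comp0 K Z C A g c \<and>
                              comp0 K Z Y A y0 h = comp0 K Z B A f b \<and>
        is_pullback K Z A2 Y h p D d q)"


section \<open>Functors and weak equivalences of \<infinity>-cosmoi\<close>

record ('o, 'h, 'p, 'l) cosmos_fun =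
  fobj :: "'o \<Rightarrow> 'p"
  fmap :: "'o \<Rightarrow> 'o \<Rightarrow> nat \<Rightarrow> 'h \<Rightarrow> 'l"

definition simplicial_functor ::
  "('o, 'h) cosmos \<Rightarrow> ('p, 'l) cosmos \<Rightarrow> ('o, 'h, 'p, 'l) cosmos_fun \<Rightarrow> bool" where
  "simplicial_functor K L F \<longleftrightarrow> fobj F \<in> obj K \<rightarrow> obj L \<and>
     (\<forall>A\<in>obj K. \<forall>B\<in>obj K. smap (Fun K A B) (Fun L (fobj F A) (fobj F B)) (fmap F A B)) \<and>
     (\<forall>A\<in>obj K. fmap F A A 0 (ident K A) = ident L (fobj F A)) \<and>
     (\<forall>A\<in>obj K. \<forall>B\<in>obj K. \<forall>C\<in>obj K. \<forall>n.
        \<forall>f\<in>simplices (Fun K A B) n. \<forall>g\<in>simplices (Fun K B C) n.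
        fmap F A C n (ecomp K A B C n g f) =
          ecomp L (fobj F A) (fobj F B) (fobj F C) n (fmap F B C n g) (fmap F A B n f))"

definition cosmos_functor :: "'u::infinite itself \<Rightarrow> ('o, 'h) cosmos \<Rightarrow> ('p, 'l) cosmos \<Rightarrow>
    ('o, 'h, 'p, 'l) cosmos_fun \<Rightarrow> bool" where
  "cosmos_functor u K L F \<longleftrightarrow> infinity_cosmos u K \<and> infinity_cosmos u L \<and>
     simplicial_functor K L F \<and>
     (\<forall>A\<in>obj K. \<forall>B\<in>obj K. fmap F A B 0 \<in> isofib K A B \<rightarrow> isofib L (fobj F A) (fobj F B)) \<and>
     (\<forall>T. is_terminal K T \<longrightarrow> is_terminal L (fobj F T)) \<and>
     (\<forall>(U :: 'u sset) A P t. is_sset U \<longrightarrow> is_cotensor K U A P t \<longrightarrow>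
        is_cotensor L U (fobj F A) (fobj F P) (\<lambda>n s. fmap F P A n (t n s))) \<and>
     (\<forall>A E B f p P a e. is_pullback K A E B f p P a e \<longrightarrow> p \<in> isofib K E B \<longrightarrow>
        is_pullback L (fobj F A) (fobj F E) (fobj F B) (fmap F A B 0 f) (fmap F E B 0 p)
          (fobj F P) (fmap F P A 0 a) (fmap F P E 0 e))"

definition cosmos_weak_equivalence :: "'u::infinite itself \<Rightarrow> ('o, 'h) cosmos \<Rightarrow>
    ('p, 'l) cosmos \<Rightarrow> ('o, 'h, 'p, 'l) cosmos_fun \<Rightarrow> bool" where
  "cosmos_weak_equivalence u K L F \<longleftrightarrow> cosmos_functor u K L F \<and>
     (\<forall>X\<in>obj L. \<exists>A\<in>obj K. equivalent L (fobj F A) X) \<and>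
     (\<forall>A\<in>obj K. \<forall>B\<in>obj K.
        qc_equivalence (Fun K A B) (Fun L (fobj F A) (fobj F B)) (fmap F A B))"

definition homotopy_2_functor :: "('p, 'l) cosmos \<Rightarrow> ('o, 'h, 'p, 'l) cosmos_fun \<Rightarrow>
    ('o, 'h, 'h set, 'p, 'l, 'l set) two_fun" where
  "homotopy_2_functor L F =
     \<lparr>tfobj = fobj F,
      tfun1 = (\<lambda>A B. fmap F A B 0),
      tfun2 = (\<lambda>A B. ho_map (Fun L (fobj F A) (fobj F B)) (fmap F A B))\<rparr>"

end

theory Submission
  imports Defs "HOL-Library.Nat_Bijection"
begin

text \<open>The argument runs on paths \<open>\<I> \<rightarrow> Fun(A, B)\<close>, where \<open>\<I>\<close> is the walking isomorphism, so that an
  isomorphism in a homotopy category never has to be extended to a coherent one. Such paths compose: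
  by the Leibniz axiom \<open>A\<^sup>\<I> \<rightarrow> A \<times> A\<close> is an isofibration, and paths lift along isofibrations. Hence a
  functor \<open>f\<close> is an equivalence iff there are a functor \<open>g\<close> and paths from \<open>id\<close> to \<open>gf\<close> and from \<open>fg\<close> to
  \<open>id\<close>. A local equivalence \<open>F\<close> preserves and reflects the existence of paths and hits every functor
  \<open>FA \<rightarrow> FB\<close> up to a path; therefore it preserves and reflects equivalences.

  An equivalence \<open>FE \<rightarrow> F(f \<down> g)\<close> over \<open>FC \<times> FB\<close> is joined by a path to \<open>Fu\<close> for some \<open>u\<close>. Then \<open>u\<close>
  commutes with the projections up to a path, and lifting that path along the isofibration
  \<open>f \<down> g \<rightarrow> C \<times> B\<close> replaces \<open>u\<close> by an equivalence that commutes strictly.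

  The statements about homotopy categories hold because an equivalence of quasi-categories induces an
  equivalence of homotopy categories.\<close>

section \<open>Simplicial sets and maps\<close>

text \<open>Extending an isomorphism of a homotopy category to a map out of the walking isomorphism
  would require filling special outer horns in all dimensions. Working with paths from the start
  avoids this: the only horns filled explicitly are inner ones of dimension 2 and 3, and they serve
  to make homotopy categories into categories. The cost is that transitivity of \<open>ipath\<close>
  becomes a statement about the mapping quasi-categories of a cosmos, where cotensors and
  isofibrations are at hand, and not about an arbitrary quasi-category.

  Essential surjectivity of F on objects enters twice: for the biequivalence, and for groupoidal
  objects, where a test object of \<open>L\<close> is replaced by an equivalent one in the image of
  F.

  The clause on commas fixes no choice of products, cotensors or pullbacks. The comparison between F
  of a comma in \<open>K\<close> and a comma in \<open>L\<close> therefore rests on uniqueness up to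
  isomorphism, and the comparison j of the two products has to be carried through all of it.\<close>

lemma is_sset_act_in:
  "\<lbrakk>is_sset X; a \<in> ops m n; x \<in> simplices X n\<rbrakk> \<Longrightarrow> act X n a x \<in> simplices X m"
  unfolding is_sset_def by blast

lemma is_sset_act_id: "\<lbrakk>is_sset X; x \<in> simplices X n\<rbrakk> \<Longrightarrow> act X n (op_id n) x = x"
  unfolding is_sset_def by blast

lemma is_sset_act_act:
  "\<lbrakk>is_sset X; a \<in> ops m n; b \<in> ops k m; x \<in> simplices X n\<rbrakk>
    \<Longrightarrow> act X m b (act X n a x) = act X n (op_comp a b) x"
  unfolding is_sset_def by blast

lemma smap_in: "\<lbrakk>smap X Y f; x \<in> simplices X n\<rbrakk> \<Longrightarrow> f n x \<in> simplices Y n"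
  unfolding smap_def by blast

lemma smap_act:
  "\<lbrakk>smap X Y f; a \<in> ops m n; x \<in> simplices X n\<rbrakk> \<Longrightarrow> f m (act X n a x) = act Y n a (f n x)"
  unfolding smap_def by blast

lemma smapI:
  assumes "\<And>n x. x \<in> simplices X n \<Longrightarrow> f n x \<in> simplices Y n"
    and "\<And>m n a x. a \<in> ops m n \<Longrightarrow> x \<in> simplices X n \<Longrightarrow> f m (act X n a x) = act Y n a (f n x)"
  shows "smap X Y f"
  using assms unfolding smap_def by blast

lemma smap_comp:
  "\<lbrakk>smap X Y f; smap Y Z g\<rbrakk> \<Longrightarrow> smap X Z (\<lambda>n x. g n (f n x))"
  unfolding smap_def by (auto simp: Pi_iff)

lemma op_id_in: "op_id n \<in> ops n n"
  by (auto simp: op_id_def ops_def simp del: upt_Suc)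

lemma op_const_in: "op_const m \<in> ops m n"
  by (auto simp: op_const_def ops_def)

lemma ops_0_eq_const: "s \<in> ops n 0 \<Longrightarrow> s = op_const n"
  unfolding ops_def op_const_def by (auto intro!: replicate_eqI simp del: replicate_Suc)

lemma op_comp_in: "\<lbrakk>a \<in> ops m n; b \<in> ops k m\<rbrakk> \<Longrightarrow> op_comp a b \<in> ops k n"
proof -
  assume a: "a \<in> ops m n" and b: "b \<in> ops k m"
  have "sorted (op_comp a b)"
    using a b unfolding op_comp_def ops_def
    by (auto simp: sorted_iff_nth_mono subset_iff less_Suc_eq_le)
  moreover have "set (op_comp a b) \<subseteq> {..n}"
    using a b unfolding op_comp_def ops_def
    by (auto simp: subset_iff less_Suc_eq_le)
  ultimately show ?thesis
    using b by (auto simp: ops_def op_comp_def)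
qed

lemma op_comp_id_right: "a \<in> ops m n \<Longrightarrow> op_comp a (op_id m) = a"
  unfolding op_comp_def op_id_def ops_def using map_nth[of a] by simp

lemma op_comp_id_left: "a \<in> ops m n \<Longrightarrow> op_comp (op_id n) a = a"
  unfolding op_comp_def op_id_def ops_def
  by (auto intro!: map_idI simp: subset_iff less_Suc_eq_le simp del: upt_Suc)

lemma op_comp_assoc:
  "b \<in> ops k m \<Longrightarrow> c \<in> ops l k \<Longrightarrow> op_comp (op_comp a b) c = op_comp a (op_comp b c)"
  unfolding op_comp_def ops_def by (auto simp: subset_iff less_Suc_eq_le)

lemma op_comp_const: "b \<in> ops k m \<Longrightarrow> op_comp (op_const m) b = op_const k"
  unfolding op_comp_def ops_def op_const_def
  by (auto simp: subset_iff less_Suc_eq_le map_eq_conv intro!: replicate_eqI simp del: replicate_Suc)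

lemma op_const_0: "op_const 0 = op_id 0"
  by (simp add: op_const_def op_id_def)

lemma is_sset_std_simplex: "is_sset (std_simplex n)"
  unfolding is_sset_def std_simplex_def
  by (auto simp: op_comp_in op_comp_id_right op_comp_assoc)

text \<open>The direction of the Yoneda lemma that turns a simplex into a map. It is used for a
  vertex, as the initial datum of a lifting problem.\<close>

lemma smap_yoneda:
  "is_sset X \<Longrightarrow> x \<in> simplices X n \<Longrightarrow> smap (std_simplex n) X (\<lambda>m a. act X n a x)"
  by (rule smapI) (auto simp: std_simplex_def is_sset_act_in is_sset_act_act)

lemma is_sset_walking_iso: "is_sset walking_iso"
proof -
  have "op_comp a b \<in> {x. length x = Suc m \<and> set x \<subseteq> {0, 1}}"
    if "b \<in> ops m n" "length a = Suc n" "set a \<subseteq> {0,1}" for a b m n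
    using that unfolding op_comp_def ops_def
    by (auto simp: subset_iff less_Suc_eq_le) (metis One_nat_def less_Suc_eq_le nth_mem)
  moreover have "op_comp a (op_id n) = a" if "length a = Suc n" for a n
    using that map_nth[of a] unfolding op_comp_def op_id_def by simp
  ultimately show ?thesis
    unfolding is_sset_def walking_iso_def by (auto simp: op_comp_assoc)
qed

section \<open>Inner horns by their faces\<close>

text \<open>The i-th coface operator [n - 1] \<rightarrow> [n].\<close>

definition face :: "nat \<Rightarrow> nat \<Rightarrow> nat list" where
  "face n i = [0..<i] @ [i + 1..<n + 1]"

text \<open>Postcomposition with the i-th codegeneracy. On an operator that omits i it undoes
  postcomposition with \<open>face\<close>, so it computes the factorization through that
  face.\<close>

definition skip :: "nat \<Rightarrow> nat list \<Rightarrow> nat list" where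
  "skip i s = map (\<lambda>x. if i < x then x - 1 else x) s"

lemma face_nth: "i \<le> n \<Longrightarrow> x < n \<Longrightarrow> face n i ! x = (if x < i then x else Suc x)"
  unfolding face_def by (auto simp: nth_append simp del: upt_Suc)

lemma face_in: "i \<le> Suc n \<Longrightarrow> face (Suc n) i \<in> ops n (Suc n)"
  unfolding ops_def face_def by (auto simp: sorted_append simp del: upt_Suc)

lemma skip_in:
  assumes s: "s \<in> ops m (Suc n)" and i: "i \<le> Suc n" "i \<notin> set s"
  shows "skip i s \<in> ops m n"
proof -
  have "sorted s" using s by (simp add: ops_def)
  then have "sorted (skip i s)"
    unfolding skip_def sorted_map by (rule sorted_wrt_mono_rel[rotated]) auto
  moreover have "set (skip i s) \<subseteq> {..n}"
  proof
    fix y assume "y \<in> set (skip i s)"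
    then obtain x where x: "x \<in> set s" "y = (if i < x then x - 1 else x)"
      by (auto simp: skip_def)
    then have "x \<noteq> i" "x \<le> Suc n" using s i by (auto simp: ops_def)
    with x i show "y \<in> {..n}" by auto
  qed
  ultimately show ?thesis using s by (simp add: ops_def skip_def)
qed

lemma op_comp_face_skip:
  assumes s: "s \<in> ops m (Suc n)" and i: "i \<le> Suc n" "i \<notin> set s"
  shows "op_comp (face (Suc n) i) (skip i s) = s"
proof -
  have "face (Suc n) i ! (if i < x then x - 1 else x) = x" if "x \<in> set s" for x
  proof -
    have "x \<noteq> i" "x \<le> Suc n" using that s i by (auto simp: ops_def)
    then show ?thesis using i by (auto simp: face_nth)
  qed
  then show ?thesis unfolding op_comp_def skip_def by (simp add: map_idI)
qed

lemma skip_op_comp: "a \<in> ops m k \<Longrightarrow> length s = Suc k \<Longrightarrow> skip i (op_comp s a) = op_comp (skip i s) a"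
  unfolding skip_def op_comp_def ops_def by (auto simp: subset_iff less_Suc_eq_le)

text \<open>Once i is removed, the larger value j has become j - 1. Either side is the operator seen
  in the intersection of the faces opposite i and j.\<close>

lemma skip_skip:
  assumes "i < j" "i \<notin> set s" "j \<notin> set s"
  shows "skip (j - 1) (skip i s) = skip i (skip j s)"
proof -
  have "x \<noteq> i \<and> x \<noteq> j" if "x \<in> set s" for x using assms that by auto
  then show ?thesis using assms(1) unfolding skip_def by auto
qed

lemma skip_face: "i \<le> Suc n \<Longrightarrow> skip i (face (Suc n) i) = op_id n"
proof -
  assume i: "i \<le> Suc n"
  have len: "length (face (Suc n) i) = Suc n"
    using i by (simp add: face_def del: upt_Suc)
  then show ?thesis
    using i by (intro nth_equalityI) (auto simp: skip_def op_id_def face_nth simp del: upt_Suc)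
qed

text \<open>A horn is glued from its faces along their pairwise intersections, so a family of
  simplices that match there is a map out of the horn. The dimensions are variables tied by
  equations, not successor terms, so that callers can write them as numerals.\<close>

lemma inner_horn_filler:
  fixes X :: "'x sset" and x :: "nat \<Rightarrow> 'x"
  assumes X: "quasi_category X" and k: "0 < k" "k < N" and NM: "N = Suc M" "M = Suc n"
    and x': "\<And>i. i \<le> N \<Longrightarrow> i \<noteq> k \<Longrightarrow> x i \<in> simplices X M"
    and compat': "\<And>i j. \<lbrakk>i < j; j \<le> N; i \<noteq> k; j \<noteq> k\<rbrakk> \<Longrightarrow>
       act X M (face M i) (x j) = act X M (face M (j - 1)) (x i)"
  obtains w where "w \<in> simplices X N"
    "\<And>i. i \<le> N \<Longrightarrow> i \<noteq> k \<Longrightarrow> act X N (face N i) w = x i"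
proof -
  let ?N = "Suc (Suc n)"
  have N: "N = ?N" "M = Suc n" using NM by simp_all
  note x = x'[unfolded N] and compat = compat'[unfolded N]
  have sX: "is_sset X" using X by (simp add: quasi_category_def)
  \<comment> \<open>\<open>good s i\<close> means that s lies in the face opposite i and that this
    face belongs to the horn.\<close>
  define good where "good s i \<longleftrightarrow> i \<le> ?N \<and> i \<noteq> k \<and> i \<notin> set s" for s i
  define u where "u m s = act X (Suc n) (skip (SOME i. good s i) s) (x (SOME i. good s i))"
    for m :: nat and s
  \<comment> \<open>If s lies in two faces, it lies in their intersection, where
    \<open>compat\<close> makes both candidate values equal. Hence the choice made by
    \<open>SOME\<close> does not matter.\<close>
  have *: "act X (Suc n) (skip i s) (x i) = act X (Suc n) (skip j s) (x j)"
    if s: "s \<in> ops m ?N" and g: "good s i" "good s j" and "i < j" for s i j m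
  proof -
    let ?t = "skip i (skip j s)"
    have gs: "i \<le> ?N" "j \<le> ?N" "i \<noteq> k" "j \<noteq> k" "i \<notin> set s" "j \<notin> set s"
      using g by (auto simp: good_def)
    have si: "skip i s \<in> ops m (Suc n)" and sj: "skip j s \<in> ops m (Suc n)"
      using s gs by (auto intro: skip_in)
    have ni: "i \<notin> set (skip j s)" and nj: "j - 1 \<notin> set (skip i s)"
    proof -
      show "i \<notin> set (skip j s)" using gs \<open>i < j\<close> by (auto simp: skip_def)
      have "j - 1 \<noteq> (if i < x then x - 1 else x)" if "x \<in> set s" for x
        using that gs \<open>i < j\<close> by (cases "x = j"; cases "x = i") auto
      then show "j - 1 \<notin> set (skip i s)" unfolding skip_def set_map image_iff by blast
    qed
    have t: "?t \<in> ops m n" using sj ni \<open>i < j\<close> gs by (auto intro: skip_in)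
    have t': "skip (j - 1) (skip i s) = ?t" using gs \<open>i < j\<close> by (intro skip_skip)
    have "act X (Suc n) (skip j s) (x j) = act X (Suc n) (op_comp (face (Suc n) i) ?t) (x j)"
      using op_comp_face_skip[OF sj _ ni] gs \<open>i < j\<close> by simp
    also have "\<dots> = act X n ?t (act X (Suc n) (face (Suc n) i) (x j))"
      using is_sset_act_act[OF sX face_in t] x gs \<open>i < j\<close> by simp
    also have "\<dots> = act X n ?t (act X (Suc n) (face (Suc n) (j - 1)) (x i))"
      using compat gs \<open>i < j\<close> by simp
    also have "\<dots> = act X (Suc n) (op_comp (face (Suc n) (j - 1)) ?t) (x i)"
      using is_sset_act_act[OF sX face_in t] x gs \<open>i < j\<close> by simp
    also have "\<dots> = act X (Suc n) (skip i s) (x i)"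
      using op_comp_face_skip[OF si _ nj] gs \<open>i < j\<close> t' by simp
    finally show ?thesis by simp
  qed
  have u: "u m s = act X (Suc n) (skip i s) (x i)" if s: "s \<in> ops m ?N" and g: "good s i" for m s i
  proof -
    have g': "good s (SOME i. good s i)" using g by (rule someI)
    show ?thesis unfolding u_def
      using *[OF s g g'] *[OF s g' g] by (metis linorder_neqE_nat)
  qed
  have "smap (horn ?N k) X u"
  proof (rule smapI)
    fix m s assume "s \<in> simplices (horn ?N k) m"
    then obtain i where s: "s \<in> ops m ?N" and i: "good s i"
      by (auto simp: horn_def good_def)
    show "u m s \<in> simplices X m"
      unfolding u[OF s i] using i s x by (auto intro!: is_sset_act_in[OF sX] skip_in simp: good_def)
    fix l a assume a: "a \<in> ops l m"
    have i': "good (op_comp s a) i"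
      using i a s unfolding good_def ops_def op_comp_def by (auto simp: subset_iff less_Suc_eq_le)
    have "u l (op_comp s a) = act X (Suc n) (skip i (op_comp s a)) (x i)"
      using u[OF op_comp_in[OF s a] i'] .
    also have "skip i (op_comp s a) = op_comp (skip i s) a"
      using s a by (intro skip_op_comp) (auto simp: ops_def)
    also have "act X (Suc n) \<dots> (x i) = act X m a (act X (Suc n) (skip i s) (x i))"
      using is_sset_act_act[OF sX skip_in a] s i x by (auto simp: good_def)
    finally show "u l (act (horn ?N k) m a s) = act X m a (u m s)"
      unfolding u[OF s i] by (simp add: horn_def)
  qed
  then obtain w where w: "smap (std_simplex ?N) X w"
    and wu: "\<And>m s. s \<in> simplices (horn ?N k) m \<Longrightarrow> w m s = u m s"
    using X[unfolded quasi_category_def, THEN conjunct2, rule_format, of k ?N u] k N by auto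
  show thesis
  proof (rule that, unfold N)
    \<comment> \<open>By Yoneda the filler is a single simplex, the value of w at the identity
      operator.\<close>
    have id: "op_id ?N \<in> simplices (std_simplex ?N) ?N" by (simp add: std_simplex_def op_id_in)
    show "w ?N (op_id ?N) \<in> simplices X ?N" using smap_in[OF w id] .
    fix i assume i: "i \<le> ?N" "i \<noteq> k"
    have f: "face ?N i \<in> ops (Suc n) ?N" using face_in i by blast
    have g: "good (face ?N i) i" using i by (auto simp: good_def face_def)
    have "act X ?N (face ?N i) (w ?N (op_id ?N)) = w (Suc n) (op_comp (op_id ?N) (face ?N i))"
      using smap_act[OF w f id] by (simp add: std_simplex_def)
    also have "\<dots> = w (Suc n) (face ?N i)" using f by (simp add: op_comp_id_left)
    also have "\<dots> = u (Suc n) (face ?N i)"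
      using f g i by (intro wu) (auto simp: horn_def good_def)
    also have "\<dots> = x i"
      unfolding u[OF f g] using i x[OF i] by (simp add: skip_face is_sset_act_id[OF sX])
    finally show "act X ?N (face ?N i) (w ?N (op_id ?N)) = x i" .
  qed
qed

section \<open>Triangles\<close>

text \<open>A 2-simplex that exhibits h as a composite of f followed by g. Only its boundary is
  kept, because the arguments about homotopy categories depend on boundaries alone.\<close>

definition tri :: "'x sset \<Rightarrow> 'x \<Rightarrow> 'x \<Rightarrow> 'x \<Rightarrow> bool" where
  "tri X f g h \<longleftrightarrow> (\<exists>s\<in>simplices X 2. act X 2 [0, 1] s = f \<and> act X 2 [1, 2] s = g \<and> act X 2 [0, 2] s = h)"

abbreviation src :: "'x sset \<Rightarrow> 'x \<Rightarrow> 'x" where "src X f \<equiv> act X 1 [0] f"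
abbreviation tgt :: "'x sset \<Rightarrow> 'x \<Rightarrow> 'x" where "tgt X f \<equiv> act X 1 [1] f"
abbreviation unit_edge :: "'x sset \<Rightarrow> 'x \<Rightarrow> 'x" where "unit_edge X x \<equiv> act X 0 [0, 0] x"

lemma tri_edges:
  assumes X: "is_sset X" and t: "tri X f g h"
  shows "f \<in> simplices X 1" "g \<in> simplices X 1" "h \<in> simplices X 1"
    "tgt X f = src X g" "src X h = src X f" "tgt X h = tgt X g"
proof -
  have o: "[0,1] \<in> ops 1 2" "[1,2] \<in> ops 1 2" "[0,2] \<in> ops 1 2" "[0] \<in> ops 0 1" "[1] \<in> ops 0 1"
    by (auto simp: ops_def)
  show "f \<in> simplices X 1" "g \<in> simplices X 1" "h \<in> simplices X 1"
    "tgt X f = src X g" "src X h = src X f" "tgt X h = tgt X g"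
    using t o unfolding tri_def
    by (auto simp: is_sset_act_in[OF X] is_sset_act_act[OF X] op_comp_def)
qed

lemma edge_ends:
  assumes X: "is_sset X" and f: "f \<in> simplices X 1"
  shows "src X f \<in> simplices X 0" "tgt X f \<in> simplices X 0"
  using is_sset_act_in[OF X _ f] by (auto simp: ops_def)

lemma unit_edge_in: "is_sset X \<Longrightarrow> x \<in> simplices X 0 \<Longrightarrow> unit_edge X x \<in> simplices X 1"
  by (auto intro!: is_sset_act_in simp: ops_def)

lemma unit_edge_ends:
  assumes X: "is_sset X" and x: "x \<in> simplices X 0"
  shows "src X (unit_edge X x) = x" "tgt X (unit_edge X x) = x"
proof -
  have o: "[0,0] \<in> ops 1 0" "[0] \<in> ops 0 1" "[1] \<in> ops 0 1" by (auto simp: ops_def)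
  have "[0] = op_id 0" by (simp add: op_id_def)
  then have "act X 0 [0] x = x" using is_sset_act_id[OF X x] by simp
  then show "src X (unit_edge X x) = x" "tgt X (unit_edge X x) = x"
    using o x by (auto simp: is_sset_act_act[OF X] op_comp_def)
qed

lemma tri_unit_left:
  assumes X: "is_sset X" and f: "f \<in> simplices X 1"
  shows "tri X (unit_edge X (src X f)) f f"
proof -
  have o: "[0,0,1] \<in> ops 2 1" "[0,1] \<in> ops 1 2" "[1,2] \<in> ops 1 2" "[0,2] \<in> ops 1 2" "[0] \<in> ops 0 1"
     "[0,0] \<in> ops 1 0"
    by (auto simp: ops_def)
  have "[0,1] = op_id 1" by (simp add: op_id_def)
  then have "act X 1 [0,1] f = f" using is_sset_act_id[OF X f] by simp
  then show ?thesis unfolding tri_def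
    using o f by (intro bexI[of _ "act X 1 [0,0,1] f"])
      (auto simp: is_sset_act_act[OF X] op_comp_def is_sset_act_in[OF X])
qed

lemma tri_unit_right:
  assumes X: "is_sset X" and f: "f \<in> simplices X 1"
  shows "tri X f (unit_edge X (tgt X f)) f"
proof -
  have o: "[0,1,1] \<in> ops 2 1" "[0,1] \<in> ops 1 2" "[1,2] \<in> ops 1 2" "[0,2] \<in> ops 1 2" "[1] \<in> ops 0 1"
     "[0,0] \<in> ops 1 0"
    by (auto simp: ops_def)
  have "[0,1] = op_id 1" by (simp add: op_id_def)
  then have "act X 1 [0,1] f = f" using is_sset_act_id[OF X f] by simp
  then show ?thesis unfolding tri_def
    using o f by (intro bexI[of _ "act X 1 [0,1,1] f"])
      (auto simp: is_sset_act_act[OF X] op_comp_def is_sset_act_in[OF X])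
qed

text \<open>The inner horn of dimension 2; the faces opposite 0 and 2 have to match in the middle
  vertex, which is the hypothesis on f and g.\<close>

lemma tri_exists:
  assumes X: "quasi_category X" and f: "f \<in> simplices X 1" and g: "g \<in> simplices X 1"
    and fg: "tgt X f = src X g"
  shows "\<exists>h. tri X f g h"
proof -
  obtain w where w: "w \<in> simplices X 2"
    and wi: "\<And>i. i \<le> 2 \<Longrightarrow> i \<noteq> 1 \<Longrightarrow> act X 2 (face 2 i) w = (if i = 0 then g else f)"
  proof (rule inner_horn_filler[where n = 0 and k = 1 and N = 2 and M = 1
        and x = "\<lambda>i. if i = 0 then g else f", OF X])
    fix i j :: nat assume "i < j" "j \<le> 2" "i \<noteq> 1" "j \<noteq> 1"
    then have "i = 0" "j = 2" by auto
    then show "act X 1 (face 1 i) (if j = 0 then g else f) =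
       act X 1 (face 1 (j - 1)) (if i = 0 then g else f)"
      using fg by (simp add: face_def)
  qed (use f g in auto)
  have "face 2 0 = [1,2]" "face 2 2 = [0,1]" by (simp_all add: face_def upt_rec)
  then show ?thesis
    unfolding tri_def using w wi[of 0] wi[of 2]
    by (intro exI[of _ "act X 2 [0,2] w"] bexI[of _ w]) auto
qed

text \<open>The edge \<open>f\<^sub>i\<^sub>j\<close> joins the vertices \<open>i\<close> and \<open>j\<close> of a 3-simplex, whose face opposite to 1 or 2 is missing.\<close>

lemma
  assumes X: "quasi_category X" and a: "tri X f01 f12 f02" and b: "tri X f12 f23 f13"
  shows tri_fill1: "tri X f01 f13 f03 \<Longrightarrow> tri X f02 f23 f03"
    and tri_fill2: "tri X f02 f23 f03 \<Longrightarrow> tri X f01 f13 f03"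
proof -
  have sX: "is_sset X" using X by (simp add: quasi_category_def)
  have o: "[0,1] \<in> ops 1 2" "[1,2] \<in> ops 1 2" "[0,2] \<in> ops 1 2"
    "[1,2,3] \<in> ops 2 3" "[0,2,3] \<in> ops 2 3" "[0,1,3] \<in> ops 2 3" "[0,1,2] \<in> ops 2 3"
    by (auto simp: ops_def)
  have fc: "face 3 0 = [1,2,3]" "face 3 1 = [0,2,3]" "face 3 2 = [0,1,3]" "face 3 3 = [0,1,2]"
    "face 2 0 = [1,2]" "face 2 1 = [0,2]" "face 2 2 = [0,1]"
    by (simp_all add: face_def upt_rec)
  from a obtain s3 where s3: "s3 \<in> simplices X 2" "act X 2 [0,1] s3 = f01"
    "act X 2 [1,2] s3 = f12" "act X 2 [0,2] s3 = f02" unfolding tri_def by auto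
  from b obtain s0 where s0: "s0 \<in> simplices X 2" "act X 2 [0,1] s0 = f12"
    "act X 2 [1,2] s0 = f23" "act X 2 [0,2] s0 = f13" unfolding tri_def by auto
  {
    assume "tri X f01 f13 f03"
    then obtain s2 where s2: "s2 \<in> simplices X 2" "act X 2 [0,1] s2 = f01"
      "act X 2 [1,2] s2 = f13" "act X 2 [0,2] s2 = f03" unfolding tri_def by auto
    let ?x = "\<lambda>i::nat. if i = 0 then s0 else if i = 2 then s2 else s3"
    obtain w where w: "w \<in> simplices X 3"
      and wi: "\<And>i. i \<le> 3 \<Longrightarrow> i \<noteq> 1 \<Longrightarrow>
        act X 3 (face 3 i) w = ?x i"
    proof (rule inner_horn_filler[where n = 1 and k = 1 and N = 3 and M = 2 and x = ?x, OF X])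
      fix i j :: nat assume "i < j" "j \<le> 3" "i \<noteq> 1" "j \<noteq> 1"
      then have "i = 0 \<and> j = 2 \<or> i = 0 \<and> j = 3 \<or> i = 2 \<and> j = 3" by auto
      then show "act X 2 (face 2 i) (?x j) = act X 2 (face 2 (j - 1)) (?x i)"
        using s0 s2 s3 by (elim disjE) (simp_all add: fc fc[simplified])
    qed (use s0 s2 s3 in simp_all)
    note w3 = w
    have "act X 3 [1,2,3] w = s0" "act X 3 [0,1,3] w = s2" "act X 3 [0,1,2] w = s3"
      using wi[of 0] wi[of 2] wi[of 3] fc by auto
    then have "act X 3 [0,2] w = f02" "act X 3 [2,3] w = f23" "act X 3 [0,3] w = f03"
      using s0(3) s2(4) s3(4) w3 o by (auto simp: is_sset_act_act[OF sX] op_comp_def)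
    then show "tri X f02 f23 f03"
      unfolding tri_def using w3 o
      by (intro bexI[of _ "act X 3 [0,2,3] w"])
        (auto simp: is_sset_act_act[OF sX] op_comp_def is_sset_act_in[OF sX])
  }
  {
    assume "tri X f02 f23 f03"
    then obtain s1 where s1: "s1 \<in> simplices X 2" "act X 2 [0,1] s1 = f02"
      "act X 2 [1,2] s1 = f23" "act X 2 [0,2] s1 = f03" unfolding tri_def by auto
    let ?x = "\<lambda>i::nat. if i = 0 then s0 else if i = 1 then s1 else s3"
    obtain w where w: "w \<in> simplices X 3"
      and wi: "\<And>i. i \<le> 3 \<Longrightarrow> i \<noteq> 2 \<Longrightarrow>
        act X 3 (face 3 i) w = ?x i"
    proof (rule inner_horn_filler[where n = 1 and k = 2 and N = 3 and M = 2 and x = ?x, OF X])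
      fix i j :: nat assume "i < j" "j \<le> 3" "i \<noteq> 2" "j \<noteq> 2"
      then have "i = 0 \<and> j = 1 \<or> i = 0 \<and> j = 3 \<or> i = 1 \<and> j = 3" by auto
      then show "act X 2 (face 2 i) (?x j) = act X 2 (face 2 (j - 1)) (?x i)"
        using s0 s1 s3 by (elim disjE) (simp_all add: fc fc[simplified])
    qed (use s0 s1 s3 in simp_all)
    note w3 = w
    have "act X 3 [1,2,3] w = s0" "act X 3 [0,2,3] w = s1" "act X 3 [0,1,2] w = s3"
      using wi[of 0] wi[of 1] wi[of 3] fc by auto
    then have "act X 3 [0,1] w = f01" "act X 3 [1,3] w = f13" "act X 3 [0,3] w = f03"
      using s0(4) s1(4) s3(2) w3 o by (auto simp: is_sset_act_act[OF sX] op_comp_def)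
    then show "tri X f01 f13 f03"
      unfolding tri_def using w3 o
      by (intro bexI[of _ "act X 3 [0,1,3] w"])
        (auto simp: is_sset_act_act[OF sX] op_comp_def is_sset_act_in[OF sX])
  }
qed

lemma tri_smap:
  assumes f: "smap X Y f" and t: "tri X x y z"
  shows "tri Y (f 1 x) (f 1 y) (f 1 z)"
proof -
  obtain s where s: "s \<in> simplices X 2" "x = act X 2 [0,1] s" "y = act X 2 [1,2] s" "z = act X 2 [0,2] s"
    using t unfolding tri_def by auto
  have o: "[0,1] \<in> ops 1 2" "[1,2] \<in> ops 1 2" "[0,2] \<in> ops 1 2" by (auto simp: ops_def)
  show ?thesis unfolding tri_def
    using s smap_act[OF f o(1) s(1)] smap_act[OF f o(2) s(1)] smap_act[OF f o(3) s(1)]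
    by (intro bexI[of _ "f 2 s"]) (auto simp: smap_in[OF f])
qed

section \<open>The homotopy category\<close>

lemma quasi_category_is_sset: "quasi_category X \<Longrightarrow> is_sset X"
  by (simp add: quasi_category_def)

lemma act_11_eq_unit:
  assumes X: "is_sset X" and f: "f \<in> simplices X 1"
  shows "act X 1 [1, 1] f = unit_edge X (tgt X f)"
proof -
  have o: "[1] \<in> ops 0 1" "[0,0] \<in> ops 1 0" by (auto simp: ops_def)
  show ?thesis using is_sset_act_act[OF X o f] by (simp add: op_comp_def)
qed

text \<open>On an edge, the operator \<open>[1, 1]\<close> factors through the target. If f is not
  an edge, both sides fail, since each makes f a face of a 2-simplex.\<close>

lemma edge_homotopic_iff:
  assumes X: "is_sset X"
  shows "edge_homotopic X f g \<longleftrightarrow> tri X f (unit_edge X (tgt X f)) g"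
proof -
  have o: "[0,1] \<in> ops 1 2" by (auto simp: ops_def)
  have f: "act X 2 [0,1] s \<in> simplices X 1" if "s \<in> simplices X 2" for s
    using is_sset_act_in[OF X o that] .
  show ?thesis
  proof (cases "f \<in> simplices X 1")
    case True
    show ?thesis unfolding edge_homotopic_def tri_def act_11_eq_unit[OF X True] by blast
  next
    case False
    then have n: "act X 2 [0,1] s = f \<longleftrightarrow> False" if "s \<in> simplices X 2" for s
      using f[OF that] by auto
    show ?thesis unfolding edge_homotopic_def tri_def by (simp only: n simp_thms cong: bex_cong)
  qed
qed

lemma edge_homotopic_in:
  assumes X: "is_sset X" and e: "edge_homotopic X f g"
  shows "f \<in> simplices X 1" "g \<in> simplices X 1" "src X g = src X f" "tgt X g = tgt X f"
proof -
  have t: "tri X f (unit_edge X (tgt X f)) g" using e edge_homotopic_iff[OF X] by simp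
  note te = tri_edges[OF X t]
  then show "f \<in> simplices X 1" "g \<in> simplices X 1" "src X g = src X f" by auto
  show "tgt X g = tgt X f"
    using te unit_edge_ends[OF X, of "tgt X f"] edge_ends[OF X, of f] by simp
qed

context
  fixes X :: "'x sset"
  assumes X: "quasi_category X"
begin

private lemmas sX = quasi_category_is_sset[OF X]

lemma unit_edge_tri: "x \<in> simplices X 0 \<Longrightarrow> tri X (unit_edge X x) (unit_edge X x) (unit_edge X x)"
  using tri_unit_left[OF sX unit_edge_in[OF sX]] unit_edge_ends[OF sX] by metis

lemma edge_homotopic_refl: "f \<in> simplices X 1 \<Longrightarrow> edge_homotopic X f f"
  using tri_unit_right[OF sX] edge_homotopic_iff[OF sX] by simp

text \<open>The 3-simplex has f on 01 and 03, g on 02, and the unit of the target on 12, 13 and 23.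
  Its face 023 is the reversed homotopy.\<close>

lemma edge_homotopic_sym:
  assumes e: "edge_homotopic X f g"
  shows "edge_homotopic X g f"
proof -
  note i = edge_homotopic_in[OF sX e]
  have "tri X f (unit_edge X (tgt X f)) g" using e edge_homotopic_iff[OF sX] by simp
  moreover have "tri X f (unit_edge X (tgt X f)) f" using i tri_unit_right[OF sX] by blast
  moreover note unit_edge_tri[OF edge_ends(2)[OF sX i(1)]]
  ultimately have "tri X g (unit_edge X (tgt X f)) f" using tri_fill1[OF X] by blast
  then show ?thesis using i edge_homotopic_iff[OF sX] by simp
qed

lemma edge_homotopic_trans:
  assumes e: "edge_homotopic X f g" "edge_homotopic X g h"
  shows "edge_homotopic X f h"
proof -
  note i = edge_homotopic_in[OF sX e(1)]
  have "tri X f (unit_edge X (tgt X f)) g" "tri X g (unit_edge X (tgt X f)) h"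
    using e edge_homotopic_iff[OF sX] i by metis+
  moreover note unit_edge_tri[OF edge_ends(2)[OF sX i(1)]]
  ultimately have "tri X f (unit_edge X (tgt X f)) h" using tri_fill2[OF X] by blast
  then show ?thesis using i edge_homotopic_iff[OF sX] by simp
qed

text \<open>In this and the next three lemmas a homotopy is read as a triangle with a unit edge. The
  homotopy, the triangles of the statement and one degenerate triangle are the four faces of a
  3-simplex; filling an inner horn produces the face that is wanted.\<close>

lemma tri_homotopic_comp:
  assumes t: "tri X f g h" and e: "edge_homotopic X h h'"
  shows "tri X f g h'"
proof -
  note te = tri_edges[OF sX t]
  have "tri X h (unit_edge X (tgt X g)) h'" using e edge_homotopic_iff[OF sX] te by metis
  moreover have "tri X g (unit_edge X (tgt X g)) g" using tri_unit_right[OF sX] te by blast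
  ultimately show ?thesis using tri_fill2[OF X t] by blast
qed

lemma tri_unique:
  assumes t: "tri X f g h" "tri X f g h'"
  shows "edge_homotopic X h h'"
proof -
  note te = tri_edges[OF sX t(1)]
  have "tri X g (unit_edge X (tgt X g)) g" using tri_unit_right[OF sX] te by blast
  then have "tri X h (unit_edge X (tgt X g)) h'" using tri_fill1[OF X t(1)] t(2) by blast
  then show ?thesis using te edge_homotopic_iff[OF sX] by simp
qed

lemma tri_homotopic_first:
  assumes t: "tri X f g h" and e: "edge_homotopic X f f'"
  shows "tri X f' g h"
proof -
  note te = tri_edges[OF sX t]
  have e': "edge_homotopic X f' f" using edge_homotopic_sym[OF e] .
  have "tri X f' (unit_edge X (tgt X f)) f"
    using e' edge_homotopic_iff[OF sX] edge_homotopic_in[OF sX e'] by metis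
  moreover have "tri X (unit_edge X (tgt X f)) g g" using tri_unit_left[OF sX] te by metis
  ultimately show ?thesis using tri_fill2[OF X _ _ t] by blast
qed

lemma tri_homotopic_second:
  assumes t: "tri X f g h" and e: "edge_homotopic X g g'"
  shows "tri X f g' h"
proof -
  note te = tri_edges[OF sX t]
  have "tri X g (unit_edge X (tgt X g)) g'" using e edge_homotopic_iff[OF sX] by metis
  moreover have "tri X h (unit_edge X (tgt X g)) h" using tri_unit_right[OF sX] te by metis
  ultimately show ?thesis using tri_fill2[OF X t] by blast
qed

lemma edge_class_self: "f \<in> simplices X 1 \<Longrightarrow> f \<in> edge_class X f"
  by (simp add: edge_class_def edge_homotopic_refl)

lemma edge_class_eqI: "edge_homotopic X f g \<Longrightarrow> edge_class X f = edge_class X g"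
  unfolding edge_class_def using edge_homotopic_sym edge_homotopic_trans by blast

lemma edge_class_eqD:
  "edge_class X f = edge_class X g \<Longrightarrow> g \<in> simplices X 1 \<Longrightarrow> edge_homotopic X f g"
  using edge_class_self unfolding edge_class_def by blast

text \<open>\<open>ho\<close> composes two classes by collecting the composites of all
  representatives. Since \<open>tri\<close> is invariant under homotopy of each edge and determines
  its third edge up to homotopy, the result is one class.\<close>

lemma ccomp_ho:
  assumes t: "tri X f g h"
  shows "ccomp (ho X) (edge_class X g) (edge_class X f) = edge_class X h"
proof -
  note te = tri_edges[OF sX t]
  have "ccomp (ho X) (edge_class X g) (edge_class X f) =
     {h'. \<exists>f' g'. edge_homotopic X f f' \<and> edge_homotopic X g g' \<and> tri X f' g' h'}"
    unfolding ho_def tri_def edge_class_def by auto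
  also have "\<dots> = edge_class X h"
    unfolding edge_class_def
  proof (intro equalityI subsetI CollectI; elim CollectE exE conjE)
    fix h' f' g' assume "edge_homotopic X f f'" "edge_homotopic X g g'" "tri X f' g' h'"
    then have "tri X f g h'"
      using tri_homotopic_first tri_homotopic_second edge_homotopic_sym by blast
    then show "edge_homotopic X h h'" using t tri_unique by blast
  next
    fix h' assume "edge_homotopic X h h'"
    then show "\<exists>f' g'. edge_homotopic X f f' \<and> edge_homotopic X g g' \<and> tri X f' g' h'"
      using t te edge_homotopic_refl tri_homotopic_comp by blast
  qed
  finally show ?thesis .
qed

lemma chom_hoI:
  "f \<in> simplices X 1 \<Longrightarrow> edge_class X f \<in> chom (ho X) (src X f) (tgt X f)"
  by (auto simp: ho_def)

lemma chom_hoE: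
  assumes "a \<in> chom (ho X) x y"
  obtains f where "f \<in> simplices X 1" "a = edge_class X f" "src X f = x" "tgt X f = y"
  using assms by (auto simp: ho_def)

lemma cobj_ho: "cobj (ho X) = simplices X 0"
  by (simp add: ho_def)

lemma cid_ho: "cid (ho X) x = edge_class X (unit_edge X x)"
  by (simp add: ho_def)

lemma is_category_ho: "is_category (ho X)"
  unfolding is_category_def cobj_ho cid_ho
proof (intro conjI ballI)
  fix x assume x: "x \<in> simplices X 0"
  show "edge_class X (unit_edge X x) \<in> chom (ho X) x x"
    using chom_hoI[OF unit_edge_in[OF sX x]] unit_edge_ends[OF sX x] by simp
next
  fix x y z a b assume a: "a \<in> chom (ho X) x y" and b: "b \<in> chom (ho X) y z"
  obtain f where f: "f \<in> simplices X 1" "a = edge_class X f" "src X f = x" "tgt X f = y"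
    using a by (rule chom_hoE)
  obtain g where g: "g \<in> simplices X 1" "b = edge_class X g" "src X g = y" "tgt X g = z"
    using b by (rule chom_hoE)
  obtain h where h: "tri X f g h" using tri_exists[OF X f(1) g(1)] f g by auto
  show "ccomp (ho X) b a \<in> chom (ho X) x z"
    using ccomp_ho[OF h] chom_hoI[of h] tri_edges[OF sX h] f g by auto
next
  fix x y a assume a: "a \<in> chom (ho X) x y"
  obtain f where f: "f \<in> simplices X 1" "a = edge_class X f" "src X f = x" "tgt X f = y"
    using a by (rule chom_hoE)
  show "ccomp (ho X) a (edge_class X (unit_edge X x)) = a"
    using ccomp_ho[OF tri_unit_left[OF sX f(1)]] f by auto
  show "ccomp (ho X) (edge_class X (unit_edge X y)) a = a"
    using ccomp_ho[OF tri_unit_right[OF sX f(1)]] f by auto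
next
  fix w x y z a b c
  assume a: "a \<in> chom (ho X) w x" and b: "b \<in> chom (ho X) x y" and c: "c \<in> chom (ho X) y z"
  obtain f where f: "f \<in> simplices X 1" "a = edge_class X f" "src X f = w" "tgt X f = x"
    using a by (rule chom_hoE)
  obtain g where g: "g \<in> simplices X 1" "b = edge_class X g" "src X g = x" "tgt X g = y"
    using b by (rule chom_hoE)
  obtain k where k: "k \<in> simplices X 1" "c = edge_class X k" "src X k = y" "tgt X k = z"
    using c by (rule chom_hoE)
  obtain p where p: "tri X f g p" using tri_exists[OF X f(1) g(1)] f g by auto
  obtain q where q: "tri X g k q" using tri_exists[OF X g(1) k(1)] g k by auto
  obtain r where r: "tri X p k r"
    using tri_exists[OF X, of p k] tri_edges[OF sX p] g k by auto
  \<comment> \<open>Associativity is one inner horn: p composes f and g, q composes g and k, and r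
    then serves as the composite for both bracketings.\<close>
  have r': "tri X f q r" using tri_fill2[OF X p q r] .
  show "ccomp (ho X) c (ccomp (ho X) b a) = ccomp (ho X) (ccomp (ho X) c b) a"
    using ccomp_ho[OF p] ccomp_ho[OF q] ccomp_ho[OF r] ccomp_ho[OF r'] f g k by simp
qed

end

text \<open>Both composites are unit edges and not merely homotopic to them. By
  \<open>tri_homotopic_comp\<close> this is no restriction, so the notion agrees with invertibility
  of the class in \<open>ho X\<close>.\<close>

definition eq_edge :: "'x sset \<Rightarrow> 'x \<Rightarrow> bool" where
  "eq_edge X f \<longleftrightarrow> (\<exists>g. tri X f g (unit_edge X (src X f)) \<and> tri X g f (unit_edge X (tgt X f)))"

lemma cat_iso_ho:
  assumes X: "quasi_category X" and f: "f \<in> simplices X 1"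
  shows "cat_iso (ho X) (src X f) (tgt X f) (edge_class X f) \<longleftrightarrow> eq_edge X f"
proof -
  note sX = quasi_category_is_sset[OF X]
  show ?thesis
  proof
    assume "cat_iso (ho X) (src X f) (tgt X f) (edge_class X f)"
    then obtain b where b: "b \<in> chom (ho X) (tgt X f) (src X f)"
      "ccomp (ho X) b (edge_class X f) = edge_class X (unit_edge X (src X f))"
      "ccomp (ho X) (edge_class X f) b = edge_class X (unit_edge X (tgt X f))"
      unfolding cat_iso_def cid_ho[OF X] by blast
    obtain g where g: "g \<in> simplices X 1" "b = edge_class X g" "src X g = tgt X f" "tgt X g = src X f"
      using b(1) by (rule chom_hoE[OF X])
    obtain h h' where h: "tri X f g h" "tri X g f h'"
      using tri_exists[OF X f g(1)] tri_exists[OF X g(1) f] g by auto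
    have u: "unit_edge X (src X f) \<in> simplices X 1" "unit_edge X (tgt X f) \<in> simplices X 1"
      using f edge_ends[OF sX] unit_edge_in[OF sX] by auto
    have "edge_homotopic X h (unit_edge X (src X f))" "edge_homotopic X h' (unit_edge X (tgt X f))"
      using b(2,3) ccomp_ho[OF X h(1)] ccomp_ho[OF X h(2)] g u by (auto intro!: edge_class_eqD[OF X])
    then have "tri X f g (unit_edge X (src X f))" "tri X g f (unit_edge X (tgt X f))"
      using h tri_homotopic_comp[OF X] by blast+
    then show "eq_edge X f" unfolding eq_edge_def by blast
  next
    assume "eq_edge X f"
    then obtain g where g: "tri X f g (unit_edge X (src X f))" "tri X g f (unit_edge X (tgt X f))"
      unfolding eq_edge_def by blast
    have s: "src X f \<in> simplices X 0" "tgt X f \<in> simplices X 0" using f edge_ends[OF sX] by auto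
    have "g \<in> simplices X 1" "src X g = tgt X f" "tgt X g = src X f"
      using tri_edges[OF sX g(1)] unit_edge_ends[OF sX s(1)] by auto
    then have "edge_class X g \<in> chom (ho X) (tgt X f) (src X f)" using chom_hoI[OF X] by metis
    then show "cat_iso (ho X) (src X f) (tgt X f) (edge_class X f)"
      unfolding cat_iso_def cid_ho[OF X] using ccomp_ho[OF X g(1)] ccomp_ho[OF X g(2)] chom_hoI[OF X f]
      by blast
  qed
qed

lemma smap_src_tgt_unit:
  assumes f: "smap X Y f"
  shows "e \<in> simplices X 1 \<Longrightarrow> f 0 (src X e) = src Y (f 1 e)"
    and "e \<in> simplices X 1 \<Longrightarrow> f 0 (tgt X e) = tgt Y (f 1 e)"
    and "x \<in> simplices X 0 \<Longrightarrow> f 1 (unit_edge X x) = unit_edge Y (f 0 x)"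
proof -
  have o: "[0] \<in> ops 0 1" "[1] \<in> ops 0 1" "[0,0] \<in> ops 1 0" by (auto simp: ops_def)
  show "e \<in> simplices X 1 \<Longrightarrow> f 0 (src X e) = src Y (f 1 e)"
    "e \<in> simplices X 1 \<Longrightarrow> f 0 (tgt X e) = tgt Y (f 1 e)"
    "x \<in> simplices X 0 \<Longrightarrow> f 1 (unit_edge X x) = unit_edge Y (f 0 x)"
    using o smap_act[OF f] by auto
qed

lemma smap_edge_homotopic:
  assumes sX: "is_sset X" and sY: "is_sset Y" and f: "smap X Y f" and e: "edge_homotopic X a b"
  shows "edge_homotopic Y (f 1 a) (f 1 b)"
proof -
  have "tri X a (unit_edge X (tgt X a)) b" using e edge_homotopic_iff[OF sX] by simp
  from tri_smap[OF f this] show ?thesis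
    using edge_homotopic_in[OF sX e] edge_homotopic_iff[OF sY] smap_src_tgt_unit[OF f]
      edge_ends[OF sX] by metis
qed

lemma ho_map_class:
  assumes X: "quasi_category X" and Y: "quasi_category Y" and f: "smap X Y f"
    and e: "e \<in> simplices X 1"
  shows "ho_map Y f (edge_class X e) = edge_class Y (f 1 e)"
proof -
  have "edge_class Y (f 1 x) = edge_class Y (f 1 e)" if "x \<in> edge_class X e" for x
  proof -
    have "edge_homotopic X e x" using that by (simp add: edge_class_def)
    then have "edge_homotopic Y (f 1 e) (f 1 x)"
      using smap_edge_homotopic[OF quasi_category_is_sset[OF X] quasi_category_is_sset[OF Y] f] by blast
    then show ?thesis using edge_class_eqI[OF Y] by blast
  qed
  then show ?thesis unfolding ho_map_def using edge_class_self[OF X e] by blast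
qed

lemma cat_functor_ho:
  assumes X: "quasi_category X" and Y: "quasi_category Y" and f: "smap X Y f"
  shows "cat_functor (ho X) (ho Y) (f 0) (ho_map Y f)"
  unfolding cat_functor_def cobj_ho[OF X] cobj_ho[OF Y] cid_ho[OF X] cid_ho[OF Y]
proof (intro conjI ballI funcsetI is_category_ho X Y)
  note sX = quasi_category_is_sset[OF X] and st = smap_src_tgt_unit[OF f]
  note hm = ho_map_class[OF X Y f]
  show "f 0 x \<in> simplices Y 0" if "x \<in> simplices X 0" for x using smap_in[OF f that] .
  show "ho_map Y f a \<in> chom (ho Y) (f 0 x) (f 0 y)" if "a \<in> chom (ho X) x y" for a x y
  proof -
    obtain e where e: "e \<in> simplices X 1" "a = edge_class X e" "src X e = x" "tgt X e = y"
      using \<open>a \<in> chom (ho X) x y\<close> by (rule chom_hoE[OF X])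
    show ?thesis using chom_hoI[OF Y smap_in[OF f e(1)]] st e hm[OF e(1)] by auto
  qed
  show "ho_map Y f (edge_class X (unit_edge X x)) = edge_class Y (unit_edge Y (f 0 x))"
    if "x \<in> simplices X 0" for x
    using hm[OF unit_edge_in[OF sX that]] st(3)[OF that] by simp
  fix x y z a b assume a: "a \<in> chom (ho X) x y" and b: "b \<in> chom (ho X) y z"
  obtain e where e: "e \<in> simplices X 1" "a = edge_class X e" "src X e = x" "tgt X e = y"
    using a by (rule chom_hoE[OF X])
  obtain g where g: "g \<in> simplices X 1" "b = edge_class X g" "src X g = y" "tgt X g = z"
    using b by (rule chom_hoE[OF X])
  obtain h where h: "tri X e g h" using tri_exists[OF X e(1) g(1)] e g by auto
  show "ho_map Y f (ccomp (ho X) b a) = ccomp (ho Y) (ho_map Y f b) (ho_map Y f a)"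
    using ccomp_ho[OF X h] ccomp_ho[OF Y tri_smap[OF f h]] e g hm tri_edges[OF sX h] by simp
qed

section \<open>Equivalences of categories\<close>

lemma is_category_comp:
  "\<lbrakk>is_category C; x \<in> cobj C; y \<in> cobj C; z \<in> cobj C; f \<in> chom C x y; g \<in> chom C y z\<rbrakk>
    \<Longrightarrow> ccomp C g f \<in> chom C x z"
  unfolding is_category_def by blast

lemma is_category_assoc:
  "\<lbrakk>is_category C; w \<in> cobj C; x \<in> cobj C; y \<in> cobj C; z \<in> cobj C; f \<in> chom C w x; g \<in> chom C x y; h \<in> chom C y z\<rbrakk>
    \<Longrightarrow> ccomp C h (ccomp C g f) = ccomp C (ccomp C h g) f"
  unfolding is_category_def by blast

lemma is_category_id:
  "\<lbrakk>is_category C; x \<in> cobj C; y \<in> cobj C; f \<in> chom C x y\<rbrakk>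
    \<Longrightarrow> ccomp C f (cid C x) = f \<and> ccomp C (cid C y) f = f"
  "\<lbrakk>is_category C; x \<in> cobj C\<rbrakk> \<Longrightarrow> cid C x \<in> chom C x x"
  unfolding is_category_def by blast+

lemma cat_iso_id: "\<lbrakk>is_category C; x \<in> cobj C\<rbrakk> \<Longrightarrow> cat_iso C x x (cid C x)"
  unfolding cat_iso_def using is_category_id by metis

lemma cat_iso_comp:
  assumes C: "is_category C" and o: "x \<in> cobj C" "y \<in> cobj C" "z \<in> cobj C"
    and f: "cat_iso C x y f" and g: "cat_iso C y z g"
  shows "cat_iso C x z (ccomp C g f)"
proof -
  obtain f' where f': "f \<in> chom C x y" "f' \<in> chom C y x" "ccomp C f' f = cid C x" "ccomp C f f' = cid C y"
    using f unfolding cat_iso_def by blast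
  obtain g' where g': "g \<in> chom C y z" "g' \<in> chom C z y" "ccomp C g' g = cid C y" "ccomp C g g' = cid C z"
    using g unfolding cat_iso_def by blast
  note a = is_category_assoc[OF C] and c = is_category_comp[OF C] and i = is_category_id(1)[OF C]
  have gf: "ccomp C g f \<in> chom C x z" "ccomp C f' g' \<in> chom C z x" using o f' g' c by auto
  have "ccomp C (ccomp C f' g') (ccomp C g f) = ccomp C f' (ccomp C g' (ccomp C g f))"
    using a[of x z y x] o f' g' gf by simp
  also have "\<dots> = ccomp C f' (ccomp C (ccomp C g' g) f)"
    using a[of x y z y] o f' g' by simp
  also have "\<dots> = cid C x" using o f' g' i by simp
  finally have 1: "ccomp C (ccomp C f' g') (ccomp C g f) = cid C x" .
  have "ccomp C (ccomp C g f) (ccomp C f' g') = ccomp C g (ccomp C f (ccomp C f' g'))"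
    using a[of z x y z] o f' g' gf by simp
  also have "\<dots> = ccomp C g (ccomp C (ccomp C f f') g')"
    using a[of z y x y] o f' g' by simp
  also have "\<dots> = cid C z" using o f' g' i by simp
  finally have 2: "ccomp C (ccomp C g f) (ccomp C f' g') = cid C z" .
  show ?thesis
    unfolding cat_iso_def using gf 1 2 by blast
qed

lemma cat_iso_inverse:
  assumes "cat_iso C x y f"
  obtains g where "cat_iso C y x g" "ccomp C g f = cid C x" "ccomp C f g = cid C y"
  using assms unfolding cat_iso_def by blast

lemma cat_functor_iso:
  assumes F: "cat_functor C D Fo Fm" and o: "x \<in> cobj C" "y \<in> cobj C" and f: "cat_iso C x y f"
  shows "cat_iso D (Fo x) (Fo y) (Fm f)"
proof -
  obtain g where g: "f \<in> chom C x y" "g \<in> chom C y x" "ccomp C g f = cid C x" "ccomp C f g = cid C y"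
    using f unfolding cat_iso_def by blast
  have "Fm f \<in> chom D (Fo x) (Fo y)" "Fm g \<in> chom D (Fo y) (Fo x)"
    "ccomp D (Fm g) (Fm f) = cid D (Fo x)" "ccomp D (Fm f) (Fm g) = cid D (Fo y)"
    using F o g unfolding cat_functor_def by (metis funcset_mem)+
  then show ?thesis unfolding cat_iso_def by blast
qed

text \<open>Each of f and g is the conjugate of the other by s and t.\<close>

lemma cat_iso_square:
  assumes C: "is_category C" and o: "x \<in> cobj C" "y \<in> cobj C" "x' \<in> cobj C" "y' \<in> cobj C"
    and s: "cat_iso C x x' s" and t: "cat_iso C y y' t"
    and f: "f \<in> chom C x y" and g: "g \<in> chom C x' y'"
    and sq: "ccomp C t f = ccomp C g s"
  shows "cat_iso C x y f \<longleftrightarrow> cat_iso C x' y' g"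
proof -
  note a = is_category_assoc[OF C] and i = is_category_id(1)[OF C]
  obtain s' where s': "cat_iso C x' x s'" "ccomp C s' s = cid C x" "ccomp C s s' = cid C x'"
    using s by (rule cat_iso_inverse)
  obtain t' where t': "cat_iso C y' y t'" "ccomp C t' t = cid C y" "ccomp C t t' = cid C y'"
    using t by (rule cat_iso_inverse)
  have h: "s \<in> chom C x x'" "t \<in> chom C y y'" "s' \<in> chom C x' x" "t' \<in> chom C y' y"
    using s t s' t' by (auto simp: cat_iso_def)
  have "f = ccomp C (ccomp C t' t) f" using i o f t' by simp
  also have "\<dots> = ccomp C t' (ccomp C g s)" using a[of x y y' y f t t'] o h f sq by simp
  finally have 1: "f = ccomp C t' (ccomp C g s)" .
  have "g = ccomp C g (ccomp C s s')" using i o g s' by simp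
  also have "\<dots> = ccomp C (ccomp C t f) s'" using a[of x' x x' y' s' s g] o h g sq by simp
  finally have 2: "g = ccomp C (ccomp C t f) s'" .
  note comp = cat_iso_comp[OF C]
  show ?thesis
  proof
    assume "cat_iso C x y f"
    then have "cat_iso C x' y' (ccomp C (ccomp C t f) s')"
      using comp[OF o(3,1,4) s'(1)] comp[OF o(1,2,4) _ t] by blast
    then show "cat_iso C x' y' g" using 2 by simp
  next
    assume "cat_iso C x' y' g"
    then have "cat_iso C x y (ccomp C t' (ccomp C g s))"
      using comp[OF o(1,4,2) _ t'(1)] comp[OF o(1,3,4) s] by blast
    then show "cat_iso C x y f" using 1 by simp
  qed
qed

text \<open>Reflection comes from the natural isomorphism s, by which f is conjugate to
  \<open>Gm (Fm f)\<close>.\<close>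

lemma cat_equivalence_iso_iff:
  assumes E: "cat_equivalence C D Fo Fm" and o: "x \<in> cobj C" "y \<in> cobj C" and f: "f \<in> chom C x y"
  shows "cat_iso C x y f \<longleftrightarrow> cat_iso D (Fo x) (Fo y) (Fm f)"
proof -
  obtain Go Gm s where F: "cat_functor C D Fo Fm" and G: "cat_functor D C Go Gm"
    and s: "nat_iso C C id id (Go \<circ> Fo) (Gm \<circ> Fm) s"
    using E unfolding cat_equivalence_def by blast
  have C: "is_category C" using F by (simp add: cat_functor_def)
  have Fo: "Fo x \<in> cobj D" "Fo y \<in> cobj D" "Fm f \<in> chom D (Fo x) (Fo y)"
    using F o f unfolding cat_functor_def by auto
  then have Go: "Go (Fo x) \<in> cobj C" "Go (Fo y) \<in> cobj C" "Gm (Fm f) \<in> chom C (Go (Fo x)) (Go (Fo y))"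
    using G unfolding cat_functor_def by (auto simp: Pi_iff)
  have "cat_iso C x (Go (Fo x)) (s x)" "cat_iso C y (Go (Fo y)) (s y)"
    "ccomp C (s y) f = ccomp C (Gm (Fm f)) (s x)"
    using s o f unfolding nat_iso_def by auto
  then have "cat_iso C x y f \<longleftrightarrow> cat_iso C (Go (Fo x)) (Go (Fo y)) (Gm (Fm f))"
    using cat_iso_square[OF C] o Go f by blast
  then show ?thesis using cat_functor_iso[OF F o] cat_functor_iso[OF G Fo(1,2)] by blast
qed

text \<open>From C to D: a morphism of D is conjugate through t to one in the image of
  \<open>Fm\<close>. From D to C: isomorphisms are reflected.\<close>

lemma cat_equivalence_groupoid:
  assumes E: "cat_equivalence C D Fo Fm"
  shows "is_groupoid C \<longleftrightarrow> is_groupoid D"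
proof
  obtain Go Gm t where F: "cat_functor C D Fo Fm" and G: "cat_functor D C Go Gm"
    and t: "nat_iso D D (Fo \<circ> Go) (Fm \<circ> Gm) id id t"
    using E unfolding cat_equivalence_def by blast
  have C: "is_category C" "is_category D" using F by (simp_all add: cat_functor_def)
  {
    assume gC: "is_groupoid C"
    show "is_groupoid D" unfolding is_groupoid_def
    proof (intro conjI ballI C)
      fix x y f assume o: "x \<in> cobj D" "y \<in> cobj D" and f: "f \<in> chom D x y"
      have Go: "Go x \<in> cobj C" "Go y \<in> cobj C" "Gm f \<in> chom C (Go x) (Go y)"
        using G o f unfolding cat_functor_def by auto
      then have Fo: "Fo (Go x) \<in> cobj D" "Fo (Go y) \<in> cobj D"
          "Fm (Gm f) \<in> chom D (Fo (Go x)) (Fo (Go y))"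
        using F unfolding cat_functor_def by (auto simp: Pi_iff)
      have "cat_iso D (Fo (Go x)) (Fo (Go y)) (Fm (Gm f))"
        using gC Go cat_functor_iso[OF F Go(1,2)] unfolding is_groupoid_def by blast
      moreover have "cat_iso D (Fo (Go x)) x (t x)" "cat_iso D (Fo (Go y)) y (t y)"
        "ccomp D (t y) (Fm (Gm f)) = ccomp D f (t x)"
        using t o f unfolding nat_iso_def by auto
      ultimately show "cat_iso D x y f"
        using cat_iso_square[OF C(2)] o Fo f by blast
    qed
  }
  {
    assume gD: "is_groupoid D"
    show "is_groupoid C" unfolding is_groupoid_def
    proof (intro conjI ballI C)
      fix x y f assume o: "x \<in> cobj C" "y \<in> cobj C" and f: "f \<in> chom C x y"
      have "Fo x \<in> cobj D" "Fo y \<in> cobj D" "Fm f \<in> chom D (Fo x) (Fo y)"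
        using F o f unfolding cat_functor_def by auto
      then show "cat_iso C x y f"
        using gD cat_equivalence_iso_iff[OF E o f] unfolding is_groupoid_def by blast
    qed
  }
qed

lemma equiv_iso_rel:
  assumes C: "is_category C"
  shows "equiv (cobj C) (iso_rel C)"
proof (rule equivI)
  show "iso_rel C \<subseteq> cobj C \<times> cobj C" by (auto simp: iso_rel_def)
  show "refl_on (cobj C) (iso_rel C)" using cat_iso_id[OF C] by (auto simp: refl_on_def iso_rel_def)
  show "sym (iso_rel C)" by (auto simp: sym_def iso_rel_def elim: cat_iso_inverse)
  show "trans (iso_rel C)" unfolding trans_def iso_rel_def using cat_iso_comp[OF C] by blast
qed

lemma cat_equivalence_bij_on_iso_classes:
  assumes E: "cat_equivalence C D Fo Fm"
  shows "bij_on_iso_classes C D Fo"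
proof -
  obtain Go Gm s t where F: "cat_functor C D Fo Fm" and G: "cat_functor D C Go Gm"
    and s: "nat_iso C C id id (Go \<circ> Fo) (Gm \<circ> Fm) s"
    and t: "nat_iso D D (Fo \<circ> Go) (Fm \<circ> Gm) id id t"
    using E unfolding cat_equivalence_def by blast
  have C: "is_category C" "is_category D" using F by (simp_all add: cat_functor_def)
  note eC = equiv_iso_rel[OF C(1)] and eD = equiv_iso_rel[OF C(2)]
  have Fo: "Fo x \<in> cobj D" if "x \<in> cobj C" for x using F that by (auto simp: cat_functor_def)
  have Go: "Go x \<in> cobj C" if "x \<in> cobj D" for x using G that by (auto simp: cat_functor_def)
  have F_rel: "(Fo x, Fo y) \<in> iso_rel D" if "(x, y) \<in> iso_rel C" for x y
    using that Fo cat_functor_iso[OF F] unfolding iso_rel_def by blast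
  have G_rel: "(Go x, Go y) \<in> iso_rel C" if "(x, y) \<in> iso_rel D" for x y
    using that Go cat_functor_iso[OF G] unfolding iso_rel_def by blast
  have s_rel: "(x, Go (Fo x)) \<in> iso_rel C" if "x \<in> cobj C" for x
    using s that Fo Go by (auto simp: iso_rel_def nat_iso_def)
  have t_rel: "(Fo (Go x), x) \<in> iso_rel D" if "x \<in> cobj D" for x
    using t that Fo Go by (auto simp: iso_rel_def nat_iso_def)
  \<comment> \<open>This is reflection, not reflexivity: x, \<open>Go (Fo x)\<close>,
    \<open>Go (Fo y)\<close> and y are successively isomorphic.\<close>
  have refl: "(x, y) \<in> iso_rel C" if "x \<in> cobj C" "y \<in> cobj C" "(Fo x, Fo y) \<in> iso_rel D" for x y
    using G_rel[OF that(3)] s_rel that eC by (meson equivE symE transE)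
  \<comment> \<open>All members of a class are sent into the same class of D, so the union
    collapses.\<close>
  have val: "(\<Union>x\<in>iso_rel C `` {z}. iso_rel D `` {Fo x}) = iso_rel D `` {Fo z}" if z: "z \<in> cobj C" for z
  proof -
    have "z \<in> iso_rel C `` {z}" using equiv_class_self[OF eC z] .
    moreover have "iso_rel D `` {Fo x} = iso_rel D `` {Fo z}" if "x \<in> iso_rel C `` {z}" for x
      using equiv_class_eq[OF eD F_rel[of z x]] that by auto
    ultimately show ?thesis by blast
  qed
  show ?thesis unfolding bij_on_iso_classes_def
  proof (rule bij_betw_imageI)
    show "inj_on (\<lambda>c. \<Union>x\<in>c. iso_rel D `` {Fo x}) (cobj C // iso_rel C)"
    proof (rule inj_onI)
      fix c d assume c: "c \<in> cobj C // iso_rel C" and d: "d \<in> cobj C // iso_rel C"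
        and eq: "(\<Union>x\<in>c. iso_rel D `` {Fo x}) = (\<Union>x\<in>d. iso_rel D `` {Fo x})"
      obtain x where x: "x \<in> cobj C" "c = iso_rel C `` {x}" using c by (rule quotientE)
      obtain y where y: "y \<in> cobj C" "d = iso_rel C `` {y}" using d by (rule quotientE)
      have "iso_rel D `` {Fo x} = iso_rel D `` {Fo y}" using eq x y val by simp
      then have "(Fo x, Fo y) \<in> iso_rel D"
        using eq_equiv_class[OF _ eD] Fo y by blast
      then show "c = d" using refl x y equiv_class_eq[OF eC] by simp
    qed
    show "(\<lambda>c. \<Union>x\<in>c. iso_rel D `` {Fo x}) ` (cobj C // iso_rel C) = cobj D // iso_rel D"
    proof (intro equalityI subsetI)
      fix d assume "d \<in> (\<lambda>c. \<Union>x\<in>c. iso_rel D `` {Fo x}) ` (cobj C // iso_rel C)"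
      then obtain x where "x \<in> cobj C" "d = iso_rel D `` {Fo x}"
        using val by (auto elim!: quotientE)
      then show "d \<in> cobj D // iso_rel D" using Fo by (auto intro: quotientI)
    next
      fix d assume "d \<in> cobj D // iso_rel D"
      then obtain y where y: "y \<in> cobj D" "d = iso_rel D `` {y}" by (rule quotientE)
      have "d = iso_rel D `` {Fo (Go y)}" using equiv_class_eq[OF eD t_rel] y by simp
      also have "\<dots> = (\<Union>x\<in>iso_rel C `` {Go y}. iso_rel D `` {Fo x})" using val Go y by simp
      finally show "d \<in> (\<lambda>c. \<Union>x\<in>c. iso_rel D `` {Fo x}) ` (cobj C // iso_rel C)"
        using Go y by (intro image_eqI[where x = "iso_rel C `` {Go y}"]) (auto intro: quotientI)
    qed
  qed
qed

section \<open>Exponentials and homotopies\<close>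

lemma simplices_prod_std:
  "(u, b) \<in> simplices (sset_prod U (std_simplex n)) k \<longleftrightarrow> u \<in> simplices U k \<and> b \<in> ops k n"
  by (simp add: sset_prod_def std_simplex_def)

lemma act_prod_std:
  "act (sset_prod U (std_simplex n)) k a (u, b) = (act U k a u, op_comp b a)"
  by (simp add: sset_prod_def std_simplex_def)

lemma exp_simplexD:
  assumes \<phi>: "\<phi> \<in> simplices (sset_exp Y U) n"
  shows "u \<in> simplices U k \<Longrightarrow> b \<in> ops k n \<Longrightarrow> \<phi> k (u, b) \<in> simplices Y k"
    and "u \<in> simplices U k \<Longrightarrow> b \<in> ops k n \<Longrightarrow> a \<in> ops l k \<Longrightarrow>
      \<phi> l (act U k a u, op_comp b a) = act Y k a (\<phi> k (u, b))"
proof -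
  have s: "smap (sset_prod U (std_simplex n)) Y \<phi>" using \<phi> by (simp add: sset_exp_def)
  show "u \<in> simplices U k \<Longrightarrow> b \<in> ops k n \<Longrightarrow> \<phi> k (u, b) \<in> simplices Y k"
    using smap_in[OF s] by (simp add: simplices_prod_std)
  show "u \<in> simplices U k \<Longrightarrow> b \<in> ops k n \<Longrightarrow> a \<in> ops l k \<Longrightarrow>
      \<phi> l (act U k a u, op_comp b a) = act Y k a (\<phi> k (u, b))"
    using smap_act[OF s, of a l k "(u,b)"] by (simp add: simplices_prod_std act_prod_std)
qed

lemma exp_simplexI:
  assumes "\<And>u k b. u \<in> simplices U k \<Longrightarrow> b \<in> ops k n \<Longrightarrow> \<phi> k (u, b) \<in> simplices Y k"
    and "\<And>u k b a l. u \<in> simplices U k \<Longrightarrow> b \<in> ops k n \<Longrightarrow> a \<in> ops l k \<Longrightarrow>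
      \<phi> l (act U k a u, op_comp b a) = act Y k a (\<phi> k (u, b))"
    and "\<And>k. \<phi> k \<in> extensional (simplices (sset_prod U (std_simplex n)) k)"
  shows "\<phi> \<in> simplices (sset_exp Y U) n"
  unfolding sset_exp_def using assms
  by (auto intro!: smapI simp: simplices_prod_std act_prod_std)

lemma exp_eqI:
  assumes "\<phi> \<in> simplices (sset_exp Y U) n" "\<psi> \<in> simplices (sset_exp Y U) n"
    and "\<And>u k b. u \<in> simplices U k \<Longrightarrow> b \<in> ops k n \<Longrightarrow> \<phi> k (u, b) = \<psi> k (u, b)"
  shows "\<phi> = \<psi>"
proof (rule ext)
  fix k
  have "\<phi> k \<in> extensional (simplices (sset_prod U (std_simplex n)) k)"
    "\<psi> k \<in> extensional (simplices (sset_prod U (std_simplex n)) k)"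
    using assms(1,2) by (auto simp: sset_exp_def)
  then show "\<phi> k = \<psi> k"
    by (rule extensionalityI) (auto simp: simplices_prod_std assms(3))
qed

lemma act_exp:
  assumes "a \<in> ops m n" "u \<in> simplices U k" "b \<in> ops k m"
  shows "act (sset_exp Y U) n a \<phi> k (u, b) = \<phi> k (u, op_comp a b)"
proof -
  have "length a - 1 = m" using assms by (simp add: ops_def)
  then show ?thesis using assms by (simp add: sset_exp_def simplices_prod_std)
qed

text \<open>H is a simplicial map U \<times> X \<rightarrow> Y in curried form, and the conclusion
  is about its transpose. The simplex x is first pulled back along b, so that it has the same
  dimension as u.\<close>

lemma smap_curry:
  assumes U: "is_sset U" and X: "is_sset X"
    and Hin: "\<And>n u x. u \<in> simplices U n \<Longrightarrow> x \<in> simplices X n \<Longrightarrow> H n u x \<in> simplices Y n"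
    and Hact: "\<And>n u x a m. u \<in> simplices U n \<Longrightarrow> x \<in> simplices X n \<Longrightarrow> a \<in> ops m n \<Longrightarrow>
      H m (act U n a u) (act X n a x) = act Y n a (H n u x)"
  shows "smap X (sset_exp Y U)
    (\<lambda>n x k. \<lambda>(u, b) \<in> simplices (sset_prod U (std_simplex n)) k. H k u (act X n b x))"
    (is "smap X _ ?h")
proof (rule smapI)
  fix n x assume x: "x \<in> simplices X n"
  show in_exp: "?h n x \<in> simplices (sset_exp Y U) n"
  proof (rule exp_simplexI)
    fix k u b assume ub: "u \<in> simplices U k" "b \<in> ops k n"
    then show "?h n x k (u, b) \<in> simplices Y k"
      using x by (simp add: simplices_prod_std Hin is_sset_act_in[OF X])
    fix a l assume a: "a \<in> ops l k"
    show "?h n x l (act U k a u, op_comp b a) = act Y k a (?h n x k (u, b))"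
      using ub a x Hact[OF ub(1) is_sset_act_in[OF X ub(2) x] a]
      by (simp add: simplices_prod_std is_sset_act_in[OF U] op_comp_in is_sset_act_act[OF X])
  qed auto
  fix a m assume a: "a \<in> ops m n"
  have la: "length a - 1 = m" using a by (simp add: ops_def)
  show "?h m (act X n a x) = act (sset_exp Y U) n a (?h n x)"
  proof (rule ext)+
    fix k p
    show "?h m (act X n a x) k p = act (sset_exp Y U) n a (?h n x) k p"
    proof (cases "p \<in> simplices (sset_prod U (std_simplex m)) k")
      case True
      then obtain u b where p: "p = (u, b)" "u \<in> simplices U k" "b \<in> ops k m"
        by (cases p) (auto simp: simplices_prod_std)
      show ?thesis unfolding p(1) act_exp[OF a p(2,3)]
        using p a x by (simp add: simplices_prod_std op_comp_in is_sset_act_act[OF X])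
    next
      \<comment> \<open>Off the domain both sides are \<open>undefined\<close>; by \<open>la\<close>
        the action restricts to the same domain as the left-hand side.\<close>
      case False
      then show ?thesis unfolding sset_exp_def by (simp add: la del: One_nat_def)
    qed
  qed
qed

lemma sset_eval_curry:
  assumes "is_sset U" "is_sset X" "v \<in> simplices U 0" "x \<in> simplices X n"
  shows "sset_eval U v n (\<lambda>k. \<lambda>(u, b) \<in> simplices (sset_prod U (std_simplex n)) k. H k u (act X n b x))
    = H n (act U 0 (op_const n) v) x"
  using assms
  by (simp add: sset_eval_def simplices_prod_std op_id_in is_sset_act_in[OF _ op_const_in] is_sset_act_id)

section \<open>Homotopies and paths parametrized by the walking isomorphism\<close>

definition ihomotopy ::
  "'x sset \<Rightarrow> 'y sset \<Rightarrow> (nat \<Rightarrow> 'x \<Rightarrow> 'y) \<Rightarrow> (nat \<Rightarrow> 'x \<Rightarrow> 'y) \<Rightarrow> bool" where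
  "ihomotopy X Y f g \<longleftrightarrow> (\<exists>h. smap X (sset_exp Y walking_iso) h \<and>
     (\<forall>n. \<forall>x\<in>simplices X n. sset_eval walking_iso [0] n (h n x) = f n x \<and>
                            sset_eval walking_iso [1] n (h n x) = g n x))"

lemma qc_equivalence_iff:
  "qc_equivalence A B f \<longleftrightarrow> quasi_category A \<and> quasi_category B \<and> smap A B f \<and>
     (\<exists>g. smap B A g \<and> ihomotopy A A (\<lambda>n x. x) (\<lambda>n x. g n (f n x)) \<and>
          ihomotopy B B (\<lambda>n y. f n (g n y)) (\<lambda>n y. y))"
proof -
  have *: "(\<exists>g h k. P g \<and> Q h \<and> R k \<and> S g h \<and> T g k) \<longleftrightarrow>
    (\<exists>g. P g \<and> (\<exists>h. Q h \<and> S g h) \<and> (\<exists>k. R k \<and> T g k))" for P Q R S T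
    by blast
  show ?thesis unfolding qc_equivalence_def ihomotopy_def by (simp only: *)
qed

text \<open>Reversal of paths makes sense in every simplicial set (\<open>ipath_sym\<close>), but
  concatenation is established only in mapping quasi-categories of a cosmos
  (\<open>ipath_trans\<close>).\<close>

definition ipath :: "'x sset \<Rightarrow> 'x \<Rightarrow> 'x \<Rightarrow> bool" where
  "ipath X x y \<longleftrightarrow> (\<exists>w. smap walking_iso X w \<and> w 0 [0] = x \<and> w 0 [1] = y)"

lemma ipath_smap: "ipath X x y \<Longrightarrow> smap X Y f \<Longrightarrow> ipath Y (f 0 x) (f 0 y)"
  unfolding ipath_def using smap_comp by fastforce

lemma walking_iso_simps:
  "s \<in> simplices walking_iso n \<longleftrightarrow> length s = Suc n \<and> set s \<subseteq> {0, 1}"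
  "act walking_iso n a s = op_comp s a"
  by (simp_all add: walking_iso_def)

lemma ipath_in: "ipath X x y \<Longrightarrow> x \<in> simplices X 0 \<and> y \<in> simplices X 0"
proof -
  assume "ipath X x y"
  then obtain w where w: "smap walking_iso X w" "w 0 [0] = x" "w 0 [1] = y"
    unfolding ipath_def by blast
  show ?thesis
    using smap_in[OF w(1), of "[0]" 0] smap_in[OF w(1), of "[1]" 0] w(2,3)
    by (simp add: walking_iso_simps)
qed

lemma ipath_sym:
  assumes "ipath X x y"
  shows "ipath X y x"
proof -
  obtain w where w: "smap walking_iso X w" "w 0 [0] = x" "w 0 [1] = y"
    using assms unfolding ipath_def by blast
  \<comment> \<open>The automorphism of the walking isomorphism that exchanges its two
    objects.\<close>
  have "smap walking_iso walking_iso (\<lambda>n. map (\<lambda>i. 1 - i))"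
    by (rule smapI) (auto simp: walking_iso_simps op_comp_def ops_def less_Suc_eq_le subset_iff)
  from smap_comp[OF this w(1)] show ?thesis
    unfolding ipath_def using w(2,3) by (intro exI[of _ "\<lambda>n x. w n (map (\<lambda>i. 1 - i) x)"]) simp
qed

lemma ipath_refl:
  assumes X: "is_sset X" and x: "x \<in> simplices X 0"
  shows "ipath X x x"
  unfolding ipath_def
proof (intro exI[of _ "\<lambda>n s. act X 0 (op_const n) x"] conjI smapI)
  show "act X 0 (op_const n) x \<in> simplices X n" for n using is_sset_act_in[OF X op_const_in x] .
  show "act X 0 (op_const m) x = act X n a (act X 0 (op_const n) x)" if "a \<in> ops m n" for a m n
    using is_sset_act_act[OF X op_const_in that x] op_comp_const[OF that] by simp
qed (simp_all add: op_const_0 is_sset_act_id[OF X x])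

text \<open>A vertex of the exponential is a map out of U, because over \<open>std_simplex 0\<close>
  the second component can only be a constant operator. The converse passage is
  \<open>smap_exp_vertex\<close>.\<close>

lemma exp_vertex_smap:
  assumes \<phi>: "\<phi> \<in> simplices (sset_exp Y U) 0"
  shows "smap U Y (\<lambda>n s. \<phi> n (s, op_const n))"
proof (rule smapI)
  show "\<phi> n (u, op_const n) \<in> simplices Y n" if "u \<in> simplices U n" for n u
    using exp_simplexD(1)[OF \<phi> that op_const_in] .
  show "\<phi> m (act U n a u, op_const m) = act Y n a (\<phi> n (u, op_const n))"
    if "a \<in> ops m n" "u \<in> simplices U n" for m n a u
    using exp_simplexD(2)[OF \<phi> that(2) op_const_in that(1)] op_comp_const[OF that(1)] by simp
qed

lemma smap_exp_vertex:
  assumes U: "is_sset U" and w: "smap U Y w"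
  shows "(\<lambda>n. \<lambda>(s, b) \<in> simplices (sset_prod U (std_simplex 0)) n. w n s) \<in> simplices (sset_exp Y U) 0"
  by (rule exp_simplexI)
    (auto simp: simplices_prod_std smap_in[OF w] smap_act[OF w] is_sset_act_in[OF U] op_comp_in)

lemma ihomotopy_ipath:
  assumes h: "ihomotopy X Y f g" and x: "x \<in> simplices X 0"
  shows "ipath Y (f 0 x) (g 0 x)"
proof -
  obtain h where h: "smap X (sset_exp Y walking_iso) h"
    "sset_eval walking_iso [0] 0 (h 0 x) = f 0 x" "sset_eval walking_iso [1] 0 (h 0 x) = g 0 x"
    using assms unfolding ihomotopy_def by blast
  have "smap walking_iso Y (\<lambda>n s. h 0 x n (s, op_const n))"
    using exp_vertex_smap[OF smap_in[OF h(1) x]] .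
  moreover have "sset_eval walking_iso [v] 0 (h 0 x) = h 0 x 0 ([v], op_const 0)" for v
    by (simp add: sset_eval_def walking_iso_def op_const_0 op_comp_def op_id_def)
  ultimately show ?thesis unfolding ipath_def using h(2,3) by auto
qed

text \<open>The 2-simplices \<open>[0,1,0]\<close> and \<open>[1,0,1]\<close> of the nerve give the
  two triangles that \<open>eq_edge\<close> asks for; the inverse edge is the image of
  \<open>[1,0]\<close>.\<close>

lemma walking_iso_eq_edge:
  assumes w: "smap walking_iso Y w"
  shows "w 1 [0,1] \<in> simplices Y 1" "src Y (w 1 [0,1]) = w 0 [0]" "tgt Y (w 1 [0,1]) = w 0 [1]"
    "eq_edge Y (w 1 [0,1])"
proof -
  have o: "[0,1] \<in> ops 1 2" "[1,2] \<in> ops 1 2" "[0,2] \<in> ops 1 2" "[0] \<in> ops 0 1" "[1] \<in> ops 0 1"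
    "[0,0] \<in> ops 1 0"
    by (auto simp: ops_def)
  have m: "[0] \<in> simplices walking_iso 0" "[1] \<in> simplices walking_iso 0"
    "[0,1] \<in> simplices walking_iso 1" "[0,1,0] \<in> simplices walking_iso 2"
    "[1,0,1] \<in> simplices walking_iso 2"
    by (auto simp: walking_iso_simps)
  show "w 1 [0,1] \<in> simplices Y 1" using smap_in[OF w m(3)] .
  show s: "src Y (w 1 [0,1]) = w 0 [0]" and t: "tgt Y (w 1 [0,1]) = w 0 [1]"
    using smap_act[OF w o(4) m(3)] smap_act[OF w o(5) m(3)]
    by (simp_all add: walking_iso_simps op_comp_def)
  have u: "unit_edge Y (w 0 [0]) = w 1 [0,0]" "unit_edge Y (w 0 [1]) = w 1 [1,1]"
    using smap_act[OF w o(6) m(1)] smap_act[OF w o(6) m(2)]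
    by (simp_all add: walking_iso_simps op_comp_def)
  have "tri Y (w 1 [0,1]) (w 1 [1,0]) (w 1 [0,0])" unfolding tri_def
    using smap_in[OF w m(4)] smap_act[OF w o(1) m(4)] smap_act[OF w o(2) m(4)] smap_act[OF w o(3) m(4)]
    by (intro bexI[of _ "w 2 [0,1,0]"]) (auto simp: walking_iso_simps op_comp_def)
  moreover have "tri Y (w 1 [1,0]) (w 1 [0,1]) (w 1 [1,1])" unfolding tri_def
    using smap_in[OF w m(5)] smap_act[OF w o(1) m(5)] smap_act[OF w o(2) m(5)] smap_act[OF w o(3) m(5)]
    by (intro bexI[of _ "w 2 [1,0,1]"]) (auto simp: walking_iso_simps op_comp_def)
  ultimately show "eq_edge Y (w 1 [0,1])" unfolding eq_edge_def s t u by blast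
qed

lemma ipath_cat_iso:
  assumes Y: "quasi_category Y" and p: "ipath Y x y"
  shows "\<exists>a. cat_iso (ho Y) x y a"
proof -
  obtain w where w: "smap walking_iso Y w" "w 0 [0] = x" "w 0 [1] = y"
    using p unfolding ipath_def by blast
  show ?thesis
    using cat_iso_ho[OF Y walking_iso_eq_edge(1)[OF w(1)]] walking_iso_eq_edge[OF w(1)] w(2,3) by auto
qed

text \<open>On an edge e the homotopy restricts to the product of the walking isomorphism with an
  interval. The square with sides \<open>[0,1]\<close> in both factors consists of two triangles
  sharing a diagonal; its image d is a composite along both ways around the naturality
  square.\<close>

lemma ihomotopy_natural_edges:
  assumes X: "is_sset X" and h: "ihomotopy X Y f g"
  obtains \<tau> where "\<And>x. x \<in> simplices X 0 \<Longrightarrow> \<tau> x \<in> simplices Y 1"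
    "\<And>x. x \<in> simplices X 0 \<Longrightarrow> src Y (\<tau> x) = f 0 x"
    "\<And>x. x \<in> simplices X 0 \<Longrightarrow> tgt Y (\<tau> x) = g 0 x"
    "\<And>x. x \<in> simplices X 0 \<Longrightarrow> eq_edge Y (\<tau> x)"
    "\<And>e. e \<in> simplices X 1 \<Longrightarrow>
       \<exists>d. tri Y (f 1 e) (\<tau> (tgt X e)) d \<and> tri Y (\<tau> (src X e)) (g 1 e) d"
proof -
  obtain h where h: "smap X (sset_exp Y walking_iso) h"
    and h0: "\<And>n x. x \<in> simplices X n \<Longrightarrow> sset_eval walking_iso [0] n (h n x) = f n x"
    and h1: "\<And>n x. x \<in> simplices X n \<Longrightarrow> sset_eval walking_iso [1] n (h n x) = g n x"
    using assms unfolding ihomotopy_def by blast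
  define \<tau> where "\<tau> x = h 0 x 1 ([0,1], op_const 1)" for x
  have ev: "sset_eval walking_iso [v] 0 (h 0 x) = h 0 x 0 ([v], op_const 0)" for v x
    by (simp add: sset_eval_def walking_iso_def op_const_0 op_comp_def op_id_def)
  show thesis
  proof (rule that)
    fix x assume x: "x \<in> simplices X 0"
    note w = exp_vertex_smap[OF smap_in[OF h x]]
    show "\<tau> x \<in> simplices Y 1" "src Y (\<tau> x) = f 0 x" "tgt Y (\<tau> x) = g 0 x" "eq_edge Y (\<tau> x)"
      using walking_iso_eq_edge[OF w] h0[OF x] h1[OF x] unfolding \<tau>_def ev by auto
  next
    fix e assume e: "e \<in> simplices X 1"
    let ?\<psi> = "h 1 e"
    have \<psi>: "?\<psi> \<in> simplices (sset_exp Y walking_iso) 1" using smap_in[OF h e] .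
    have o: "[0,1] \<in> ops 1 2" "[1,2] \<in> ops 1 2" "[0,2] \<in> ops 1 2" "[0] \<in> ops 0 1" "[1] \<in> ops 0 1"
      "[0,0] \<in> ops 1 0" "[0,1,1] \<in> ops 2 1" "[0,0,1] \<in> ops 2 1"
      by (auto simp: ops_def)
    have m: "[0,0,1] \<in> simplices walking_iso 2" "[0,1,1] \<in> simplices walking_iso 2"
      "[0,1] \<in> simplices walking_iso 1"
      by (auto simp: walking_iso_simps)
    have c: "op_const 1 = [0,0]" by (simp add: op_const_def)
    have t0: "\<tau> (src X e) = ?\<psi> 1 ([0,1], [0,0])" and t1: "\<tau> (tgt X e) = ?\<psi> 1 ([0,1], [1,1])"
      unfolding \<tau>_def c
      using smap_act[OF h o(4) e] smap_act[OF h o(5) e] act_exp[OF o(4) m(3) o(6)]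
        act_exp[OF o(5) m(3) o(6)]
      by (simp_all add: op_comp_def)
    have f: "f 1 e = ?\<psi> 1 ([0,0], [0,1])" and g: "g 1 e = ?\<psi> 1 ([1,1], [0,1])"
      using h0[OF e] h1[OF e] unfolding sset_eval_def c
      by (simp_all add: walking_iso_simps op_comp_def op_id_def)
    note a = exp_simplexD(2)[OF \<psi>, where k = 2 and l = 1]
    \<comment> \<open>The simplex \<open>([0,0,1],[0,1,1])\<close> runs first along e and then
      across the homotopy; the one used for the second triangle runs across first.\<close>
    have "tri Y (f 1 e) (\<tau> (tgt X e)) (?\<psi> 1 ([0,1],[0,1]))" unfolding tri_def f t1
      using exp_simplexD(1)[OF \<psi> m(1) o(7)] a[OF m(1) o(7) o(1)] a[OF m(1) o(7) o(2)] a[OF m(1) o(7) o(3)]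
      by (intro bexI[of _ "?\<psi> 2 ([0,0,1],[0,1,1])"]) (auto simp: walking_iso_simps op_comp_def)
    moreover have "tri Y (\<tau> (src X e)) (g 1 e) (?\<psi> 1 ([0,1],[0,1]))" unfolding tri_def g t0
      using exp_simplexD(1)[OF \<psi> m(2) o(8)] a[OF m(2) o(8) o(1)] a[OF m(2) o(8) o(2)] a[OF m(2) o(8) o(3)]
      by (intro bexI[of _ "?\<psi> 2 ([0,1,1],[0,0,1])"]) (auto simp: walking_iso_simps op_comp_def)
    ultimately show "\<exists>d. tri Y (f 1 e) (\<tau> (tgt X e)) d \<and> tri Y (\<tau> (src X e)) (g 1 e) d" by blast
  qed
qed

text \<open>The functors enter through their values on vertices and edge classes only, so that the
  lemma applies to \<open>id\<close> and to the composites that occur in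
  \<open>cat_equivalence\<close>.\<close>

lemma ihomotopy_nat_iso:
  assumes X: "quasi_category X" and Y: "quasi_category Y" and h: "ihomotopy X Y f g"
    and Fo: "\<And>x. x \<in> simplices X 0 \<Longrightarrow> Fo x = f 0 x" "\<And>x. x \<in> simplices X 0 \<Longrightarrow> Go x = g 0 x"
    and Fm: "\<And>e. e \<in> simplices X 1 \<Longrightarrow> Fm (edge_class X e) = edge_class Y (f 1 e)"
      "\<And>e. e \<in> simplices X 1 \<Longrightarrow> Gm (edge_class X e) = edge_class Y (g 1 e)"
  shows "\<exists>t. nat_iso (ho X) (ho Y) Fo Fm Go Gm t"
proof -
  note sX = quasi_category_is_sset[OF X] and sY = quasi_category_is_sset[OF Y]
  obtain \<tau> where t: "\<And>x. x \<in> simplices X 0 \<Longrightarrow> \<tau> x \<in> simplices Y 1"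
    "\<And>x. x \<in> simplices X 0 \<Longrightarrow> src Y (\<tau> x) = f 0 x"
    "\<And>x. x \<in> simplices X 0 \<Longrightarrow> tgt Y (\<tau> x) = g 0 x"
    "\<And>x. x \<in> simplices X 0 \<Longrightarrow> eq_edge Y (\<tau> x)"
    and tn: "\<And>e. e \<in> simplices X 1 \<Longrightarrow>
       \<exists>d. tri Y (f 1 e) (\<tau> (tgt X e)) d \<and> tri Y (\<tau> (src X e)) (g 1 e) d"
    using ihomotopy_natural_edges[OF sX h] by blast
  show ?thesis
  proof (rule exI[of _ "\<lambda>x. edge_class Y (\<tau> x)"], unfold nat_iso_def cobj_ho[OF X], intro conjI ballI)
    fix x assume x: "x \<in> simplices X 0"
    show "cat_iso (ho Y) (Fo x) (Go x) (edge_class Y (\<tau> x))"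
      using cat_iso_ho[OF Y t(1)[OF x]] t[OF x] Fo[OF x] by simp
  next
    fix x y a assume a: "a \<in> chom (ho X) x y"
    obtain e where e: "e \<in> simplices X 1" "a = edge_class X e" "src X e = x" "tgt X e = y"
      using a by (rule chom_hoE[OF X])
    obtain d where d: "tri Y (f 1 e) (\<tau> y) d" "tri Y (\<tau> x) (g 1 e) d"
      using tn[OF e(1)] e(3,4) by auto
    show "ccomp (ho Y) (edge_class Y (\<tau> y)) (Fm a) = ccomp (ho Y) (Gm a) (edge_class Y (\<tau> x))"
      unfolding e(2) Fm(1)[OF e(1)] Fm(2)[OF e(1)] ccomp_ho[OF Y d(1)] ccomp_ho[OF Y d(2)] ..
  qed
qed

lemma qc_equivalence_cat_equivalence:
  assumes E: "qc_equivalence A B f"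
  shows "cat_equivalence (ho A) (ho B) (f 0) (ho_map B f)"
proof -
  obtain g where A: "quasi_category A" and B: "quasi_category B" and f: "smap A B f"
    and g: "smap B A g" and h: "ihomotopy A A (\<lambda>n x. x) (\<lambda>n x. g n (f n x))"
    and k: "ihomotopy B B (\<lambda>n y. f n (g n y)) (\<lambda>n y. y)"
    using E unfolding qc_equivalence_iff by blast
  have "\<exists>s. nat_iso (ho A) (ho A) id id (g 0 \<circ> f 0) (ho_map A g \<circ> ho_map B f) s"
    by (rule ihomotopy_nat_iso[OF A A h])
      (simp_all add: ho_map_class[OF A B f] ho_map_class[OF B A g] smap_in[OF f] del: One_nat_def)
  moreover have "\<exists>s. nat_iso (ho B) (ho B) (f 0 \<circ> g 0) (ho_map B f \<circ> ho_map A g) id id s"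
    by (rule ihomotopy_nat_iso[OF B B k])
      (simp_all add: ho_map_class[OF A B f] ho_map_class[OF B A g] smap_in[OF g] del: One_nat_def)
  ultimately show ?thesis
    unfolding cat_equivalence_def using cat_functor_ho[OF A B f] cat_functor_ho[OF B A g] by blast
qed

section \<open>Categories enriched in quasi-categories\<close>

lemma tri_prod:
  assumes "tri X f g h" "tri Y f' g' h'"
  shows "tri (sset_prod X Y) (f, f') (g, g') (h, h')"
proof -
  obtain s where "s \<in> simplices X 2" "act X 2 [0,1] s = f" "act X 2 [1,2] s = g" "act X 2 [0,2] s = h"
    using assms(1) unfolding tri_def by blast
  moreover obtain s' where "s' \<in> simplices Y 2" "act Y 2 [0,1] s' = f'" "act Y 2 [1,2] s' = g'"
    "act Y 2 [0,2] s' = h'"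
    using assms(2) unfolding tri_def by blast
  ultimately show ?thesis unfolding tri_def
    by (intro bexI[of _ "(s, s')"]) (auto simp: sset_prod_def)
qed

text \<open>Two of the axioms of an \<infinity>-cosmos. They suffice for the homotopy 2-category,
  for homotopies induced by paths and for the uniqueness of given limits; existence of limits and
  isofibrations enter with the locale \<open>cosmos\<close>.\<close>

locale qc_enriched =
  fixes K :: "('o, 'h) cosmos"
  assumes simplicial: "simplicial_category K"
    and quasi: "\<And>A B. A \<in> obj K \<Longrightarrow> B \<in> obj K \<Longrightarrow> quasi_category (Fun K A B)"
begin

lemma sset_Fun: "A \<in> obj K \<Longrightarrow> B \<in> obj K \<Longrightarrow> is_sset (Fun K A B)"
  using simplicial by (simp add: simplicial_category_def)

lemma ident_in: "A \<in> obj K \<Longrightarrow> ident K A \<in> functors K A A"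
  using simplicial by (simp add: simplicial_category_def)

lemma smap_ecomp:
  "\<lbrakk>A \<in> obj K; B \<in> obj K; C \<in> obj K\<rbrakk> \<Longrightarrow>
    smap (sset_prod (Fun K B C) (Fun K A B)) (Fun K A C) (\<lambda>n (g, f). ecomp K A B C n g f)"
  using simplicial by (simp add: simplicial_category_def)

lemma ecomp_in:
  assumes "A \<in> obj K" "B \<in> obj K" "C \<in> obj K"
    "g \<in> simplices (Fun K B C) n" "f \<in> simplices (Fun K A B) n"
  shows "ecomp K A B C n g f \<in> simplices (Fun K A C) n"
  using smap_in[OF smap_ecomp[OF assms(1-3)], of "(g, f)" n] assms by (simp add: sset_prod_def)

lemma ecomp_act:
  assumes "A \<in> obj K" "B \<in> obj K" "C \<in> obj K" "a \<in> ops m n"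
    "g \<in> simplices (Fun K B C) n" "f \<in> simplices (Fun K A B) n"
  shows "ecomp K A B C m (act (Fun K B C) n a g) (act (Fun K A B) n a f)
    = act (Fun K A C) n a (ecomp K A B C n g f)"
  using smap_act[OF smap_ecomp[OF assms(1-3)] assms(4), of "(g, f)"] assms by (simp add: sset_prod_def)

lemma ecomp_assoc:
  assumes "A \<in> obj K" "B \<in> obj K" "C \<in> obj K" "D \<in> obj K"
    "f \<in> simplices (Fun K A B) n" "g \<in> simplices (Fun K B C) n" "h \<in> simplices (Fun K C D) n"
  shows "ecomp K A C D n h (ecomp K A B C n g f) = ecomp K A B D n (ecomp K B C D n h g) f"
  using simplicial assms unfolding simplicial_category_def by meson

lemma ecomp_dgn_ident:
  assumes "A \<in> obj K" "B \<in> obj K" "f \<in> simplices (Fun K A B) n"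
  shows "ecomp K A A B n f (dgn K A A n (ident K A)) = f"
    "ecomp K A B B n (dgn K B B n (ident K B)) f = f"
  using simplicial assms unfolding simplicial_category_def by meson+

lemma dgn_in:
  assumes "A \<in> obj K" "B \<in> obj K" "f \<in> functors K A B"
  shows "dgn K A B n f \<in> simplices (Fun K A B) n"
  unfolding dgn_def using is_sset_act_in[OF sset_Fun op_const_in] assms by blast

lemma dgn_0:
  assumes "A \<in> obj K" "B \<in> obj K" "f \<in> functors K A B"
  shows "dgn K A B 0 f = f"
  unfolding dgn_def op_const_0 using is_sset_act_id[OF sset_Fun] assms by blast

lemma act_dgn:
  assumes "A \<in> obj K" "B \<in> obj K" "f \<in> functors K A B" "a \<in> ops m n"
  shows "act (Fun K A B) n a (dgn K A B n f) = dgn K A B m f"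
  unfolding dgn_def
  using is_sset_act_act[OF sset_Fun[OF assms(1,2)] op_const_in assms(4,3)] op_comp_const[OF assms(4)]
  by simp

lemma dgn_comp0:
  assumes "A \<in> obj K" "B \<in> obj K" "C \<in> obj K" "g \<in> functors K B C" "f \<in> functors K A B"
  shows "dgn K A C n (comp0 K A B C g f) = ecomp K A B C n (dgn K B C n g) (dgn K A B n f)"
  unfolding dgn_def using ecomp_act[OF assms(1-3) op_const_in assms(4,5)] by simp

lemma comp0_ident:
  assumes "A \<in> obj K" "B \<in> obj K" "f \<in> functors K A B"
  shows "comp0 K A A B f (ident K A) = f" "comp0 K A B B (ident K B) f = f"
  using ecomp_dgn_ident[OF assms] dgn_0[OF _ _ ident_in] assms by simp_all

lemma unit_edge_dgn: "unit_edge (Fun K A B) f = dgn K A B 1 f"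
  by (simp add: dgn_def op_const_def)

lemma tri_ecomp:
  assumes "A \<in> obj K" "B \<in> obj K" "C \<in> obj K"
    "tri (Fun K B C) g g' g''" "tri (Fun K A B) f f' f''"
  shows "tri (Fun K A C) (ecomp K A B C 1 g f) (ecomp K A B C 1 g' f') (ecomp K A B C 1 g'' f'')"
  using tri_smap[OF smap_ecomp[OF assms(1-3)] tri_prod[OF assms(4,5)]] by simp

lemma src_tgt_ecomp:
  assumes "A \<in> obj K" "B \<in> obj K" "C \<in> obj K"
    "g \<in> simplices (Fun K B C) 1" "f \<in> simplices (Fun K A B) 1"
  shows "src (Fun K A C) (ecomp K A B C 1 g f) = comp0 K A B C (src (Fun K B C) g) (src (Fun K A B) f)"
    "tgt (Fun K A C) (ecomp K A B C 1 g f) = comp0 K A B C (tgt (Fun K B C) g) (tgt (Fun K A B) f)"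
proof -
  have o: "[0] \<in> ops 0 1" "[1] \<in> ops 0 1" by (auto simp: ops_def)
  show "src (Fun K A C) (ecomp K A B C 1 g f) = comp0 K A B C (src (Fun K B C) g) (src (Fun K A B) f)"
    "tgt (Fun K A C) (ecomp K A B C 1 g f) = comp0 K A B C (tgt (Fun K B C) g) (tgt (Fun K A B) f)"
    using ecomp_act[OF assms(1-3) o(1) assms(4,5)] ecomp_act[OF assms(1-3) o(2) assms(4,5)] by simp_all
qed

lemma ecomp_unit:
  assumes "A \<in> obj K" "B \<in> obj K" "C \<in> obj K" "g \<in> functors K B C" "f \<in> functors K A B"
  shows "ecomp K A B C 1 (unit_edge (Fun K B C) g) (unit_edge (Fun K A B) f)
    = unit_edge (Fun K A C) (comp0 K A B C g f)"
  unfolding unit_edge_dgn using dgn_comp0[OF assms] by simp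

lemma edge_homotopic_ecomp:
  assumes o: "A \<in> obj K" "B \<in> obj K" "C \<in> obj K"
    and g: "edge_homotopic (Fun K B C) g g'" and f: "edge_homotopic (Fun K A B) f f'"
  shows "edge_homotopic (Fun K A C) (ecomp K A B C 1 g f) (ecomp K A B C 1 g' f')"
proof -
  note sg = sset_Fun[OF o(2,3)] and sf = sset_Fun[OF o(1,2)] and s = sset_Fun[OF o(1,3)]
  note ig = edge_homotopic_in[OF sg g] and jf = edge_homotopic_in[OF sf f]
  have "tri (Fun K B C) g (unit_edge (Fun K B C) (tgt (Fun K B C) g)) g'"
    "tri (Fun K A B) f (unit_edge (Fun K A B) (tgt (Fun K A B) f)) f'"
    using f g edge_homotopic_iff[OF sg] edge_homotopic_iff[OF sf] by simp_all
  from tri_ecomp[OF o this] show ?thesis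
    unfolding edge_homotopic_iff[OF s] src_tgt_ecomp[OF o ig(1) jf(1)]
    using ecomp_unit[OF o edge_ends(2)[OF sg ig(1)] edge_ends(2)[OF sf jf(1)]] by simp
qed

abbreviation hK where "hK \<equiv> homotopy_2_category K"

lemma h2c_simps:
  "tobj hK = obj K" "thom hK A B = ho (Fun K A B)" "tid hK = ident K"
  "tcomp1 hK A B C g f = comp0 K A B C g f"
  by (simp_all add: homotopy_2_category_def)

text \<open>\<open>tcomp2\<close> takes a union over all representatives. Composition preserves
  homotopy in both arguments, so the classes in that union coincide.\<close>

lemma tcomp2_class:
  assumes o: "A \<in> obj K" "B \<in> obj K" "C \<in> obj K"
    and g: "g \<in> simplices (Fun K B C) 1" and f: "f \<in> simplices (Fun K A B) 1"
  shows "tcomp2 hK A B C (edge_class (Fun K B C) g) (edge_class (Fun K A B) f)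
    = edge_class (Fun K A C) (ecomp K A B C 1 g f)"
proof -
  note q = quasi[OF o(2,3)] quasi[OF o(1,2)] quasi[OF o(1,3)]
  have "edge_class (Fun K A C) (ecomp K A B C 1 y x) = edge_class (Fun K A C) (ecomp K A B C 1 g f)"
    if "y \<in> edge_class (Fun K B C) g" "x \<in> edge_class (Fun K A B) f" for x y
  proof -
    have "edge_homotopic (Fun K A C) (ecomp K A B C 1 g f) (ecomp K A B C 1 y x)"
      using edge_homotopic_ecomp[OF o] that by (simp add: edge_class_def)
    then show ?thesis using edge_class_eqI[OF q(3)] by simp
  qed
  then have "tcomp2 hK A B C (edge_class (Fun K B C) g) (edge_class (Fun K A B) f) =
    (\<Union>y\<in>edge_class (Fun K B C) g. \<Union>x\<in>edge_class (Fun K A B) f. edge_class (Fun K A C) (ecomp K A B C 1 g f))"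
    by (simp add: homotopy_2_category_def)
  also have "\<dots> = edge_class (Fun K A C) (ecomp K A B C 1 g f)"
    using edge_class_self[OF q(1) g] edge_class_self[OF q(2) f] by (subst UN_constant)+ auto
  finally show ?thesis .
qed

lemma cell2E:
  assumes "A \<in> obj K" "B \<in> obj K" "a \<in> chom (ho (Fun K A B)) x y"
  obtains f where "f \<in> simplices (Fun K A B) 1" "a = edge_class (Fun K A B) f"
    "src (Fun K A B) f = x" "tgt (Fun K A B) f = y"
  using chom_hoE[OF quasi[OF assms(1,2)] assms(3)] by blast

text \<open>Composition is strictly associative and unital on edges, so the laws of horizontal
  composition already hold for representatives. Apart from the hom-categories themselves, only
  interchange involves triangles.\<close>

lemma strict_2_category_h2c: "strict_2_category hK"
  unfolding strict_2_category_def h2c_simps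
proof (intro conjI ballI)
  fix A B assume o: "A \<in> obj K" "B \<in> obj K"
  show "is_category (ho (Fun K A B))" using is_category_ho[OF quasi[OF o]] .
next
  fix A assume "A \<in> obj K"
  then show "ident K A \<in> cobj (ho (Fun K A A))" using ident_in by (simp add: ho_def)
next
  fix A B C f g assume o: "A \<in> obj K" "B \<in> obj K" "C \<in> obj K"
    and "f \<in> cobj (ho (Fun K A B))" "g \<in> cobj (ho (Fun K B C))"
  then have fg: "g \<in> functors K B C" "f \<in> functors K A B" by (simp_all add: ho_def)
  show "comp0 K A B C g f \<in> cobj (ho (Fun K A C))" using ecomp_in[OF o fg] by (simp add: ho_def)
  show "tcomp2 hK A B C (cid (ho (Fun K B C)) g) (cid (ho (Fun K A B)) f) =
    cid (ho (Fun K A C)) (comp0 K A B C g f)"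
    using o fg by (simp add: cid_ho quasi tcomp2_class[simplified] unit_edge_in[simplified] sset_Fun ecomp_unit[simplified])
next
  fix A B C f f' g g' a b assume o: "A \<in> obj K" "B \<in> obj K" "C \<in> obj K"
    and a: "a \<in> chom (ho (Fun K A B)) f f'" and b: "b \<in> chom (ho (Fun K B C)) g g'"
  obtain x where x: "x \<in> simplices (Fun K A B) 1" "a = edge_class (Fun K A B) x"
    "src (Fun K A B) x = f" "tgt (Fun K A B) x = f'" using a by (rule cell2E[OF o(1,2)])
  obtain y where y: "y \<in> simplices (Fun K B C) 1" "b = edge_class (Fun K B C) y"
    "src (Fun K B C) y = g" "tgt (Fun K B C) y = g'" using b by (rule cell2E[OF o(2,3)])
  show "tcomp2 hK A B C b a \<in> chom (ho (Fun K A C)) (comp0 K A B C g f) (comp0 K A B C g' f')"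
    unfolding x(2) y(2) tcomp2_class[OF o y(1) x(1)]
    using chom_hoI[OF quasi[OF o(1,3)] ecomp_in[OF o y(1) x(1)]] src_tgt_ecomp[OF o y(1) x(1)] x y
    by simp
next
  fix A B C f f' f'' g g' g'' a a' b b' assume o: "A \<in> obj K" "B \<in> obj K" "C \<in> obj K"
    and a: "a \<in> chom (ho (Fun K A B)) f f'" and a': "a' \<in> chom (ho (Fun K A B)) f' f''"
    and b: "b \<in> chom (ho (Fun K B C)) g g'" and b': "b' \<in> chom (ho (Fun K B C)) g' g''"
  note qf = quasi[OF o(1,2)] and qg = quasi[OF o(2,3)]
  obtain x where x: "x \<in> simplices (Fun K A B) 1" "a = edge_class (Fun K A B) x"
    "src (Fun K A B) x = f" "tgt (Fun K A B) x = f'" using a by (rule cell2E[OF o(1,2)])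
  obtain x' where x': "x' \<in> simplices (Fun K A B) 1" "a' = edge_class (Fun K A B) x'"
    "src (Fun K A B) x' = f'" "tgt (Fun K A B) x' = f''" using a' by (rule cell2E[OF o(1,2)])
  obtain y where y: "y \<in> simplices (Fun K B C) 1" "b = edge_class (Fun K B C) y"
    "src (Fun K B C) y = g" "tgt (Fun K B C) y = g'" using b by (rule cell2E[OF o(2,3)])
  obtain y' where y': "y' \<in> simplices (Fun K B C) 1" "b' = edge_class (Fun K B C) y'"
    "src (Fun K B C) y' = g'" "tgt (Fun K B C) y' = g''" using b' by (rule cell2E[OF o(2,3)])
  obtain x'' where tx: "tri (Fun K A B) x x' x''" using tri_exists[OF qf x(1) x'(1)] x x' by auto
  obtain y'' where ty: "tri (Fun K B C) y y' y''" using tri_exists[OF qg y(1) y'(1)] y y' by auto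
  \<comment> \<open>Interchange: composition is simplicial on the product, so it carries the two
    chosen composition triangles to a third one.\<close>
  note t = tri_ecomp[OF o ty tx]
  show "tcomp2 hK A B C (ccomp (ho (Fun K B C)) b' b) (ccomp (ho (Fun K A B)) a' a) =
    ccomp (ho (Fun K A C)) (tcomp2 hK A B C b' a') (tcomp2 hK A B C b a)"
    unfolding x(2) y(2) x'(2) y'(2) ccomp_ho[OF qf tx] ccomp_ho[OF qg ty]
      tcomp2_class[OF o y(1) x(1)] tcomp2_class[OF o y'(1) x'(1)]
      tcomp2_class[OF o tri_edges(3)[OF sset_Fun[OF o(2,3)] ty] tri_edges(3)[OF sset_Fun[OF o(1,2)] tx]]
      ccomp_ho[OF quasi[OF o(1,3)] t] ..
next
  fix A B f assume o: "A \<in> obj K" "B \<in> obj K" and "f \<in> cobj (ho (Fun K A B))"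
  then show "comp0 K A A B f (ident K A) = f" "comp0 K A B B (ident K B) f = f"
    using comp0_ident by (simp_all add: ho_def)
next
  fix A B f f' a assume o: "A \<in> obj K" "B \<in> obj K" and a: "a \<in> chom (ho (Fun K A B)) f f'"
  obtain x where x: "x \<in> simplices (Fun K A B) 1" "a = edge_class (Fun K A B) x"
    using a by (rule cell2E[OF o])
  have u: "unit_edge (Fun K A A) (ident K A) \<in> simplices (Fun K A A) 1"
    "unit_edge (Fun K B B) (ident K B) \<in> simplices (Fun K B B) 1"
    using unit_edge_in[OF sset_Fun ident_in] o by blast+
  show "tcomp2 hK A A B a (cid (ho (Fun K A A)) (ident K A)) = a"
    unfolding x(2) cid_ho[OF quasi[OF o(1,1)]] tcomp2_class[OF o(1,1,2) x(1) u(1)]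
    unfolding unit_edge_dgn ecomp_dgn_ident[OF o x(1)] ..
  show "tcomp2 hK A B B (cid (ho (Fun K B B)) (ident K B)) a = a"
    unfolding x(2) cid_ho[OF quasi[OF o(2,2)]] tcomp2_class[OF o(1,2,2) u(2) x(1)]
    unfolding unit_edge_dgn ecomp_dgn_ident[OF o x(1)] ..
next
  fix A B C D f g h assume o: "A \<in> obj K" "B \<in> obj K" "C \<in> obj K" "D \<in> obj K"
    and "f \<in> cobj (ho (Fun K A B))" "g \<in> cobj (ho (Fun K B C))" "h \<in> cobj (ho (Fun K C D))"
  then show "comp0 K A C D h (comp0 K A B C g f) = comp0 K A B D (comp0 K B C D h g) f"
    using ecomp_assoc[OF o] by (simp add: ho_def)
next
  fix A B C D f f' g g' h h' a b c assume o: "A \<in> obj K" "B \<in> obj K" "C \<in> obj K" "D \<in> obj K"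
    and a: "a \<in> chom (ho (Fun K A B)) f f'" and b: "b \<in> chom (ho (Fun K B C)) g g'"
    and c: "c \<in> chom (ho (Fun K C D)) h h'"
  obtain x where x: "x \<in> simplices (Fun K A B) 1" "a = edge_class (Fun K A B) x"
    using a by (rule cell2E[OF o(1,2)])
  obtain y where y: "y \<in> simplices (Fun K B C) 1" "b = edge_class (Fun K B C) y"
    using b by (rule cell2E[OF o(2,3)])
  obtain z where z: "z \<in> simplices (Fun K C D) 1" "c = edge_class (Fun K C D) z"
    using c by (rule cell2E[OF o(3,4)])
  show "tcomp2 hK A C D c (tcomp2 hK A B C b a) = tcomp2 hK A B D (tcomp2 hK B C D c b) a"
    unfolding x(2) y(2) z(2) tcomp2_class[OF o(1,2,3) y(1) x(1)] tcomp2_class[OF o(2,3,4) z(1) y(1)]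
      tcomp2_class[OF o(1,3,4) z(1) ecomp_in[OF o(1,2,3) y(1) x(1)]]
      tcomp2_class[OF o(1,2,4) ecomp_in[OF o(2,3,4) z(1) y(1)] x(1)]
      ecomp_assoc[OF o x(1) y(1) z(1)] ..
qed

section \<open>Composition with a fixed functor and with a path of functors\<close>

lemma smap_post:
  assumes o: "X \<in> obj K" "A \<in> obj K" "B \<in> obj K" and f: "f \<in> functors K A B"
  shows "smap (Fun K X A) (Fun K X B) (post K X A B f)"
proof (rule smapI)
  fix n x assume x: "x \<in> simplices (Fun K X A) n"
  show "post K X A B f n x \<in> simplices (Fun K X B) n"
    unfolding post_def using ecomp_in[OF o dgn_in[OF o(2,3) f] x] .
  fix m a assume a: "a \<in> ops m n"
  show "post K X A B f m (act (Fun K X A) n a x) = act (Fun K X B) n a (post K X A B f n x)"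
    unfolding post_def
    using ecomp_act[OF o a dgn_in[OF o(2,3) f] x] act_dgn[OF o(2,3) f a] by simp
qed

lemma post_0:
  assumes "A \<in> obj K" "B \<in> obj K" "f \<in> functors K A B"
  shows "post K X A B f 0 x = comp0 K X A B f x"
  by (simp add: post_def dgn_0[OF assms])

lemma post_comp:
  assumes o: "X \<in> obj K" "A \<in> obj K" "B \<in> obj K" "C \<in> obj K"
    and f: "f \<in> functors K A B" and g: "g \<in> functors K B C" and x: "x \<in> simplices (Fun K X A) n"
  shows "post K X A C (comp0 K A B C g f) n x = post K X B C g n (post K X A B f n x)"
  unfolding post_def dgn_comp0[OF o(2-4) g f]
  using ecomp_assoc[OF o x dgn_in[OF o(2,3) f] dgn_in[OF o(3,4) g]] by simp

lemma post_ident: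
  assumes "X \<in> obj K" "A \<in> obj K" "x \<in> simplices (Fun K X A) n"
  shows "post K X A A (ident K A) n x = x"
  unfolding post_def using ecomp_dgn_ident(2)[OF assms] .

text \<open>Composing simplices x with the simplices of the path is a simplicial map of two
  variables, and currying it gives the homotopy. The same path works for every X, as an equivalence
  in a cosmos demands.\<close>

lemma ihomotopy_post:
  assumes o: "X \<in> obj K" "A \<in> obj K" "B \<in> obj K" and p: "ipath (Fun K A B) f g"
  shows "ihomotopy (Fun K X A) (Fun K X B) (post K X A B f) (post K X A B g)"
proof -
  obtain w where w: "smap walking_iso (Fun K A B) w" "w 0 [0] = f" "w 0 [1] = g"
    using p unfolding ipath_def by blast
  let ?h = "\<lambda>n x k. \<lambda>(u, b) \<in> simplices (sset_prod walking_iso (std_simplex n)) k.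
    ecomp K X A B k (w k u) (act (Fun K X A) n b x)"
  have "smap (Fun K X A) (sset_exp (Fun K X B) walking_iso) ?h"
    by (rule smap_curry[OF is_sset_walking_iso sset_Fun[OF o(1,2)]])
      (simp_all add: ecomp_in[OF o] smap_in[OF w(1)] smap_act[OF w(1)] ecomp_act[OF o])
  moreover have "sset_eval walking_iso v n (?h n x) = ecomp K X A B n (dgn K A B n (w 0 v)) x"
    if "v \<in> simplices walking_iso 0" "x \<in> simplices (Fun K X A) n" for v n x
    unfolding dgn_def
    using sset_eval_curry[OF is_sset_walking_iso sset_Fun[OF o(1,2)] that,
        where H = "\<lambda>k u y. ecomp K X A B k (w k u) y"]
    by (simp add: smap_act[OF w(1) op_const_in that(1)])
  ultimately show ?thesis
    unfolding ihomotopy_def post_def using w(2,3)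
    by (intro exI[of _ ?h]) (auto simp: walking_iso_simps)
qed

text \<open>The counterpart of \<open>post\<close>: restriction of mapping objects along f. It is
  needed to change the test object in the groupoidal condition, which the definition of an
  equivalence, made with \<open>post\<close>, does not address.\<close>

definition pre :: "'o \<Rightarrow> 'o \<Rightarrow> 'o \<Rightarrow> 'h \<Rightarrow> nat \<Rightarrow> 'h \<Rightarrow> 'h" where
  "pre X Y A f n x = ecomp K X Y A n x (dgn K X Y n f)"

lemma smap_pre:
  assumes o: "X \<in> obj K" "Y \<in> obj K" "A \<in> obj K" and f: "f \<in> functors K X Y"
  shows "smap (Fun K Y A) (Fun K X A) (pre X Y A f)"
proof (rule smapI)
  fix n x assume x: "x \<in> simplices (Fun K Y A) n"
  show "pre X Y A f n x \<in> simplices (Fun K X A) n"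
    unfolding pre_def using ecomp_in[OF o x dgn_in[OF o(1,2) f]] .
  fix m a assume a: "a \<in> ops m n"
  show "pre X Y A f m (act (Fun K Y A) n a x) = act (Fun K X A) n a (pre X Y A f n x)"
    unfolding pre_def
    using ecomp_act[OF o a x dgn_in[OF o(1,2) f]] act_dgn[OF o(1,2) f a] by simp
qed

lemma pre_comp:
  assumes o: "X \<in> obj K" "Y \<in> obj K" "Z \<in> obj K" "A \<in> obj K"
    and f: "f \<in> functors K X Y" and g: "g \<in> functors K Y Z" and x: "x \<in> simplices (Fun K Z A) n"
  shows "pre X Z A (comp0 K X Y Z g f) n x = pre X Y A f n (pre Y Z A g n x)"
  unfolding pre_def dgn_comp0[OF o(1-3) g f]
  using ecomp_assoc[OF o dgn_in[OF o(1,2) f] dgn_in[OF o(2,3) g] x] by simp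

lemma pre_0:
  assumes "X \<in> obj K" "Y \<in> obj K" "f \<in> functors K X Y"
  shows "pre X Y A f 0 x = comp0 K X Y A x f"
  by (simp add: pre_def dgn_0[OF assms])

lemma ihomotopy_pre:
  assumes o: "X \<in> obj K" "Y \<in> obj K" "A \<in> obj K" and p: "ipath (Fun K X Y) f g"
  shows "ihomotopy (Fun K Y A) (Fun K X A) (pre X Y A f) (pre X Y A g)"
proof -
  obtain w where w: "smap walking_iso (Fun K X Y) w" "w 0 [0] = f" "w 0 [1] = g"
    using p unfolding ipath_def by blast
  let ?h = "\<lambda>n x k. \<lambda>(u, b) \<in> simplices (sset_prod walking_iso (std_simplex n)) k.
    ecomp K X Y A k (act (Fun K Y A) n b x) (w k u)"
  have "smap (Fun K Y A) (sset_exp (Fun K X A) walking_iso) ?h"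
    by (rule smap_curry[OF is_sset_walking_iso sset_Fun[OF o(2,3)], where H = "\<lambda>k u y. ecomp K X Y A k y (w k u)"])
      (simp_all add: ecomp_in[OF o] smap_in[OF w(1)] smap_act[OF w(1)] ecomp_act[OF o])
  moreover have "sset_eval walking_iso v n (?h n x) = ecomp K X Y A n x (dgn K X Y n (w 0 v))"
    if "v \<in> simplices walking_iso 0" "x \<in> simplices (Fun K Y A) n" for v n x
    unfolding dgn_def
    using sset_eval_curry[OF is_sset_walking_iso sset_Fun[OF o(2,3)] that,
        where H = "\<lambda>k u y. ecomp K X Y A k y (w k u)"]
    by (simp add: smap_act[OF w(1) op_const_in that(1)])
  ultimately show ?thesis
    unfolding ihomotopy_def pre_def using w(2,3)
    by (intro exI[of _ ?h]) (auto simp: walking_iso_simps)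
qed

lemma ipath_comp_left:
  assumes o: "X \<in> obj K" "A \<in> obj K" "B \<in> obj K" and h: "h \<in> functors K A B"
    and p: "ipath (Fun K X A) f g"
  shows "ipath (Fun K X B) (comp0 K X A B h f) (comp0 K X A B h g)"
  using ipath_smap[OF p smap_post[OF o h]] by (simp add: post_0[OF o(2,3) h])

lemma ipath_comp_right:
  assumes o: "X \<in> obj K" "Y \<in> obj K" "A \<in> obj K" and h: "h \<in> functors K X Y"
    and p: "ipath (Fun K Y A) f g"
  shows "ipath (Fun K X A) (comp0 K X Y A f h) (comp0 K X Y A g h)"
  using ipath_smap[OF p smap_pre[OF o h]] by (simp add: pre_0[OF o(1,2) h])

end

section \<open>Change of the exponent\<close>

text \<open>The map of exponentials \<open>Y\<^sup>V \<rightarrow> Y\<^sup>U\<close> induced by i :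
  U \<rightarrow> V.\<close>

definition exp_pre :: "'u sset \<Rightarrow> (nat \<Rightarrow> 'u \<Rightarrow> 'v) \<Rightarrow> nat \<Rightarrow> (nat \<Rightarrow> 'v \<times> nat list \<Rightarrow> 'x) \<Rightarrow>
    nat \<Rightarrow> 'u \<times> nat list \<Rightarrow> 'x" where
  "exp_pre U i n \<phi> = (\<lambda>k. \<lambda>(u, b) \<in> simplices (sset_prod U (std_simplex n)) k. \<phi> k (i k u, b))"

lemma exp_pre_in:
  assumes U: "is_sset U" and i: "smap U V i" and \<phi>: "\<phi> \<in> simplices (sset_exp Y V) n"
  shows "exp_pre U i n \<phi> \<in> simplices (sset_exp Y U) n"
proof (rule exp_simplexI)
  fix u k b assume ub: "u \<in> simplices U k" "b \<in> ops k n"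
  note iu = smap_in[OF i ub(1)]
  show "exp_pre U i n \<phi> k (u, b) \<in> simplices Y k"
    using exp_simplexD(1)[OF \<phi> iu ub(2)] ub by (simp add: exp_pre_def simplices_prod_std)
  fix a l assume a: "a \<in> ops l k"
  show "exp_pre U i n \<phi> l (act U k a u, op_comp b a) = act Y k a (exp_pre U i n \<phi> k (u, b))"
    using exp_simplexD(2)[OF \<phi> iu ub(2) a] ub a smap_act[OF i a ub(1)] is_sset_act_in[OF U a ub(1)]
    by (simp add: exp_pre_def simplices_prod_std op_comp_in)
qed (simp add: exp_pre_def)

lemma exp_pre_inverse:
  assumes U: "is_sset U" and V: "is_sset V" and i: "smap U V i" and j: "smap V U j"
    and ij: "\<And>n v. v \<in> simplices V n \<Longrightarrow> i n (j n v) = v" and \<phi>: "\<phi> \<in> simplices (sset_exp Y V) n"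
  shows "exp_pre V j n (exp_pre U i n \<phi>) = \<phi>"
proof (rule exp_eqI[OF exp_pre_in[OF V j exp_pre_in[OF U i \<phi>]] \<phi>])
  fix v k b assume "v \<in> simplices V k" "b \<in> ops k n"
  then show "exp_pre V j n (exp_pre U i n \<phi>) k (v, b) = \<phi> k (v, b)"
    using smap_in[OF j] ij by (simp add: exp_pre_def simplices_prod_std)
qed

text \<open>The cosmos axioms speak of simplicial sets over an arbitrary infinite type only; copies along an
  injection bring \<open>walking_iso\<close> and \<open>std_simplex 1\<close> there.\<close>

definition sset_image :: "('x \<Rightarrow> 'y) \<Rightarrow> 'x sset \<Rightarrow> 'y sset" where
  "sset_image \<iota> X = \<lparr>simplices = (\<lambda>n. \<iota> ` simplices X n), act = (\<lambda>n a y. \<iota> (act X n a (inv \<iota> y)))\<rparr>"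

lemma
  assumes i: "inj \<iota>" and X: "is_sset X"
  shows is_sset_image: "is_sset (sset_image \<iota> X)"
    and smap_image: "smap X (sset_image \<iota> X) (\<lambda>n. \<iota>)"
    and smap_inv_image: "smap (sset_image \<iota> X) X (\<lambda>n. inv \<iota>)"
  using X unfolding is_sset_def smap_def sset_image_def
  by (auto simp: inv_f_f[OF i] Pi_iff)

lemma ex_inj_nat_list: "\<exists>\<iota> :: nat list \<Rightarrow> 'u::infinite. inj \<iota>"
proof -
  obtain f :: "nat \<Rightarrow> 'u" where f: "inj f"
    using infinite_countable_subset[OF infinite_UNIV] by blast
  have "inj list_encode" by (rule inj_list_encode)
  then have "inj (f \<circ> list_encode)" using f by (simp add: inj_compose)
  then show ?thesis by blast
qed

section \<open>Limits in enriched categories\<close>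

context qc_enriched
begin

section \<open>Terminal objects, products and pullbacks\<close>

lemma terminal_eq:
  "\<lbrakk>is_terminal K T; X \<in> obj K; x \<in> simplices (Fun K X T) n; y \<in> simplices (Fun K X T) n\<rbrakk> \<Longrightarrow> x = y"
  unfolding is_terminal_def by metis

lemma terminal_arrow:
  assumes "is_terminal K T" "X \<in> obj K"
  obtains t where "t \<in> simplices (Fun K X T) n"
  using assms unfolding is_terminal_def by metis

text \<open>The axioms provide pullbacks of isofibrations, and cosmos functors preserve them, but
  products are not named. Over a terminal object the matching condition of a pullback is vacuous, so
  products come for free.\<close>

lemma product_iff_pullback:
  assumes T: "is_terminal K T" and f: "f \<in> functors K A T" and g: "g \<in> functors K B T"
    and o: "A \<in> obj K" "B \<in> obj K"
  shows "is_product K A B P a b \<longleftrightarrow> is_pullback K A B T f g P a b"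
proof -
  have To: "T \<in> obj K" using T by (simp add: is_terminal_def)
  have "{(x, y). x \<in> simplices (Fun K X A) n \<and> y \<in> simplices (Fun K X B) n \<and>
     post K X A T f n x = post K X B T g n y} = simplices (Fun K X A) n \<times> simplices (Fun K X B) n"
    if X: "X \<in> obj K" for X n
    using terminal_eq[OF T X smap_in[OF smap_post[OF X o(1) To f]] smap_in[OF smap_post[OF X o(2) To g]]]
    by auto
  moreover have "comp0 K P A T f a = comp0 K P B T g b"
    if "P \<in> obj K" "a \<in> functors K P A" "b \<in> functors K P B"
    using terminal_eq[OF T that(1) ecomp_in[OF that(1) o(1) To f that(2)] ecomp_in[OF that(1) o(2) To g that(3)]] .
  ultimately show ?thesis unfolding is_product_def is_pullback_def using assms To by auto
qed

lemma product_eqI: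
  assumes P: "is_product K A B P a b" and X: "X \<in> obj K"
    and z: "z \<in> simplices (Fun K X P) n" "z' \<in> simplices (Fun K X P) n"
    and "post K X P A a n z = post K X P A a n z'" "post K X P B b n z = post K X P B b n z'"
  shows "z = z'"
proof -
  have "inj_on (\<lambda>z. (post K X P A a n z, post K X P B b n z)) (simplices (Fun K X P) n)"
    using P X unfolding is_product_def bij_betw_def by blast
  then show ?thesis using assms by (auto dest: inj_onD)
qed

lemma product_pair:
  assumes P: "is_product K A B P a b" and X: "X \<in> obj K"
    and x: "x \<in> simplices (Fun K X A) n" and y: "y \<in> simplices (Fun K X B) n"
  obtains z where "z \<in> simplices (Fun K X P) n" "post K X P A a n z = x" "post K X P B b n z = y"
proof -
  have "(\<lambda>z. (post K X P A a n z, post K X P B b n z)) ` simplices (Fun K X P) n =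
    simplices (Fun K X A) n \<times> simplices (Fun K X B) n"
    using P X unfolding is_product_def bij_betw_def by blast
  then have "(x, y) \<in> (\<lambda>z. (post K X P A a n z, post K X P B b n z)) ` simplices (Fun K X P) n"
    using x y by simp
  then show thesis using that by auto
qed

lemma product_eq0I:
  assumes P: "is_product K A B P a b" and X: "X \<in> obj K"
    and z: "z \<in> functors K X P" "z' \<in> functors K X P"
    and "comp0 K X P A a z = comp0 K X P A a z'" "comp0 K X P B b z = comp0 K X P B b z'"
  shows "z = z'"
proof (rule product_eqI[OF P X z])
  have "P \<in> obj K" "A \<in> obj K" "B \<in> obj K" "a \<in> functors K P A" "b \<in> functors K P B"
    using P by (simp_all add: is_product_def)
  then show "post K X P A a 0 z = post K X P A a 0 z'" "post K X P B b 0 z = post K X P B b 0 z'"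
    using assms by (simp_all add: post_0)
qed

lemma product_pair0:
  assumes P: "is_product K A B P a b" and X: "X \<in> obj K"
    and x: "x \<in> functors K X A" and y: "y \<in> functors K X B"
  obtains z where "z \<in> functors K X P" "comp0 K X P A a z = x" "comp0 K X P B b z = y"
proof -
  have "P \<in> obj K" "A \<in> obj K" "B \<in> obj K" "a \<in> functors K P A" "b \<in> functors K P B"
    using P by (simp_all add: is_product_def)
  then show thesis using product_pair[OF P X x y] that by (auto simp: post_0)
qed

lemma pullback_eq0I:
  assumes P: "is_pullback K A E B f p P a e" and X: "X \<in> obj K"
    and z: "z \<in> functors K X P" "z' \<in> functors K X P"
    and "comp0 K X P A a z = comp0 K X P A a z'" "comp0 K X P E e z = comp0 K X P E e z'"
  shows "z = z'"
proof -
  have *: "P \<in> obj K" "A \<in> obj K" "E \<in> obj K" "a \<in> functors K P A" "e \<in> functors K P E"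
    using P by (simp_all add: is_pullback_def)
  have "inj_on (\<lambda>z. (post K X P A a 0 z, post K X P E e 0 z)) (functors K X P)"
    using P X unfolding is_pullback_def bij_betw_def by blast
  then show ?thesis using assms * by (auto dest: inj_onD simp: post_0)
qed

lemma pullback_pair0:
  assumes P: "is_pullback K A E B f p P a e" and X: "X \<in> obj K"
    and x: "x \<in> functors K X A" and y: "y \<in> functors K X E" and xy: "comp0 K X A B f x = comp0 K X E B p y"
  obtains z where "z \<in> functors K X P" "comp0 K X P A a z = x" "comp0 K X P E e z = y"
proof -
  have *: "P \<in> obj K" "A \<in> obj K" "E \<in> obj K" "B \<in> obj K" "a \<in> functors K P A" "e \<in> functors K P E"
    "f \<in> functors K A B" "p \<in> functors K E B"
    using P by (simp_all add: is_pullback_def)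
  have "(\<lambda>z. (post K X P A a 0 z, post K X P E e 0 z)) ` functors K X P =
    {(x, y). x \<in> functors K X A \<and> y \<in> functors K X E \<and> post K X A B f 0 x = post K X E B p 0 y}"
    using P X unfolding is_pullback_def bij_betw_def by blast
  then have "(x, y) \<in> (\<lambda>z. (post K X P A a 0 z, post K X P E e 0 z)) ` functors K X P"
    using x y xy * by (simp add: post_0)
  then show thesis using that * by (auto simp: post_0)
qed

section \<open>Cotensors\<close>

lemma cotensor_compare_in:
  assumes U: "is_sset U" and o: "X \<in> obj K" "P \<in> obj K" "A \<in> obj K"
    and t: "smap U (Fun K P A) t" and z: "z \<in> simplices (Fun K X P) n"
  shows "cotensor_compare K U A P t X n z \<in> simplices (sset_exp (Fun K X A) U) n"
proof (rule exp_simplexI)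
  fix u k b assume ub: "u \<in> simplices U k" "b \<in> ops k n"
  have zb: "act (Fun K X P) n b z \<in> simplices (Fun K X P) k"
    using is_sset_act_in[OF sset_Fun[OF o(1,2)] ub(2) z] .
  show "cotensor_compare K U A P t X n z k (u, b) \<in> simplices (Fun K X A) k"
    using ub ecomp_in[OF o smap_in[OF t ub(1)] zb]
    by (simp add: cotensor_compare_def simplices_prod_std)
  fix a l assume a: "a \<in> ops l k"
  show "cotensor_compare K U A P t X n z l (act U k a u, op_comp b a) =
    act (Fun K X A) k a (cotensor_compare K U A P t X n z k (u, b))"
    using ub a ecomp_act[OF o a smap_in[OF t ub(1)] zb] smap_act[OF t a ub(1)]
      is_sset_act_act[OF sset_Fun[OF o(1,2)] ub(2) a z] is_sset_act_in[OF U a ub(1)]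
    by (simp add: cotensor_compare_def simplices_prod_std op_comp_in)
qed (simp add: cotensor_compare_def)

text \<open>Restriction along an isomorphism U \<rightarrow> V is a bijection of exponentials and
  carries the comparison map for V to the one for U.\<close>

lemma is_cotensor_transfer:
  assumes C: "is_cotensor K V A P t" and V: "is_sset V" and U: "is_sset U"
    and i: "smap U V i" and j: "smap V U j"
    and ji: "\<And>n u. u \<in> simplices U n \<Longrightarrow> j n (i n u) = u"
    and ij: "\<And>n v. v \<in> simplices V n \<Longrightarrow> i n (j n v) = v"
  shows "is_cotensor K U A P (\<lambda>n u. t n (i n u))"
proof -
  have o: "A \<in> obj K" "P \<in> obj K" and t: "smap V (Fun K P A) t" using C by (auto simp: is_cotensor_def)
  have "bij_betw (cotensor_compare K U A P (\<lambda>n u. t n (i n u)) X n)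
    (simplices (Fun K X P) n) (simplices (sset_exp (Fun K X A) U) n)" if X: "X \<in> obj K" for X n
  proof -
    have "bij_betw (exp_pre U i n) (simplices (sset_exp (Fun K X A) V) n) (simplices (sset_exp (Fun K X A) U) n)"
      by (rule bij_betw_byWitness[where f' = "exp_pre V j n"])
        (auto simp: exp_pre_inverse[OF U V i j ij] exp_pre_inverse[OF V U j i ji] exp_pre_in[OF U i] exp_pre_in[OF V j])
    moreover have "bij_betw (cotensor_compare K V A P t X n) (simplices (Fun K X P) n)
        (simplices (sset_exp (Fun K X A) V) n)"
      using C X unfolding is_cotensor_def by blast
    ultimately have "bij_betw (exp_pre U i n \<circ> cotensor_compare K V A P t X n)
        (simplices (Fun K X P) n) (simplices (sset_exp (Fun K X A) U) n)"
      by (rule bij_betw_trans[rotated])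
    moreover have "exp_pre U i n \<circ> cotensor_compare K V A P t X n =
        cotensor_compare K U A P (\<lambda>n u. t n (i n u)) X n"
      unfolding comp_def exp_pre_def cotensor_compare_def
      using smap_in[OF i] by (intro ext) (auto simp: simplices_prod_std)
    ultimately show ?thesis by (simp only:)
  qed
  then show ?thesis unfolding is_cotensor_def using o smap_comp[OF i t] by blast
qed

text \<open>For a copy of a simplicial set along \<iota>, \<open>\<iota> (inv \<iota> u)\<close> is
  u only when u lies in the copy. Structure maps must therefore be exchangeable as soon as they
  agree on simplices.\<close>

lemma is_cotensor_cong:
  assumes C: "is_cotensor K U A P t" and U: "is_sset U"
    and t: "\<And>n u. u \<in> simplices U n \<Longrightarrow> t' n u = t n u"
  shows "is_cotensor K U A P t'"
proof -
  have "smap U (Fun K P A) t'"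
    using C is_sset_act_in[OF U] t unfolding is_cotensor_def smap_def by (auto simp: Pi_iff)
  moreover have "cotensor_compare K U A P t' X n = cotensor_compare K U A P t X n" for X n
    unfolding cotensor_compare_def using t by (intro ext) (auto simp: simplices_prod_std)
  ultimately show ?thesis using C unfolding is_cotensor_def by auto
qed

lemma is_cotensor_image_iff:
  assumes i: "inj \<iota>" and U: "is_sset U"
  shows "is_cotensor K (sset_image \<iota> U) A P (\<lambda>n u. t n (inv \<iota> u)) \<longleftrightarrow> is_cotensor K U A P t"
proof
  note im = is_sset_image[OF i U] smap_image[OF i U] smap_inv_image[OF i U]
  have v: "inv \<iota> (\<iota> u) = u" for u using i by simp
  have w: "\<iota> (inv \<iota> v) = v" if "v \<in> simplices (sset_image \<iota> U) n" for v n
    using that i by (auto simp: sset_image_def)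
  show "is_cotensor K U A P t \<Longrightarrow> is_cotensor K (sset_image \<iota> U) A P (\<lambda>n u. t n (inv \<iota> u))"
    using is_cotensor_transfer[OF _ U im(1,3,2)] w v by blast
  assume "is_cotensor K (sset_image \<iota> U) A P (\<lambda>n u. t n (inv \<iota> u))"
  from is_cotensor_transfer[OF this im(1) U im(2,3)] show "is_cotensor K U A P t"
    using w by (simp add: v)
qed

lemma is_cotensor_image:
  assumes i: "inj \<iota>" and U: "is_sset U" and C: "is_cotensor K (sset_image \<iota> U) A P t"
  shows "is_cotensor K U A P (\<lambda>n u. t n (\<iota> u))"
proof -
  have "is_cotensor K (sset_image \<iota> U) A P (\<lambda>n u. t n (\<iota> (inv \<iota> u)))"
    by (rule is_cotensor_cong[OF C is_sset_image[OF i U]]) (auto simp: sset_image_def i)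
  then show ?thesis using is_cotensor_image_iff[OF i U, where t = "\<lambda>n u. t n (\<iota> u)"] by simp
qed

text \<open>The universal property in dimension 0: w is a vertex of the exponential, hence the image
  of a functor under the comparison map.\<close>

lemma cotensor_factor:
  assumes C: "is_cotensor K U A P t" and U: "is_sset U" and X: "X \<in> obj K"
    and w: "smap U (Fun K X A) w"
  obtains z where "z \<in> functors K X P"
    "\<And>n u. u \<in> simplices U n \<Longrightarrow> ecomp K X P A n (t n u) (dgn K X P n z) = w n u"
proof -
  let ?\<phi> = "\<lambda>n. \<lambda>(s, b) \<in> simplices (sset_prod U (std_simplex 0)) n. w n s"
  have "cotensor_compare K U A P t X 0 ` functors K X P = simplices (sset_exp (Fun K X A) U) 0"
    using C X unfolding is_cotensor_def bij_betw_def by blast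
  then obtain z where z: "z \<in> functors K X P" "cotensor_compare K U A P t X 0 z = ?\<phi>"
    using smap_exp_vertex[OF U w] by (metis (no_types, lifting) imageE)
  have "ecomp K X P A n (t n u) (dgn K X P n z) = w n u" if u: "u \<in> simplices U n" for n u
    using fun_cong[OF fun_cong[OF z(2)], of n "(u, op_const n)"] u op_const_in[of n 0]
    by (simp add: cotensor_compare_def simplices_prod_std dgn_def)
  then show thesis using that z(1) by blast
qed

text \<open>In dimension 0 the operator component is constant, so the comparison map sees z only
  through its totally degenerate simplices.\<close>

lemma cotensor_eqI:
  assumes C: "is_cotensor K U A P t" and X: "X \<in> obj K"
    and z: "z \<in> functors K X P" "z' \<in> functors K X P"
    and eq: "\<And>n u. u \<in> simplices U n \<Longrightarrow>
      ecomp K X P A n (t n u) (dgn K X P n z) = ecomp K X P A n (t n u) (dgn K X P n z')"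
  shows "z = z'"
proof -
  have "inj_on (cotensor_compare K U A P t X 0) (functors K X P)"
    using C X unfolding is_cotensor_def bij_betw_def by blast
  moreover have "cotensor_compare K U A P t X 0 z = cotensor_compare K U A P t X 0 z'"
    unfolding cotensor_compare_def
    using eq by (intro ext) (auto simp: simplices_prod_std dgn_def restrict_def dest!: ops_0_eq_const)
  ultimately show ?thesis using z by (auto dest: inj_onD)
qed

text \<open>Simplices of a fixed dimension in a mapping object into T are unique, so both sides of
  the comparison have exactly one element.\<close>

lemma terminal_cotensor:
  assumes T: "is_terminal K T" and U: "is_sset U" and t: "smap U (Fun K T T) t"
  shows "is_cotensor K U T T t"
proof -
  have To: "T \<in> obj K" using T by (simp add: is_terminal_def)
  have "bij_betw (cotensor_compare K U T T t X n)
    (simplices (Fun K X T) n) (simplices (sset_exp (Fun K X T) U) n)" if X: "X \<in> obj K" for X n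
  proof (rule bij_betw_imageI)
    show "inj_on (cotensor_compare K U T T t X n) (simplices (Fun K X T) n)"
      by (rule inj_onI) (rule terminal_eq[OF T X])
    obtain z where z: "z \<in> simplices (Fun K X T) n" using T X by (rule terminal_arrow)
    have "\<phi> = cotensor_compare K U T T t X n z"
      if \<phi>: "\<phi> \<in> simplices (sset_exp (Fun K X T) U) n" for \<phi>
    proof (rule exp_eqI[OF \<phi>])
      show c: "cotensor_compare K U T T t X n z \<in> simplices (sset_exp (Fun K X T) U) n"
        using cotensor_compare_in[OF U X To To t z] .
      show "\<phi> k (u, b) = cotensor_compare K U T T t X n z k (u, b)"
        if "u \<in> simplices U k" "b \<in> ops k n" for u k b
        using terminal_eq[OF T X exp_simplexD(1)[OF \<phi> that] exp_simplexD(1)[OF c that]] .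
    qed
    then show "cotensor_compare K U T T t X n ` simplices (Fun K X T) n = simplices (sset_exp (Fun K X T) U) n"
      using z cotensor_compare_in[OF U X To To t] by blast
  qed
  then show ?thesis using To t unfolding is_cotensor_def by blast
qed

text \<open>A square \<open>A \<times> A\<close> is a power of \<open>A\<close> by two points. They are taken inside \<open>V\<close>, because the Leibniz
  axiom requires an inclusion.\<close>

definition endpoints :: "'u sset \<Rightarrow> 'u \<Rightarrow> 'u \<Rightarrow> 'u sset" where
  "endpoints V v0 v1 =
    \<lparr>simplices = (\<lambda>n. {act V 0 (op_const n) v0, act V 0 (op_const n) v1}), act = act V\<rparr>"

lemma act_vertex:
  assumes V: "is_sset V" and v: "v \<in> simplices V 0" and a: "a \<in> ops m n"
  shows "act V n a (act V 0 (op_const n) v) = act V 0 (op_const m) v"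
  using is_sset_act_act[OF V op_const_in a v] op_comp_const[OF a] by simp

lemma sub_sset_endpoints:
  assumes V: "is_sset V" and v: "v0 \<in> simplices V 0" "v1 \<in> simplices V 0"
  shows "sub_sset (endpoints V v0 v1) V"
proof -
  have s: "simplices (endpoints V v0 v1) n \<subseteq> simplices V n" for n
    using is_sset_act_in[OF V op_const_in] v by (auto simp: endpoints_def)
  have c: "act V n a x \<in> simplices (endpoints V v0 v1) m"
    if "a \<in> ops m n" "x \<in> simplices (endpoints V v0 v1) n" for a m n x
    using that act_vertex[OF V v(1) that(1)] act_vertex[OF V v(2) that(1)] by (auto simp: endpoints_def)
  have a: "act (endpoints V v0 v1) = act V" by (simp add: endpoints_def)
  have "is_sset (endpoints V v0 v1)"
    unfolding is_sset_def a using V s c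
    by (auto simp: Pi_iff is_sset_act_id[OF V] subset_iff intro!: is_sset_act_act[OF V])
  then show ?thesis
    unfolding sub_sset_def smap_def a using V s by auto
qed

text \<open>A map out of two points is a pair. A simplex of the exponential is determined by its
  values at the two points paired with \<open>op_id n\<close>, because every other pair arises from
  these by an operator; the product supplies a z with the two values.\<close>

lemma product_cotensor:
  assumes Y: "is_product K A A Y y1 y0" and V: "is_sset V"
    and v: "v0 \<in> simplices V 0" "v1 \<in> simplices V 0" "v0 \<noteq> v1"
  defines "t \<equiv> \<lambda>n u. if u = act V 0 (op_const n) v1 then dgn K Y A n y1 else dgn K Y A n y0"
  shows "is_cotensor K (endpoints V v0 v1) A Y t"
    "t n (act V 0 (op_const n) v1) = dgn K Y A n y1"
    "t n (act V 0 (op_const n) v0) = dgn K Y A n y0"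
proof -
  let ?U = "endpoints V v0 v1"
  let ?d = "\<lambda>n v. act V 0 (op_const n) v"
  have o: "A \<in> obj K" "Y \<in> obj K" and y: "y1 \<in> functors K Y A" "y0 \<in> functors K Y A"
    using Y by (simp_all add: is_product_def)
  have U: "is_sset ?U" using sub_sset_endpoints[OF V v(1,2)] by (simp add: sub_sset_def)
  have aU: "act ?U = act V" by (simp add: endpoints_def)
  \<comment> \<open>The case distinction in t is consistent because the two points stay distinct in
    every dimension: restriction to a vertex recovers v0 and v1.\<close>
  have dist: "?d n v0 \<noteq> ?d n v1" for n
  proof
    assume "?d n v0 = ?d n v1"
    then have "act V n (op_const 0) (?d n v0) = act V n (op_const 0) (?d n v1)" by simp
    then show False
      using act_vertex[OF V v(1), of "op_const 0" 0 n] act_vertex[OF V v(2), of "op_const 0" 0 n] v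
      by (simp add: op_const_in) (simp add: op_const_0 is_sset_act_id[OF V])
  qed
  show t1: "t n (?d n v1) = dgn K Y A n y1" for n by (simp add: t_def)
  show t0: "t n (?d n v0) = dgn K Y A n y0" for n using dist by (simp add: t_def)
  have U2: "u = ?d n v0 \<or> u = ?d n v1" if "u \<in> simplices ?U n" for u n
    using that by (auto simp: endpoints_def)
  have d: "?d n v0 \<in> simplices ?U n" "?d n v1 \<in> simplices ?U n" for n by (simp_all add: endpoints_def)
  have t: "smap ?U (Fun K Y A) t"
  proof (rule smapI)
    fix n u assume u: "u \<in> simplices ?U n"
    show "t n u \<in> simplices (Fun K Y A) n" using dgn_in[OF o(2,1)] y by (simp add: t_def)
    fix m a assume a: "a \<in> ops m n"
    show "t m (act ?U n a u) = act (Fun K Y A) n a (t n u)"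
      using U2[OF u] act_dgn[OF o(2,1) y(1) a] act_dgn[OF o(2,1) y(2) a]
        act_vertex[OF V v(1) a] act_vertex[OF V v(2) a]
      by (auto simp: aU t0 t1)
  qed
  have "bij_betw (cotensor_compare K ?U A Y t X n)
    (simplices (Fun K X Y) n) (simplices (sset_exp (Fun K X A) ?U) n)" if X: "X \<in> obj K" for X n
  proof (rule bij_betw_imageI)
    note oid = op_id_in[of n]
    have val1: "cotensor_compare K ?U A Y t X n z k (?d k v1, b) = post K X Y A y1 k (act (Fun K X Y) n b z)"
      and val0: "cotensor_compare K ?U A Y t X n z k (?d k v0, b) = post K X Y A y0 k (act (Fun K X Y) n b z)"
      if "b \<in> ops k n" for z k b
      using d that by (simp_all add: cotensor_compare_def simplices_prod_std t0 t1 post_def)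
    have id: "act (Fun K X Y) n (op_id n) z = z" if "z \<in> simplices (Fun K X Y) n" for z
      using is_sset_act_id[OF sset_Fun[OF X o(2)] that] .
    show "inj_on (cotensor_compare K ?U A Y t X n) (simplices (Fun K X Y) n)"
    proof (rule inj_onI)
      fix z z' assume z: "z \<in> simplices (Fun K X Y) n" "z' \<in> simplices (Fun K X Y) n"
        and eq: "cotensor_compare K ?U A Y t X n z = cotensor_compare K ?U A Y t X n z'"
      show "z = z'"
        using eq val1[OF oid, of z] val1[OF oid, of z'] val0[OF oid, of z] val0[OF oid, of z'] id z
        by (intro product_eqI[OF Y X z]) auto
    qed
    have "\<exists>z\<in>simplices (Fun K X Y) n. \<phi> = cotensor_compare K ?U A Y t X n z"
      if \<phi>: "\<phi> \<in> simplices (sset_exp (Fun K X A) ?U) n" for \<phi>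
    proof -
      obtain z where z: "z \<in> simplices (Fun K X Y) n"
        "post K X Y A y1 n z = \<phi> n (?d n v1, op_id n)" "post K X Y A y0 n z = \<phi> n (?d n v0, op_id n)"
        using product_pair[OF Y X exp_simplexD(1)[OF \<phi> d(2) oid] exp_simplexD(1)[OF \<phi> d(1) oid]] by blast
      have "\<phi> = cotensor_compare K ?U A Y t X n z"
      proof (rule exp_eqI[OF \<phi> cotensor_compare_in[OF U X o(2,1) t z(1)]])
        fix u k b assume u: "u \<in> simplices ?U k" and b: "b \<in> ops k n"
        have "\<phi> k (?d k v1, b) = post K X Y A y1 k (act (Fun K X Y) n b z)"
          using exp_simplexD(2)[OF \<phi> d(2) oid b] smap_act[OF smap_post[OF X o(2,1) y(1)] b z(1)]
            act_vertex[OF V v(2) b] op_comp_id_left[OF b] z(2) by (simp add: aU)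
        moreover have "\<phi> k (?d k v0, b) = post K X Y A y0 k (act (Fun K X Y) n b z)"
          using exp_simplexD(2)[OF \<phi> d(1) oid b] smap_act[OF smap_post[OF X o(2,1) y(2)] b z(1)]
            act_vertex[OF V v(1) b] op_comp_id_left[OF b] z(3) by (simp add: aU)
        ultimately show "\<phi> k (u, b) = cotensor_compare K ?U A Y t X n z k (u, b)"
          using U2[OF u] val0[OF b] val1[OF b] by auto
      qed
      then show ?thesis using z(1) by blast
    qed
    then show "cotensor_compare K ?U A Y t X n ` simplices (Fun K X Y) n = simplices (sset_exp (Fun K X A) ?U) n"
      using cotensor_compare_in[OF U X o(2,1) t] by blast
  qed
  then show "is_cotensor K ?U A Y t" using o t unfolding is_cotensor_def by blast
qed

end

section \<open>\<infinity>-cosmoi\<close>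

locale cosmos =
  fixes size :: "'u::infinite itself" and K :: "('o, 'h) cosmos"
  assumes infinity_cosmos: "infinity_cosmos size K"
begin

sublocale qc_enriched K
  using infinity_cosmos by unfold_locales (simp_all add: infinity_cosmos_def)

lemmas axioms_from_simplicial = infinity_cosmos[unfolded infinity_cosmos_def]
lemmas axioms_from_isofib = axioms_from_simplicial[THEN conjunct2, THEN conjunct2]
lemmas axioms_from_cotensor = axioms_from_isofib[THEN conjunct2, THEN conjunct2, THEN conjunct2]
lemmas axioms_from_terminal_isofib = axioms_from_cotensor[THEN conjunct2, THEN conjunct2, THEN conjunct2]
lemmas axioms_from_leibniz = axioms_from_terminal_isofib[THEN conjunct2, THEN conjunct2]

lemma isofib_functor: "\<lbrakk>A \<in> obj K; B \<in> obj K; p \<in> isofib K A B\<rbrakk> \<Longrightarrow> p \<in> functors K A B"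
  using axioms_from_isofib[THEN conjunct1] by blast

lemma terminal_exists: "\<exists>T. is_terminal K T"
  using axioms_from_isofib[THEN conjunct2, THEN conjunct2, THEN conjunct1] .

lemma cotensor_exists:
  fixes U :: "'u sset"
  shows "\<lbrakk>A \<in> obj K; is_sset U\<rbrakk> \<Longrightarrow> \<exists>P t. is_cotensor K U A P t"
  using axioms_from_cotensor[THEN conjunct1] by blast

lemma pullback_exists:
  "\<lbrakk>A \<in> obj K; E \<in> obj K; B \<in> obj K; f \<in> functors K A B; p \<in> isofib K E B\<rbrakk>
    \<Longrightarrow> \<exists>P a e. is_pullback K A E B f p P a e"
  using axioms_from_cotensor[THEN conjunct2, THEN conjunct1] by blast

lemma isofib_terminal:
  "\<lbrakk>A \<in> obj K; is_terminal K T; f \<in> functors K A T\<rbrakk> \<Longrightarrow> f \<in> isofib K A T"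
  using axioms_from_terminal_isofib[THEN conjunct1] by blast

lemma isofib_pullback:
  "\<lbrakk>is_pullback K A E B f p P a e; p \<in> isofib K E B\<rbrakk> \<Longrightarrow> a \<in> isofib K P A"
  using axioms_from_terminal_isofib[THEN conjunct2, THEN conjunct1] by blast

lemma isofib_leibniz:
  fixes U V :: "'u sset"
  assumes "E \<in> obj K" "B \<in> obj K" "p \<in> isofib K E B" "sub_sset U V"
    "is_cotensor K V E EV sV" "is_cotensor K U E EU sU"
    "is_cotensor K V B BV tV" "is_cotensor K U B BU tU"
    "cotensor_post K V E B p EV sV BV tV pV" "cotensor_post K U E B p EU sU BU tU pU"
    "cotensor_restrict K U E EV sV EU sU rE" "cotensor_restrict K U B BV tV BU tU rB"
    "is_pullback K BV EU BU rB pU P a e"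
    "l \<in> functors K EV P" "comp0 K EV P EU e l = rE" "comp0 K EV P BV a l = pV"
  shows "l \<in> isofib K EV P"
  using axioms_from_leibniz[THEN conjunct1, rule_format, OF assms] .

lemma isofib_post:
  "\<lbrakk>X \<in> obj K; E \<in> obj K; B \<in> obj K; p \<in> isofib K E B\<rbrakk>
    \<Longrightarrow> qc_isofibration (Fun K X E) (Fun K X B) (post K X E B p)"
  using axioms_from_leibniz[THEN conjunct2] by blast

lemma product_exists:
  assumes o: "A \<in> obj K" "B \<in> obj K"
  shows "\<exists>P a b. is_product K A B P a b"
proof -
  obtain T where T: "is_terminal K T" using terminal_exists by blast
  obtain f where f: "f \<in> functors K A T" using T o(1) by (rule terminal_arrow)
  obtain g where g: "g \<in> functors K B T" using T o(2) by (rule terminal_arrow)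
  have "T \<in> obj K" using T by (simp add: is_terminal_def)
  from pullback_exists[OF o this f isofib_terminal[OF o(2) T g]]
  show ?thesis using product_iff_pullback[OF T f g o] by blast
qed

text \<open>This is the Leibniz axiom for \<open>A \<rightarrow> 1\<close> and a pair of vertices of \<open>V\<close>.\<close>

lemma endpoint_isofib:
  fixes V :: "'u sset"
  assumes V: "is_sset V" and v: "v0 \<in> simplices V 0" "v1 \<in> simplices V 0" "v0 \<noteq> v1"
    and C: "is_cotensor K V A P t" and Y: "is_product K A A Y y1 y0" and p: "p \<in> functors K P Y"
    and p1: "comp0 K P Y A y1 p = t 0 v1" and p0: "comp0 K P Y A y0 p = t 0 v0"
  shows "p \<in> isofib K P Y"
proof -
  let ?U = "endpoints V v0 v1"
  obtain T where T: "is_terminal K T" using terminal_exists by blast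
  have To: "T \<in> obj K" using T by (simp add: is_terminal_def)
  have o: "A \<in> obj K" "Y \<in> obj K" "P \<in> obj K" and y: "y1 \<in> functors K Y A" "y0 \<in> functors K Y A"
    and t: "smap V (Fun K P A) t"
    using Y C by (simp_all add: is_product_def is_cotensor_def)
  note sub = sub_sset_endpoints[OF V v(1,2)]
  have U: "is_sset ?U" using sub by (simp add: sub_sset_def)
  note eqT = terminal_eq[OF T]
  obtain bA where bA: "bA \<in> functors K A T" using T o(1) by (rule terminal_arrow)
  obtain bY where bY: "bY \<in> functors K Y T" using T o(2) by (rule terminal_arrow)
  obtain bP where bP: "bP \<in> functors K P T" using T o(3) by (rule terminal_arrow)
  \<comment> \<open>T is its own cotensor by any W; the structure map used here is constant at the
    identity.\<close>
  define s where "s W n u = dgn K T T n (ident K T)" for W :: "'u sset" and n and u :: 'u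
  have s: "smap W (Fun K T T) (s W)" for W
    by (rule smapI) (simp_all add: s_def dgn_in To ident_in act_dgn)
  define tU where "tU n u = (if u = act V 0 (op_const n) v1 then dgn K Y A n y1 else dgn K Y A n y0)"
    for n u
  note CU = product_cotensor[OF Y V v, folded tU_def]
  have tU: "smap ?U (Fun K Y A) tU" using CU(1) by (simp add: is_cotensor_def)
  show ?thesis
  proof (rule isofib_leibniz[OF o(1) To isofib_terminal[OF o(1) T bA] sub C CU(1)
        terminal_cotensor[OF T V s] terminal_cotensor[OF T U s]])
    show "cotensor_post K V A T bA P t T (s V) bP"
      unfolding cotensor_post_def
    proof (intro conjI allI ballI bP)
      fix n u assume u: "u \<in> simplices V n"
      show "ecomp K P T T n (s V n u) (dgn K P T n bP) = ecomp K P A T n (dgn K A T n bA) (t n u)"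
        by (rule eqT[OF o(3) ecomp_in[OF o(3) To To smap_in[OF s u] dgn_in[OF o(3) To bP]]
              ecomp_in[OF o(3,1) To dgn_in[OF o(1) To bA] smap_in[OF t u]]])
    qed
    show "cotensor_post K ?U A T bA Y tU T (s ?U) bY"
      unfolding cotensor_post_def
    proof (intro conjI allI ballI bY)
      fix n u assume u: "u \<in> simplices ?U n"
      show "ecomp K Y T T n (s ?U n u) (dgn K Y T n bY) = ecomp K Y A T n (dgn K A T n bA) (tU n u)"
        by (rule eqT[OF o(2) ecomp_in[OF o(2) To To smap_in[OF s u] dgn_in[OF o(2) To bY]]
              ecomp_in[OF o(2,1) To dgn_in[OF o(1) To bA] smap_in[OF tU u]]])
    qed
    show "cotensor_restrict K ?U A P t Y tU p"
      unfolding cotensor_restrict_def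
    proof (intro conjI allI ballI p)
      fix n u assume "u \<in> simplices ?U n"
      then have "u = act V 0 (op_const n) v0 \<or> u = act V 0 (op_const n) v1" by (auto simp: endpoints_def)
      then show "ecomp K P Y A n (tU n u) (dgn K P Y n p) = t n u"
        using dgn_comp0[OF o(3,2,1) y(1) p, of n] dgn_comp0[OF o(3,2,1) y(2) p, of n] p0 p1
          smap_act[OF t op_const_in v(1), of n] smap_act[OF t op_const_in v(2), of n]
        by (auto simp: CU(2,3) dgn_def)
    qed
    show "cotensor_restrict K ?U T T (s V) T (s ?U) (ident K T)"
      unfolding cotensor_restrict_def
    proof (intro conjI allI ballI ident_in To)
      fix n u assume "u \<in> simplices ?U n"
      show "ecomp K T T T n (s ?U n u) (dgn K T T n (ident K T)) = s V n u"
        unfolding s_def by (simp add: ecomp_dgn_ident To dgn_in ident_in)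
    qed
    \<comment> \<open>Both cotensors of T are T itself, so the pullback in the Leibniz axiom is a
      pullback of \<open>bY\<close> along an identity, that is Y. The induced functor into it is
      then p.\<close>
    show "is_pullback K T Y T (ident K T) bY Y bY (ident K Y)"
      unfolding is_pullback_def
    proof (intro conjI ballI allI To o ident_in bY)
      show "comp0 K Y T T (ident K T) bY = comp0 K Y Y T bY (ident K Y)"
        by (simp add: comp0_ident To o bY)
      fix X n assume X: "X \<in> obj K"
      show "bij_betw (\<lambda>z. (post K X Y T bY n z, post K X Y Y (ident K Y) n z)) (simplices (Fun K X Y) n)
        {(x, y). x \<in> simplices (Fun K X T) n \<and> y \<in> simplices (Fun K X Y) n \<and>
          post K X T T (ident K T) n x = post K X Y T bY n y}"
        by (rule bij_betw_byWitness[where f' = snd])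
          (auto simp: post_ident[OF X o(2)] post_ident[OF X To] smap_in[OF smap_post[OF X o(2) To bY]])
    qed
    show "p \<in> functors K P Y" by fact
    show "comp0 K P Y Y (ident K Y) p = p" using comp0_ident[OF o(3,2) p] by simp
    show "comp0 K P Y T bY p = bP" using eqT[OF o(3) ecomp_in[OF o(3,2) To bY p] bP] .
  qed
qed

text \<open>Applied to \<open>walking_iso\<close> for the concatenation of paths, and to
  \<open>std_simplex 1\<close> for the projection that defines commas.\<close>

lemma endpoint_isofib_nat_list:
  fixes V :: "nat list sset"
  assumes V: "is_sset V" and v: "v0 \<in> simplices V 0" "v1 \<in> simplices V 0" "v0 \<noteq> v1"
    and C: "is_cotensor K V A P t" and Y: "is_product K A A Y y1 y0" and p: "p \<in> functors K P Y"
    and p1: "comp0 K P Y A y1 p = t 0 v1" and p0: "comp0 K P Y A y0 p = t 0 v0"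
  shows "p \<in> isofib K P Y"
proof -
  obtain \<iota> :: "nat list \<Rightarrow> 'u" where i: "inj \<iota>" using ex_inj_nat_list by blast
  show ?thesis
  proof (rule endpoint_isofib[OF is_sset_image[OF i V] _ _ _ _ Y p])
    show "\<iota> v0 \<in> simplices (sset_image \<iota> V) 0" "\<iota> v1 \<in> simplices (sset_image \<iota> V) 0" "\<iota> v0 \<noteq> \<iota> v1"
      using v i by (auto simp: sset_image_def inj_eq)
    show "is_cotensor K (sset_image \<iota> V) A P (\<lambda>n u. t n (inv \<iota> u))"
      using is_cotensor_image_iff[OF i V] C by blast
  qed (simp_all add: p0 p1 i)
qed

lemma cotensor_exists_nat_list:
  fixes V :: "nat list sset"
  assumes V: "is_sset V" and A: "A \<in> obj K"
  shows "\<exists>P t. is_cotensor K V A P t"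
proof -
  obtain \<iota> :: "nat list \<Rightarrow> 'u" where i: "inj \<iota>" using ex_inj_nat_list by blast
  obtain P t where "is_cotensor K (sset_image \<iota> V) A P t"
    using cotensor_exists[OF A is_sset_image[OF i V]] by blast
  then show ?thesis using is_cotensor_image[OF i V] by blast
qed

text \<open>The lifting property of postcomposition with p against the inclusion of the vertex 0 of
  the walking isomorphism, with the vertex z read as a map out of
  \<open>std_simplex 0\<close>.\<close>

lemma isofib_lift_path:
  assumes o: "X \<in> obj K" "E \<in> obj K" "B \<in> obj K" and p: "p \<in> isofib K E B"
    and w: "smap walking_iso (Fun K X B) w" and z: "z \<in> functors K X E"
    and wz: "comp0 K X E B p z = w 0 [0]"
  obtains z' where "ipath (Fun K X E) z z'" "comp0 K X E B p z' = w 0 [1]"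
proof -
  have pf: "p \<in> functors K E B" using isofib_functor[OF o(2,3) p] .
  note sp = smap_post[OF o pf] and sE = sset_Fun[OF o(1,2)]
  have rlp: "has_rlp (std_simplex 0) walking_iso (\<lambda>m s. map (\<lambda>_. 0) s) (Fun K X E) (Fun K X B) (post K X E B p)"
    using isofib_post[OF o p] unfolding qc_isofibration_def by simp
  have z0: "[0] \<in> simplices walking_iso 0" by (simp add: walking_iso_simps)
  \<comment> \<open>The lifting square commutes in all dimensions once it does at the vertex, since
    every operator into [0] is constant.\<close>
  have comm: "post K X E B p n (act (Fun K X E) 0 s z) = w n (map (\<lambda>_. 0) s)"
    if "s \<in> simplices (std_simplex 0) n" for n s
  proof -
    have s: "s \<in> ops n 0" using that by (simp add: std_simplex_def)
    have "map (\<lambda>_. 0) s = act walking_iso 0 s [0]"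
      using ops_0_eq_const[OF s] by (simp add: walking_iso_simps op_comp_def op_const_def)
    then show ?thesis
      using smap_act[OF sp s z] smap_act[OF w s z0] wz by (simp add: post_0[OF o(2,3) pf])
  qed
  obtain l where l: "smap walking_iso (Fun K X E) l"
    and l0: "\<And>n s. s \<in> simplices (std_simplex 0) n \<Longrightarrow> l n (map (\<lambda>_. 0) s) = act (Fun K X E) 0 s z"
    and lp: "\<And>n s. s \<in> simplices walking_iso n \<Longrightarrow> post K X E B p n (l n s) = w n s"
    using rlp[unfolded has_rlp_def, rule_format, OF smap_yoneda[OF sE z] w] comm by blast
  have i: "[0] = op_id 0" "[0] \<in> simplices (std_simplex 0) 0"
    by (simp_all add: op_id_def std_simplex_def ops_def)
  have "l 0 [0] = z" using l0[OF i(2)] is_sset_act_id[OF sE z] unfolding i(1)[symmetric] by simp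
  moreover have "comp0 K X E B p (l 0 [1]) = w 0 [1]"
    using lp[of "[1]" 0] by (simp add: walking_iso_simps post_0[OF o(2,3) pf])
  ultimately show thesis using that l unfolding ipath_def by blast
qed

text \<open>Transitivity without a filler for composable isomorphisms: \<open>A\<^sup>\<I> \<rightarrow> A \<times> A\<close> is an isofibration, so the
  path \<open>(x, \<beta>)\<close> lifts to one starting at \<open>\<alpha>\<close>, and its end is a path from \<open>x\<close> to \<open>z\<close>.\<close>

lemma ipath_trans:
  assumes o: "X \<in> obj K" "A \<in> obj K"
    and a: "ipath (Fun K X A) x y" and b: "ipath (Fun K X A) y z"
  shows "ipath (Fun K X A) x z"
proof -
  obtain P t where C: "is_cotensor K walking_iso A P t"
    using cotensor_exists_nat_list[OF is_sset_walking_iso o(2)] by blast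
  obtain Y y1 y0 where Y: "is_product K A A Y y1 y0" using product_exists[OF o(2,2)] by blast
  have P: "P \<in> obj K" and t: "smap walking_iso (Fun K P A) t" using C by (simp_all add: is_cotensor_def)
  have Yo: "Y \<in> obj K" and y: "y1 \<in> functors K Y A" "y0 \<in> functors K Y A"
    using Y by (simp_all add: is_product_def)
  have v: "[0] \<in> simplices walking_iso 0" "[1] \<in> simplices walking_iso 0" by (simp_all add: walking_iso_simps)
  note t01 = smap_in[OF t v(1)] smap_in[OF t v(2)]
  obtain p where p: "p \<in> functors K P Y" "comp0 K P Y A y1 p = t 0 [1]" "comp0 K P Y A y0 p = t 0 [0]"
    using product_pair0[OF Y P t01(2,1)] by blast
  have pi: "p \<in> isofib K P Y"
    using endpoint_isofib_nat_list[OF is_sset_walking_iso v _ C Y p] by simp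
  obtain \<alpha> where \<alpha>: "smap walking_iso (Fun K X A) \<alpha>" "\<alpha> 0 [0] = x" "\<alpha> 0 [1] = y"
    using a unfolding ipath_def by blast
  obtain \<beta> where \<beta>: "smap walking_iso (Fun K X A) \<beta>" "\<beta> 0 [0] = y" "\<beta> 0 [1] = z"
    using b unfolding ipath_def by blast
  have x: "x \<in> functors K X A" using ipath_in[OF a] by simp
  \<comment> \<open>q is the path \<alpha>, regarded as a functor into the path object P.\<close>
  obtain q where q: "q \<in> functors K X P"
    and tq': "\<And>n s. s \<in> simplices walking_iso n \<Longrightarrow> ecomp K X P A n (t n s) (dgn K X P n q) = \<alpha> n s"
    using cotensor_factor[OF C is_sset_walking_iso o(1) \<alpha>(1)] by blast
  have tq: "comp0 K X P A (t 0 s) q = \<alpha> 0 s" if "s \<in> simplices walking_iso 0" for s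
    using tq'[OF that] dgn_0[OF o(1) P q] by simp
  \<comment> \<open>The path in \<open>Y\<close>, that is in A \<times> A, with component \<beta>
    under \<open>y1\<close> and the constant path at x under \<open>y0\<close>. It is chosen simplex
    by simplex; uniqueness in the product makes the choice simplicial.\<close>
  define v where "v n s = (SOME r. r \<in> simplices (Fun K X Y) n \<and> post K X Y A y1 n r = \<beta> n s \<and>
    post K X Y A y0 n r = dgn K X A n x)" for n s
  have vs: "v n s \<in> simplices (Fun K X Y) n \<and> post K X Y A y1 n (v n s) = \<beta> n s \<and>
    post K X Y A y0 n (v n s) = dgn K X A n x" if "s \<in> simplices walking_iso n" for n s
    unfolding v_def
    by (rule someI_ex) (metis product_pair[OF Y o(1) smap_in[OF \<beta>(1) that] dgn_in[OF o x]])
  have vm: "smap walking_iso (Fun K X Y) v"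
  proof (rule smapI)
    fix n s assume s: "s \<in> simplices walking_iso n"
    then show vn: "v n s \<in> simplices (Fun K X Y) n" using vs by blast
    fix m a assume a: "a \<in> ops m n"
    have as: "act walking_iso n a s \<in> simplices walking_iso m"
      using is_sset_act_in[OF is_sset_walking_iso a s] .
    show "v m (act walking_iso n a s) = act (Fun K X Y) n a (v n s)"
    proof (rule product_eqI[OF Y o(1)])
      show "v m (act walking_iso n a s) \<in> simplices (Fun K X Y) m" using vs[OF as] by blast
      show "act (Fun K X Y) n a (v n s) \<in> simplices (Fun K X Y) m"
        using is_sset_act_in[OF sset_Fun[OF o(1) Yo] a vn] .
      show "post K X Y A y1 m (v m (act walking_iso n a s)) = post K X Y A y1 m (act (Fun K X Y) n a (v n s))"
        using vs[OF as] vs[OF s] smap_act[OF \<beta>(1) a s] smap_act[OF smap_post[OF o(1) Yo o(2) y(1)] a vn]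
        by simp
      show "post K X Y A y0 m (v m (act walking_iso n a s)) = post K X Y A y0 m (act (Fun K X Y) n a (v n s))"
        using vs[OF as] vs[OF s] act_dgn[OF o x a] smap_act[OF smap_post[OF o(1) Yo o(2) y(2)] a vn]
        by simp
    qed
  qed
  note v0 = vs[of "[0]" 0, OF v(1)] and v1 = vs[of "[1]" 0, OF v(2)]
  note ass = ecomp_assoc[OF o(1) P Yo o(2) _ p(1)]
  \<comment> \<open>The lift can start at q because \<alpha> ends at y, where \<beta> begins: both
    functors have components y and x.\<close>
  have "comp0 K X P Y p q = v 0 [0]"
  proof (rule product_eq0I[OF Y o(1) ecomp_in[OF o(1) P Yo p(1) q]])
    show "v 0 [0] \<in> functors K X Y" using v0 by blast
    show "comp0 K X Y A y1 (comp0 K X P Y p q) = comp0 K X Y A y1 (v 0 [0])"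
      using ass[OF q y(1)] p tq[OF v(2)] \<alpha> \<beta> v0 post_0[OF Yo o(2) y(1)] by simp
    show "comp0 K X Y A y0 (comp0 K X P Y p q) = comp0 K X Y A y0 (v 0 [0])"
      using ass[OF q y(2)] p tq[OF v(1)] \<alpha> \<beta> v0 post_0[OF Yo o(2) y(2)] dgn_0[OF o x] by simp
  qed
  then obtain q' where q': "ipath (Fun K X P) q q'" "comp0 K X P Y p q' = v 0 [1]"
    using isofib_lift_path[OF o(1) P Yo pi vm q] by blast
  have q'in: "q' \<in> functors K X P" using ipath_in[OF q'(1)] by simp
  have "comp0 K X P A (t 0 [1]) q' = z"
    using ass[OF q'in y(1)] p q'(2) v1 \<beta> post_0[OF Yo o(2) y(1)] by simp
  moreover have "comp0 K X P A (t 0 [0]) q' = x"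
    using ass[OF q'in y(2)] p q'(2) v1 post_0[OF Yo o(2) y(2)] dgn_0[OF o x] by simp
  \<comment> \<open>The universal path over P joins the evaluations at 0 and 1; pulled back along q'
    it runs from x to z.\<close>
  moreover have "ipath (Fun K P A) (t 0 [0]) (t 0 [1])" using t unfolding ipath_def by blast
  ultimately show ?thesis using ipath_comp_right[OF o(1) P o(2) q'in] by metis
qed

subsection \<open>Equivalences\<close>

lemma ihomotopy_cong:
  assumes "ihomotopy X Y f g" "\<And>n x. x \<in> simplices X n \<Longrightarrow> f n x = f' n x"
    "\<And>n x. x \<in> simplices X n \<Longrightarrow> g n x = g' n x"
  shows "ihomotopy X Y f' g'"
  using assms unfolding ihomotopy_def by auto

text \<open>In the forward direction it is enough to test on A and B. The inverse of
  \<open>post K B A B f\<close>, applied to the identity, is a g with a path from fg to the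
  identity; the other path exists because \<open>post K A A B f\<close> reflects paths, through its
  inverse r. Conversely, paths induce homotopies for all X at once.\<close>

lemma is_equivalence_iff:
  assumes o: "A \<in> obj K" "B \<in> obj K" and f: "f \<in> functors K A B"
  shows "is_equivalence K A B f \<longleftrightarrow> (\<exists>g\<in>functors K B A.
    ipath (Fun K A A) (ident K A) (comp0 K A B A g f) \<and> ipath (Fun K B B) (comp0 K B A B f g) (ident K B))"
proof
  assume E: "is_equivalence K A B f"
  have EA: "qc_equivalence (Fun K A A) (Fun K A B) (post K A A B f)"
    and EB: "qc_equivalence (Fun K B A) (Fun K B B) (post K B A B f)"
    using E o unfolding is_equivalence_def by auto
  obtain r where r: "smap (Fun K A B) (Fun K A A) r"
    and hr: "ihomotopy (Fun K A A) (Fun K A A) (\<lambda>n x. x) (\<lambda>n x. r n (post K A A B f n x))"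
    using EA unfolding qc_equivalence_iff by blast
  obtain s where s: "smap (Fun K B B) (Fun K B A) s"
    and hs: "ihomotopy (Fun K B B) (Fun K B B) (\<lambda>n y. post K B A B f n (s n y)) (\<lambda>n y. y)"
    using EB unfolding qc_equivalence_iff by blast
  note iA = ident_in[OF o(1)] and iB = ident_in[OF o(2)]
  define g where "g = s 0 (ident K B)"
  have g: "g \<in> functors K B A" unfolding g_def using smap_in[OF s iB] .
  have gf: "comp0 K A B A g f \<in> functors K A A" using ecomp_in[OF o o(1) g f] .
  have fg: "ipath (Fun K B B) (comp0 K B A B f g) (ident K B)"
    using ihomotopy_ipath[OF hs iB] unfolding g_def[symmetric] by (simp add: post_0[OF o f])
  \<comment> \<open>For every x there is a path from x to r(fx). Taking x to be the identity and gf,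
    and using fgf ~ f, gives the chain id ~ r(f) ~ r(fgf) ~ gf.\<close>
  have 1: "ipath (Fun K A A) (ident K A) (r 0 f)"
    using ihomotopy_ipath[OF hr iA] by (simp add: post_0[OF o f] comp0_ident[OF o f])
  have 2: "ipath (Fun K A A) (comp0 K A B A g f) (r 0 (comp0 K A B B (comp0 K B A B f g) f))"
    using ihomotopy_ipath[OF hr gf] ecomp_assoc[OF o o(1,2) f g f] by (simp add: post_0[OF o f])
  have "ipath (Fun K A B) (comp0 K A B B (comp0 K B A B f g) f) f"
    using ipath_comp_right[OF o o(2) f fg] comp0_ident[OF o f] by simp
  then have 3: "ipath (Fun K A A) (r 0 (comp0 K A B B (comp0 K B A B f g) f)) (r 0 f)"
    by (rule ipath_smap[OF _ r])
  note tr = ipath_trans[OF o(1,1)]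
  show "\<exists>g\<in>functors K B A. ipath (Fun K A A) (ident K A) (comp0 K A B A g f) \<and>
    ipath (Fun K B B) (comp0 K B A B f g) (ident K B)"
    using g fg tr[OF 1 tr[OF ipath_sym[OF 3] ipath_sym[OF 2]]] by blast
next
  assume "\<exists>g\<in>functors K B A. ipath (Fun K A A) (ident K A) (comp0 K A B A g f) \<and>
    ipath (Fun K B B) (comp0 K B A B f g) (ident K B)"
  then obtain g where g: "g \<in> functors K B A" and p: "ipath (Fun K A A) (ident K A) (comp0 K A B A g f)"
    "ipath (Fun K B B) (comp0 K B A B f g) (ident K B)" by blast
  show "is_equivalence K A B f"
    unfolding is_equivalence_def
  proof (intro conjI ballI f)
    fix X assume X: "X \<in> obj K"
    have "ihomotopy (Fun K X A) (Fun K X A) (\<lambda>n x. x) (\<lambda>n x. post K X B A g n (post K X A B f n x))"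
      by (rule ihomotopy_cong[OF ihomotopy_post[OF X o(1,1) p(1)]])
        (simp_all add: post_ident X o post_comp[OF X o o(1) f g])
    moreover have "ihomotopy (Fun K X B) (Fun K X B) (\<lambda>n x. post K X A B f n (post K X B A g n x)) (\<lambda>n x. x)"
      by (rule ihomotopy_cong[OF ihomotopy_post[OF X o(2,2) p(2)]])
        (simp_all add: post_ident X o post_comp[OF X o(2,1,2) g f])
    ultimately show "qc_equivalence (Fun K X A) (Fun K X B) (post K X A B f)"
      unfolding qc_equivalence_iff
      using quasi[OF X o(1)] quasi[OF X o(2)] smap_post[OF X o f] smap_post[OF X o(2,1) g] by blast
  qed
qed

text \<open>The inverse g of f is also one of f': composing the given path with g changes the two
  required paths by concatenation.\<close>

lemma is_equivalence_ipath:
  assumes o: "A \<in> obj K" "B \<in> obj K" and p: "ipath (Fun K A B) f f'" and E: "is_equivalence K A B f"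
  shows "is_equivalence K A B f'"
proof -
  have f: "f \<in> functors K A B" "f' \<in> functors K A B" using ipath_in[OF p] by auto
  obtain g where g: "g \<in> functors K B A" "ipath (Fun K A A) (ident K A) (comp0 K A B A g f)"
    "ipath (Fun K B B) (comp0 K B A B f g) (ident K B)"
    using E unfolding is_equivalence_iff[OF o f(1)] by blast
  have "ipath (Fun K A A) (ident K A) (comp0 K A B A g f')"
    using ipath_trans[OF o(1,1) g(2) ipath_comp_left[OF o o(1) g(1) p]] .
  moreover have "ipath (Fun K B B) (comp0 K B A B f' g) (ident K B)"
    using ipath_trans[OF o(2,2) ipath_sym[OF ipath_comp_right[OF o(2,1,2) g(1) p]] g(3)] .
  ultimately show ?thesis unfolding is_equivalence_iff[OF o f(2)] using g(1) by blast
qed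

text \<open>The inverse is gl. Whiskering the path between the identity of B and lk, respectively
  fg, cancels the inner pair, and concatenation cancels the outer one.\<close>

lemma is_equivalence_comp:
  assumes o: "A \<in> obj K" "B \<in> obj K" "C \<in> obj K"
    and E: "is_equivalence K A B f" and E': "is_equivalence K B C k"
  shows "is_equivalence K A C (comp0 K A B C k f)"
proof -
  have f: "f \<in> functors K A B" and k: "k \<in> functors K B C" using E E' by (simp_all add: is_equivalence_def)
  obtain g where g: "g \<in> functors K B A" "ipath (Fun K A A) (ident K A) (comp0 K A B A g f)"
    "ipath (Fun K B B) (comp0 K B A B f g) (ident K B)"
    using E unfolding is_equivalence_iff[OF o(1,2) f] by blast
  obtain l where l: "l \<in> functors K C B" "ipath (Fun K B B) (ident K B) (comp0 K B C B l k)"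
    "ipath (Fun K C C) (comp0 K C B C k l) (ident K C)"
    using E' unfolding is_equivalence_iff[OF o(2,3) k] by blast
  have kf: "comp0 K A B C k f \<in> functors K A C" using ecomp_in[OF o k f] .
  have gl: "comp0 K C B A g l \<in> functors K C A" using ecomp_in[OF o(3,2,1) g(1) l(1)] .
  have "comp0 K A C A (comp0 K C B A g l) (comp0 K A B C k f)
      = comp0 K A B A g (comp0 K A B B (comp0 K B C B l k) f)"
    using ecomp_assoc[OF o(1,3,2,1) kf l(1) g(1)] ecomp_assoc[OF o o(2) f k l(1)] by simp
  moreover have "ipath (Fun K A A) (comp0 K A B A g (comp0 K A B B (ident K B) f)) \<dots>"
    using ipath_comp_left[OF o(1,2,1) g(1) ipath_comp_right[OF o(1,2,2) f l(2)]] .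
  ultimately have 1: "ipath (Fun K A A) (ident K A) (comp0 K A C A (comp0 K C B A g l) (comp0 K A B C k f))"
    using ipath_trans[OF o(1,1) g(2)] comp0_ident[OF o(1,2) f] by simp
  have "comp0 K C A C (comp0 K A B C k f) (comp0 K C B A g l)
      = comp0 K C B C k (comp0 K C B B (comp0 K B A B f g) l)"
    using ecomp_assoc[OF o(3,1,2,3) gl f k] ecomp_assoc[OF o(3,2,1,2) l(1) g(1) f] by simp
  moreover have "ipath (Fun K C C) \<dots> (comp0 K C B C k (comp0 K C B B (ident K B) l))"
    using ipath_comp_left[OF o(3,2,3) k ipath_comp_right[OF o(3,2,2) l(1) g(3)]] .
  ultimately have 2: "ipath (Fun K C C) (comp0 K C A C (comp0 K A B C k f) (comp0 K C B A g l)) (ident K C)"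
    using ipath_trans[OF o(3,3) _ l(3)] comp0_ident[OF o(3,2) l(1)] by simp
  show ?thesis unfolding is_equivalence_iff[OF o(1,3) kf] using gl 1 2 by blast
qed

lemma is_iso_equivalence:
  assumes o: "A \<in> obj K" "B \<in> obj K" and f: "is_iso K A B f"
  shows "is_equivalence K A B f"
proof -
  obtain g where g: "f \<in> functors K A B" "g \<in> functors K B A" "comp0 K A B A g f = ident K A"
    "comp0 K B A B f g = ident K B"
    using f unfolding is_iso_def by blast
  show ?thesis unfolding is_equivalence_iff[OF o g(1)]
    using g ipath_refl[OF sset_Fun ident_in] o by (intro bexI[of _ g]) auto
qed

lemma is_equivalence_two_cat_equivalent:
  assumes o: "A \<in> obj K" "B \<in> obj K" and E: "is_equivalence K A B f"
  shows "two_cat_equivalent (homotopy_2_category K) A B"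
proof -
  have f: "f \<in> functors K A B" using E by (simp add: is_equivalence_def)
  obtain g where g: "g \<in> functors K B A" "ipath (Fun K A A) (ident K A) (comp0 K A B A g f)"
    "ipath (Fun K B B) (comp0 K B A B f g) (ident K B)"
    using E unfolding is_equivalence_iff[OF o f] by blast
  show ?thesis
    unfolding two_cat_equivalent_def h2c_simps
    using f g(1) ipath_cat_iso[OF quasi[OF o(1,1)] g(2)] ipath_cat_iso[OF quasi[OF o(2,2)] g(3)]
    by (auto simp: ho_def)
qed

text \<open>An equivalence is defined by testing in the first variable of \<open>Fun\<close>. The
  characterization by an inverse and two paths is symmetric under reversal of composition, so it
  also controls the functors out of X and Y.\<close>

lemma qc_equivalence_pre:
  assumes o: "X \<in> obj K" "Y \<in> obj K" "A \<in> obj K" and E: "is_equivalence K X Y f"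
  shows "qc_equivalence (Fun K Y A) (Fun K X A) (pre X Y A f)"
proof -
  have f: "f \<in> functors K X Y" using E by (simp add: is_equivalence_def)
  obtain g where g: "g \<in> functors K Y X" "ipath (Fun K X X) (ident K X) (comp0 K X Y X g f)"
    "ipath (Fun K Y Y) (comp0 K Y X Y f g) (ident K Y)"
    using E unfolding is_equivalence_iff[OF o(1,2) f] by blast
  have pid: "pre Z Z A (ident K Z) n x = x" if "Z \<in> obj K" "x \<in> simplices (Fun K Z A) n" for Z n x
    unfolding pre_def using ecomp_dgn_ident(1)[OF that(1) o(3) that(2)] .
  have "ihomotopy (Fun K Y A) (Fun K Y A) (\<lambda>n x. x) (\<lambda>n x. pre Y X A g n (pre X Y A f n x))"
    by (rule ihomotopy_cong[OF ihomotopy_pre[OF o(2,2,3) ipath_sym[OF g(3)]]])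
      (simp_all add: pid o pre_comp[OF o(2,1,2,3) g(1) f])
  moreover have "ihomotopy (Fun K X A) (Fun K X A) (\<lambda>n x. pre X Y A f n (pre Y X A g n x)) (\<lambda>n x. x)"
    by (rule ihomotopy_cong[OF ihomotopy_pre[OF o(1,1,3) ipath_sym[OF g(2)]]])
      (simp_all add: pid o pre_comp[OF o(1,2,1,3) f g(1)])
  ultimately show ?thesis
    unfolding qc_equivalence_iff
    using quasi[OF o(1,3)] quasi[OF o(2,3)] smap_pre[OF o f] smap_pre[OF o(2,1,3) g(1)] by blast
qed

end

section \<open>Comma objects\<close>

context qc_enriched
begin

lemma product_arrow_iso:
  assumes P: "is_product K A B P a b" and P': "is_product K A B P' a' b'"
    and j: "j \<in> functors K P P'" "comp0 K P P' A a' j = a" "comp0 K P P' B b' j = b"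
  obtains j' where "j' \<in> functors K P' P" "comp0 K P P' P j' j = ident K P" "comp0 K P' P P' j j' = ident K P'"
proof -
  have o: "A \<in> obj K" "B \<in> obj K" "P \<in> obj K" "P' \<in> obj K" and a: "a \<in> functors K P A" "b \<in> functors K P B"
    and a': "a' \<in> functors K P' A" "b' \<in> functors K P' B"
    using P P' by (simp_all add: is_product_def)
  obtain j' where j': "j' \<in> functors K P' P" "comp0 K P' P A a j' = a'" "comp0 K P' P B b j' = b'"
    using product_pair0[OF P o(4) a'] by blast
  have "comp0 K P P' P j' j = ident K P"
    by (rule product_eq0I[OF P o(3) ecomp_in[OF o(3,4,3) j'(1) j(1)] ident_in[OF o(3)]])
      (simp_all add: comp0_ident o a ecomp_assoc[OF o(3,4,3,1) j(1) j'(1) a(1)]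
        ecomp_assoc[OF o(3,4,3,2) j(1) j'(1) a(2)] j j')
  moreover have "comp0 K P' P P' j j' = ident K P'"
    by (rule product_eq0I[OF P' o(4) ecomp_in[OF o(4,3,4) j(1) j'(1)] ident_in[OF o(4)]])
      (simp_all add: comp0_ident o a' ecomp_assoc[OF o(4,3,4,1) j'(1) j(1) a'(1)]
        ecomp_assoc[OF o(4,3,4,2) j'(1) j(1) a'(2)] j j')
  ultimately show thesis using that j'(1) by blast
qed

text \<open>Compatibility with the structure maps is recorded on vertices, because a comma refers to
  its cotensor through the evaluations at the two vertices of \<open>std_simplex 1\<close>.\<close>

lemma cotensor_unique:
  assumes C: "is_cotensor K U A P t" and C': "is_cotensor K U A P' t'" and U: "is_sset U"
  obtains k k' where "k \<in> functors K P P'" "k' \<in> functors K P' P"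
    "comp0 K P P' P k' k = ident K P" "comp0 K P' P P' k k' = ident K P'"
    "\<And>u. u \<in> simplices U 0 \<Longrightarrow> comp0 K P P' A (t' 0 u) k = t 0 u"
    "\<And>u. u \<in> simplices U 0 \<Longrightarrow> comp0 K P' P A (t 0 u) k' = t' 0 u"
proof -
  have o: "A \<in> obj K" "P \<in> obj K" "P' \<in> obj K" and t: "smap U (Fun K P A) t" and t': "smap U (Fun K P' A) t'"
    using C C' by (simp_all add: is_cotensor_def)
  obtain k where k: "k \<in> functors K P P'"
    "\<And>n u. u \<in> simplices U n \<Longrightarrow> ecomp K P P' A n (t' n u) (dgn K P P' n k) = t n u"
    using cotensor_factor[OF C' U o(2) t] by blast
  obtain k' where k': "k' \<in> functors K P' P"
    "\<And>n u. u \<in> simplices U n \<Longrightarrow> ecomp K P' P A n (t n u) (dgn K P' P n k') = t' n u"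
    using cotensor_factor[OF C U o(3) t'] by blast
  have "comp0 K P P' P k' k = ident K P"
  proof (rule cotensor_eqI[OF C o(2) ecomp_in[OF o(2,3,2) k'(1) k(1)] ident_in[OF o(2)]])
    fix n u assume u: "u \<in> simplices U n"
    note tu = smap_in[OF t u]
    show "ecomp K P P A n (t n u) (dgn K P P n (comp0 K P P' P k' k)) =
      ecomp K P P A n (t n u) (dgn K P P n (ident K P))"
      using dgn_comp0[OF o(2,3,2) k'(1) k(1)] ecomp_dgn_ident(1)[OF o(2,1) tu] k(2)[OF u] k'(2)[OF u]
        ecomp_assoc[OF o(2,3,2,1) dgn_in[OF o(2,3) k(1)] dgn_in[OF o(3,2) k'(1)] tu] by simp
  qed
  moreover have "comp0 K P' P P' k k' = ident K P'"
  proof (rule cotensor_eqI[OF C' o(3) ecomp_in[OF o(3,2,3) k(1) k'(1)] ident_in[OF o(3)]])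
    fix n u assume u: "u \<in> simplices U n"
    note tu = smap_in[OF t' u]
    show "ecomp K P' P' A n (t' n u) (dgn K P' P' n (comp0 K P' P P' k k')) =
      ecomp K P' P' A n (t' n u) (dgn K P' P' n (ident K P'))"
      using dgn_comp0[OF o(3,2,3) k(1) k'(1)] ecomp_dgn_ident(1)[OF o(3,1) tu] k(2)[OF u] k'(2)[OF u]
        ecomp_assoc[OF o(3,2,3,1) dgn_in[OF o(3,2) k'(1)] dgn_in[OF o(2,3) k(1)] tu] by simp
  qed
  moreover have "comp0 K P P' A (t' 0 u) k = t 0 u" "comp0 K P' P A (t 0 u) k' = t' 0 u"
    if "u \<in> simplices U 0" for u
    using k(2)[OF that] k'(2)[OF that] dgn_0[OF o(2,3) k(1)] dgn_0[OF o(3,2) k'(1)] by simp_all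
  ultimately show thesis using that k(1) k'(1) by blast
qed

text \<open>Functors into a product are determined by their components. Hence the comparison i of
  the two copies of A \<times> A turns p and h into p' and h' (along k and the identity of Z), and d
  with kq is a cone over the second pullback. Only one direction of k is assumed, so that the lemma
  can be used both ways.\<close>

lemma comma_arrow:
  assumes o: "A \<in> obj K" "Z \<in> obj K" "A2 \<in> obj K" "A2' \<in> obj K"
    and Y: "is_product K A A Y y1 y0" and Y': "is_product K A A Y' y1' y0'"
    and k: "k \<in> functors K A2 A2'" "comp0 K A2 A2' A s1' k = s1" "comp0 K A2 A2' A s0' k = s0"
    and p: "p \<in> functors K A2 Y" "comp0 K A2 Y A y1 p = s1" "comp0 K A2 Y A y0 p = s0"
    and p': "p' \<in> functors K A2' Y'" "comp0 K A2' Y' A y1' p' = s1'" "comp0 K A2' Y' A y0' p' = s0'"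
    and h: "h \<in> functors K Z Y" "comp0 K Z Y A y1 h = m" "comp0 K Z Y A y0 h = l"
    and h': "h' \<in> functors K Z Y'" "comp0 K Z Y' A y1' h' = m" "comp0 K Z Y' A y0' h' = l"
    and D: "is_pullback K Z A2 Y h p D d q" and D': "is_pullback K Z A2' Y' h' p' D' d' q'"
  obtains w where "w \<in> functors K D D'" "comp0 K D D' Z d' w = d" "comp0 K D D' A2' q' w = comp0 K D A2 A2' k q"
proof -
  have oy: "Y \<in> obj K" "Y' \<in> obj K" and y: "y1 \<in> functors K Y A" "y0 \<in> functors K Y A"
    and y': "y1' \<in> functors K Y' A" "y0' \<in> functors K Y' A"
    using Y Y' by (simp_all add: is_product_def)
  have od: "D \<in> obj K" and d: "d \<in> functors K D Z" and q: "q \<in> functors K D A2"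
    and dq: "comp0 K D Z Y h d = comp0 K D A2 Y p q"
    using D by (simp_all add: is_pullback_def)
  obtain i where i: "i \<in> functors K Y Y'" "comp0 K Y Y' A y1' i = y1" "comp0 K Y Y' A y0' i = y0"
    using product_pair0[OF Y' oy(1) y] by blast
  have pk: "comp0 K A2 A2' Y' p' k = comp0 K A2 Y Y' i p"
    by (rule product_eq0I[OF Y' o(3) ecomp_in[OF o(3,4) oy(2) p'(1) k(1)] ecomp_in[OF o(3) oy i(1) p(1)]])
      (simp_all add: ecomp_assoc[OF o(3,4) oy(2) o(1) k(1) p'(1) y'(1)]
        ecomp_assoc[OF o(3,4) oy(2) o(1) k(1) p'(1) y'(2)] ecomp_assoc[OF o(3) oy o(1) p(1) i(1) y'(1)]
        ecomp_assoc[OF o(3) oy o(1) p(1) i(1) y'(2)] i p p' k)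
  have hi: "h' = comp0 K Z Y Y' i h"
    by (rule product_eq0I[OF Y' o(2) h'(1) ecomp_in[OF o(2) oy i(1) h(1)]])
      (simp_all add: ecomp_assoc[OF o(2) oy o(1) h(1) i(1) y'(1)]
        ecomp_assoc[OF o(2) oy o(1) h(1) i(1) y'(2)] i h h')
  have kq: "comp0 K D A2 A2' k q \<in> functors K D A2'" using ecomp_in[OF od o(3,4) k(1) q] .
  have "comp0 K D Z Y' h' d = comp0 K D A2' Y' p' (comp0 K D A2 A2' k q)"
    using ecomp_assoc[OF od o(2) oy d h(1) i(1)] ecomp_assoc[OF od o(3) oy q p(1) i(1)]
      ecomp_assoc[OF od o(3,4) oy(2) q k(1) p'(1)] dq pk hi by simp
  then show thesis using pullback_pair0[OF D' od d kq] that by blast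
qed

text \<open>\<open>comma_arrow\<close> for the two mutually inverse comparisons of cotensors gives w
  and w'; their composites are identities because they are so on both legs of a pullback.\<close>

lemma comma_unique:
  assumes D: "is_comma K A B C f g Z c b D d" and D': "is_comma K A B C f g Z c b D' d'"
  shows "isomorphic_over K Z D d D' d'"
proof -
  obtain Y y1 y0 A2 t p h q where
    Y: "is_product K A A Y y1 y0" and A2: "is_cotensor K (std_simplex 1) A A2 t" and
    p: "p \<in> functors K A2 Y" "comp0 K A2 Y A y1 p = t 0 [1]" "comp0 K A2 Y A y0 p = t 0 [0]" and
    h: "h \<in> functors K Z Y" "comp0 K Z Y A y1 h = comp0 K Z C A g c" "comp0 K Z Y A y0 h = comp0 K Z B A f b" and
    P: "is_pullback K Z A2 Y h p D d q"
    using D unfolding is_comma_def by blast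
  obtain Y' y1' y0' A2' t' p' h' q' where
    Y': "is_product K A A Y' y1' y0'" and A2': "is_cotensor K (std_simplex 1) A A2' t'" and
    p': "p' \<in> functors K A2' Y'" "comp0 K A2' Y' A y1' p' = t' 0 [1]" "comp0 K A2' Y' A y0' p' = t' 0 [0]" and
    h': "h' \<in> functors K Z Y'" "comp0 K Z Y' A y1' h' = comp0 K Z C A g c" "comp0 K Z Y' A y0' h' = comp0 K Z B A f b" and
    P': "is_pullback K Z A2' Y' h' p' D' d' q'"
    using D' unfolding is_comma_def by blast
  have o: "A \<in> obj K" "Z \<in> obj K"
    using D Y by (simp_all add: is_comma_def is_product_def)
  have oa: "A2 \<in> obj K" "A2' \<in> obj K" using A2 A2' by (simp_all add: is_cotensor_def)
  have od: "D \<in> obj K" "D' \<in> obj K" and d: "d \<in> functors K D Z" "d' \<in> functors K D' Z"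
    and q: "q \<in> functors K D A2" "q' \<in> functors K D' A2'"
    using P P' by (simp_all add: is_pullback_def)
  have v: "[0] \<in> simplices (std_simplex 1) 0" "[1] \<in> simplices (std_simplex 1) 0"
    by (simp_all add: std_simplex_def ops_def)
  obtain k k' where k: "k \<in> functors K A2 A2'" "k' \<in> functors K A2' A2"
    "comp0 K A2 A2' A2 k' k = ident K A2" "comp0 K A2' A2 A2' k k' = ident K A2'"
    "\<And>u. u \<in> simplices (std_simplex 1) 0 \<Longrightarrow> comp0 K A2 A2' A (t' 0 u) k = t 0 u"
    "\<And>u. u \<in> simplices (std_simplex 1) 0 \<Longrightarrow> comp0 K A2' A2 A (t 0 u) k' = t' 0 u"
    using cotensor_unique[OF A2 A2' is_sset_std_simplex] by blast
  obtain w where w: "w \<in> functors K D D'" "comp0 K D D' Z d' w = d" "comp0 K D D' A2' q' w = comp0 K D A2 A2' k q"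
    using comma_arrow[OF o oa Y Y' k(1) k(5)[OF v(2)] k(5)[OF v(1)] p p' h h' P P'] by blast
  obtain w' where w': "w' \<in> functors K D' D" "comp0 K D' D Z d w' = d'" "comp0 K D' D A2 q w' = comp0 K D' A2' A2 k' q'"
    using comma_arrow[OF o oa(2,1) Y' Y k(2) k(6)[OF v(2)] k(6)[OF v(1)] p' p h' h P' P] by blast
  have "comp0 K D D' D w' w = ident K D"
    by (rule pullback_eq0I[OF P od(1) ecomp_in[OF od(1,2,1) w'(1) w(1)] ident_in[OF od(1)]])
      (simp_all add: ecomp_assoc[OF od(1,2,1) o(2) w(1) w'(1) d(1)] ecomp_assoc[OF od(1,2,1) oa(1) w(1) w'(1) q(1)]
        comp0_ident od o oa d q w w' ecomp_assoc[OF od(1,2) oa(2,1) w(1) q(2) k(2), symmetric]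
        ecomp_assoc[OF od(1) oa oa(1) q(1) k(1,2)] k)
  moreover have "comp0 K D' D D' w w' = ident K D'"
    by (rule pullback_eq0I[OF P' od(2) ecomp_in[OF od(2,1,2) w(1) w'(1)] ident_in[OF od(2)]])
      (simp_all add: ecomp_assoc[OF od(2,1,2) o(2) w'(1) w(1) d(2)] ecomp_assoc[OF od(2,1,2) oa(2) w'(1) w(1) q(2)]
        comp0_ident od o oa d q w w' ecomp_assoc[OF od(2,1) oa(1,2) w'(1) q(1) k(1), symmetric]
        ecomp_assoc[OF od(2) oa(2,1,2) q(2) k(2,1)] k)
  ultimately show ?thesis
    unfolding isomorphic_over_def is_iso_def using w w'(1) by blast
qed

text \<open>F of a comma lies over FZ, while the comma in the target cosmos is to lie over another
  product W. This lemma exchanges the base along the isomorphism between them.\<close>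

lemma pullback_iso_base:
  assumes P: "is_pullback K A E B f p P a e" and A': "A' \<in> obj K"
    and j: "j \<in> functors K A A'" "j' \<in> functors K A' A" "comp0 K A A' A j' j = ident K A"
      "comp0 K A' A A' j j' = ident K A'"
  shows "is_pullback K A' E B (comp0 K A' A B f j') p P (comp0 K P A A' j a) e"
proof -
  have o: "A \<in> obj K" "E \<in> obj K" "B \<in> obj K" "P \<in> obj K" and f: "f \<in> functors K A B"
    and p: "p \<in> functors K E B" and a: "a \<in> functors K P A" and e: "e \<in> functors K P E"
    and com: "comp0 K P A B f a = comp0 K P E B p e"
    using P by (simp_all add: is_pullback_def)
  have fj: "comp0 K A' A B f j' \<in> functors K A' B" using ecomp_in[OF A' o(1,3) f j(2)] .
  have ja: "comp0 K P A A' j a \<in> functors K P A'" using ecomp_in[OF o(4,1) A' j(1) a] .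
  have com': "comp0 K P A' B (comp0 K A' A B f j') (comp0 K P A A' j a) = comp0 K P E B p e"
    using ecomp_assoc[OF o(4) A' o(1,3) ja j(2) f] ecomp_assoc[OF o(4,1) A' o(1) a j(1,2)]
      comp0_ident[OF o(4,1) a] j com by simp
  have "bij_betw (\<lambda>z. (post K X P A' (comp0 K P A A' j a) n z, post K X P E e n z)) (simplices (Fun K X P) n)
    {(x, y). x \<in> simplices (Fun K X A') n \<and> y \<in> simplices (Fun K X E) n \<and>
      post K X A' B (comp0 K A' A B f j') n x = post K X E B p n y}" (is "bij_betw ?G _ ?S'")
    if X: "X \<in> obj K" for X n
  proof -
    let ?S = "{(x, y). x \<in> simplices (Fun K X A) n \<and> y \<in> simplices (Fun K X E) n \<and>
      post K X A B f n x = post K X E B p n y}"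
    have jj: "post K X A' A j' n (post K X A A' j n x) = x" if "x \<in> simplices (Fun K X A) n" for x
      using post_comp[OF X o(1) A' o(1) j(1,2) that] post_ident[OF X o(1) that] j(3) by simp
    have jj': "post K X A A' j n (post K X A' A j' n x) = x" if "x \<in> simplices (Fun K X A') n" for x
      using post_comp[OF X A' o(1) A' j(2,1) that] post_ident[OF X A' that] j(4) by simp
    have jin: "post K X A A' j n x \<in> simplices (Fun K X A') n" if "x \<in> simplices (Fun K X A) n" for x
      using smap_in[OF smap_post[OF X o(1) A' j(1)] that] .
    have jin': "post K X A' A j' n x \<in> simplices (Fun K X A) n" if "x \<in> simplices (Fun K X A') n" for x
      using smap_in[OF smap_post[OF X A' o(1) j(2)] that] .
    have fjx: "post K X A' B (comp0 K A' A B f j') n x = post K X A B f n (post K X A' A j' n x)"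
      if "x \<in> simplices (Fun K X A') n" for x
      using post_comp[OF X A' o(1,3) j(2) f that] .
    have b: "bij_betw (\<lambda>(x, y). (post K X A A' j n x, y)) ?S ?S'"
      by (rule bij_betw_byWitness[where f' = "\<lambda>(x, y). (post K X A' A j' n x, y)"])
        (auto simp: jj jj' jin jin' fjx)
    have "bij_betw (\<lambda>z. (post K X P A a n z, post K X P E e n z)) (simplices (Fun K X P) n) ?S"
      using P X unfolding is_pullback_def by blast
    from bij_betw_trans[OF this b]
    have bj: "bij_betw (\<lambda>z. (post K X A A' j n (post K X P A a n z), post K X P E e n z)) (simplices (Fun K X P) n) ?S'"
      by (simp add: comp_def)
    have eq: "(post K X A A' j n (post K X P A a n z), post K X P E e n z) = ?G z"
      if "z \<in> simplices (Fun K X P) n" for z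
      using post_comp[OF X o(4,1) A' a j(1) that] by simp
    show ?thesis by (rule iffD1[OF bij_betw_cong[OF eq] bj])
  qed
  then show ?thesis
    unfolding is_pullback_def using A' o fj p ja e com' by blast
qed

end

lemma (in cosmos) comma_leg_isofib:
  assumes "is_product K A A Y y1 y0" "is_cotensor K (std_simplex 1) A A2 t"
    "p \<in> functors K A2 Y" "comp0 K A2 Y A y1 p = t 0 [1]" "comp0 K A2 Y A y0 p = t 0 [0]"
  shows "p \<in> isofib K A2 Y"
proof -
  have v: "[0] \<in> simplices (std_simplex 1) 0" "[1] \<in> simplices (std_simplex 1) 0"
    by (simp_all add: std_simplex_def ops_def)
  show ?thesis using endpoint_isofib_nat_list[OF is_sset_std_simplex v _ assms(2,1,3,4,5)] by simp
qed

text \<open>This is what allows a path of functors into \<open>Z\<close> to be lifted to a path of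
  functors into the comma.\<close>

lemma (in cosmos) comma_isofib:
  assumes "is_comma K A B C f g Z c b D d"
  shows "d \<in> isofib K D Z"
  using assms isofib_pullback comma_leg_isofib unfolding is_comma_def by metis

section \<open>Weak equivalences\<close>

locale cosmos_weq = K: cosmos size K + L: cosmos size L
  for size :: "'u::infinite itself" and K :: "('o, 'h) cosmos" and L :: "('p, 'l) cosmos" +
  fixes F :: "('o, 'h, 'p, 'l) cosmos_fun"
  assumes weq: "cosmos_weak_equivalence size K L F"
begin

lemma cosmos_functor: "cosmos_functor size K L F"
  using weq by (simp add: cosmos_weak_equivalence_def)

lemma simplicial_functor: "simplicial_functor K L F"
  using cosmos_functor by (simp add: cosmos_functor_def)

lemma fobj_in: "A \<in> obj K \<Longrightarrow> fobj F A \<in> obj L"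
  using simplicial_functor unfolding simplicial_functor_def by blast

lemma smap_fmap: "A \<in> obj K \<Longrightarrow> B \<in> obj K \<Longrightarrow> smap (Fun K A B) (Fun L (fobj F A) (fobj F B)) (fmap F A B)"
  using simplicial_functor unfolding simplicial_functor_def by blast

lemma fmap_in:
  "\<lbrakk>A \<in> obj K; B \<in> obj K; f \<in> simplices (Fun K A B) n\<rbrakk>
    \<Longrightarrow> fmap F A B n f \<in> simplices (Fun L (fobj F A) (fobj F B)) n"
  by (rule smap_in[OF smap_fmap])

lemma fmap_ident: "A \<in> obj K \<Longrightarrow> fmap F A A 0 (ident K A) = ident L (fobj F A)"
  using simplicial_functor unfolding simplicial_functor_def by blast

lemma fmap_comp:
  "\<lbrakk>A \<in> obj K; B \<in> obj K; C \<in> obj K; f \<in> simplices (Fun K A B) n; g \<in> simplices (Fun K B C) n\<rbrakk>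
    \<Longrightarrow> fmap F A C n (ecomp K A B C n g f) =
      ecomp L (fobj F A) (fobj F B) (fobj F C) n (fmap F B C n g) (fmap F A B n f)"
  using simplicial_functor unfolding simplicial_functor_def by blast

lemma fobj_terminal: "is_terminal K T \<Longrightarrow> is_terminal L (fobj F T)"
  using cosmos_functor unfolding cosmos_functor_def by blast

lemma fmap_cotensor:
  fixes U :: "'u sset"
  shows "\<lbrakk>is_sset U; is_cotensor K U A P t\<rbrakk>
    \<Longrightarrow> is_cotensor L U (fobj F A) (fobj F P) (\<lambda>n s. fmap F P A n (t n s))"
  using cosmos_functor unfolding cosmos_functor_def by blast

lemma fmap_pullback:
  "\<lbrakk>is_pullback K A E B f p P a e; p \<in> isofib K E B\<rbrakk>
    \<Longrightarrow> is_pullback L (fobj F A) (fobj F E) (fobj F B) (fmap F A B 0 f) (fmap F E B 0 p)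
          (fobj F P) (fmap F P A 0 a) (fmap F P E 0 e)"
  using cosmos_functor unfolding cosmos_functor_def by blast

lemma essentially_surjective: "X \<in> obj L \<Longrightarrow> \<exists>A\<in>obj K. equivalent L (fobj F A) X"
  using weq unfolding cosmos_weak_equivalence_def by blast

lemma local_equivalence:
  "\<lbrakk>A \<in> obj K; B \<in> obj K\<rbrakk> \<Longrightarrow> qc_equivalence (Fun K A B) (Fun L (fobj F A) (fobj F B)) (fmap F A B)"
  using weq unfolding cosmos_weak_equivalence_def by blast

lemma fmap_cotensor_nat_list:
  fixes V :: "nat list sset"
  assumes V: "is_sset V" and C: "is_cotensor K V A P t"
  shows "is_cotensor L V (fobj F A) (fobj F P) (\<lambda>n s. fmap F P A n (t n s))"
proof -
  obtain \<iota> :: "nat list \<Rightarrow> 'u" where i: "inj \<iota>" using ex_inj_nat_list by blast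
  have "is_cotensor K (sset_image \<iota> V) A P (\<lambda>n u. t n (inv \<iota> u))"
    using K.is_cotensor_image_iff[OF i V] C by blast
  from fmap_cotensor[OF is_sset_image[OF i V] this] show ?thesis
    using L.is_cotensor_image_iff[OF i V, where t = "\<lambda>n s. fmap F P A n (t n s)"] by simp
qed

text \<open>A product is a pullback over a terminal object along an isofibration, and F preserves
  such pullbacks and terminal objects.\<close>

lemma fmap_product:
  assumes P: "is_product K A B P a b"
  shows "is_product L (fobj F A) (fobj F B) (fobj F P) (fmap F P A 0 a) (fmap F P B 0 b)"
proof -
  have o: "A \<in> obj K" "B \<in> obj K" using P by (simp_all add: is_product_def)
  obtain T where T: "is_terminal K T" using K.terminal_exists by blast
  have To: "T \<in> obj K" using T by (simp add: is_terminal_def)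
  obtain f where f: "f \<in> functors K A T" using T o(1) by (rule K.terminal_arrow)
  obtain g where g: "g \<in> functors K B T" using T o(2) by (rule K.terminal_arrow)
  have "is_pullback K A B T f g P a b" using K.product_iff_pullback[OF T f g o] P by blast
  from fmap_pullback[OF this K.isofib_terminal[OF o(2) T g]] show ?thesis
    using L.product_iff_pullback[OF fobj_terminal[OF T] fmap_in[OF o(1) To f] fmap_in[OF o(2) To g]
        fobj_in[OF o(1)] fobj_in[OF o(2)]] by blast
qed

lemma strict_2_functor:
  "strict_2_functor (homotopy_2_category K) (homotopy_2_category L) (homotopy_2_functor L F)"
proof -
  have fs: "tfobj (homotopy_2_functor L F) = fobj F"
    "tfun1 (homotopy_2_functor L F) A B = fmap F A B 0"
    "tfun2 (homotopy_2_functor L F) A B = ho_map (Fun L (fobj F A) (fobj F B)) (fmap F A B)" for A B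
    by (simp_all add: homotopy_2_functor_def)
  note qK = K.quasi and qL = L.quasi[OF fobj_in fobj_in]
  show ?thesis
    unfolding strict_2_functor_def fs K.h2c_simps L.h2c_simps
  proof (intro conjI ballI K.strict_2_category_h2c L.strict_2_category_h2c)
    show "fobj F \<in> obj K \<rightarrow> obj L" using fobj_in by blast
    show "cat_functor (ho (Fun K A B)) (ho (Fun L (fobj F A) (fobj F B))) (fmap F A B 0)
       (ho_map (Fun L (fobj F A) (fobj F B)) (fmap F A B))" if "A \<in> obj K" "B \<in> obj K" for A B
      using cat_functor_ho[OF qK qL smap_fmap] that by blast
    show "fmap F A A 0 (ident K A) = ident L (fobj F A)" if "A \<in> obj K" for A using fmap_ident that .
    show "fmap F A C 0 (comp0 K A B C g f) =
      comp0 L (fobj F A) (fobj F B) (fobj F C) (fmap F B C 0 g) (fmap F A B 0 f)"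
      if "A \<in> obj K" "B \<in> obj K" "C \<in> obj K" "f \<in> cobj (ho (Fun K A B))" "g \<in> cobj (ho (Fun K B C))" for A B C f g
      using fmap_comp that by (simp add: ho_def)
    fix A B C f f' g g' a b assume o: "A \<in> obj K" "B \<in> obj K" "C \<in> obj K"
      and a: "a \<in> chom (ho (Fun K A B)) f f'" and b: "b \<in> chom (ho (Fun K B C)) g g'"
    obtain x where x: "x \<in> simplices (Fun K A B) 1" "a = edge_class (Fun K A B) x"
      using a by (rule K.cell2E[OF o(1,2)])
    obtain y where y: "y \<in> simplices (Fun K B C) 1" "b = edge_class (Fun K B C) y"
      using b by (rule K.cell2E[OF o(2,3)])
    note oF = fobj_in[OF o(1)] fobj_in[OF o(2)] fobj_in[OF o(3)]
    show "ho_map (Fun L (fobj F A) (fobj F C)) (fmap F A C) (tcomp2 (homotopy_2_category K) A B C b a) =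
      tcomp2 (homotopy_2_category L) (fobj F A) (fobj F B) (fobj F C)
        (ho_map (Fun L (fobj F B) (fobj F C)) (fmap F B C) b) (ho_map (Fun L (fobj F A) (fobj F B)) (fmap F A B) a)"
      unfolding x(2) y(2) K.tcomp2_class[OF o y(1) x(1)]
        ho_map_class[OF qK[OF o(1,2)] qL[OF o(1,2)] smap_fmap[OF o(1,2)] x(1)]
        ho_map_class[OF qK[OF o(2,3)] qL[OF o(2,3)] smap_fmap[OF o(2,3)] y(1)]
        ho_map_class[OF qK[OF o(1,3)] qL[OF o(1,3)] smap_fmap[OF o(1,3)] K.ecomp_in[OF o y(1) x(1)]]
        L.tcomp2_class[OF oF fmap_in[OF o(2,3) y(1)] fmap_in[OF o(1,2) x(1)]]
        fmap_comp[OF o x(1) y(1)] ..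
  qed
qed

lemma hom_cat_equivalence:
  assumes "A \<in> obj K" "B \<in> obj K"
  shows "cat_equivalence (ho (Fun K A B)) (ho (Fun L (fobj F A) (fobj F B))) (fmap F A B 0)
    (ho_map (Fun L (fobj F A) (fobj F B)) (fmap F A B))"
  using qc_equivalence_cat_equivalence[OF local_equivalence[OF assms]] .

lemma biequivalence_h2f:
  "biequivalence (homotopy_2_category K) (homotopy_2_category L) (homotopy_2_functor L F)"
  unfolding biequivalence_def K.h2c_simps L.h2c_simps
proof (intro conjI ballI strict_2_functor)
  fix X assume X: "X \<in> obj L"
  then obtain A f where "A \<in> obj K" "is_equivalence L (fobj F A) X f"
    using essentially_surjective unfolding equivalent_def by blast
  then show "\<exists>A\<in>obj K. two_cat_equivalent (homotopy_2_category L) (tfobj (homotopy_2_functor L F) A) X"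
    using L.is_equivalence_two_cat_equivalent[OF fobj_in X] by (auto simp: homotopy_2_functor_def)
qed (simp add: homotopy_2_functor_def hom_cat_equivalence)

text \<open>Test objects in the image of F are handled by the local equivalence. Any other X is
  equivalent to some FY, and precomposition with that equivalence identifies the hom-categories into
  FA up to equivalence.\<close>

lemma groupoidal_iff:
  assumes A: "A \<in> obj K"
  shows "groupoidal K A \<longleftrightarrow> groupoidal L (fobj F A)"
proof -
  have iff: "is_groupoid (ho (Fun K X A)) \<longleftrightarrow> is_groupoid (ho (Fun L (fobj F X) (fobj F A)))"
    if "X \<in> obj K" for X
    using cat_equivalence_groupoid[OF hom_cat_equivalence[OF that A]] .
  have "is_groupoid (ho (Fun L X (fobj F A)))"
    if X: "X \<in> obj L" and gr: "\<And>Y. Y \<in> obj K \<Longrightarrow> is_groupoid (ho (Fun K Y A))" for X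
  proof -
    obtain Y f where Y: "Y \<in> obj K" "is_equivalence L (fobj F Y) X f"
      using essentially_surjective[OF X] unfolding equivalent_def by blast
    from qc_equivalence_cat_equivalence[OF L.qc_equivalence_pre[OF fobj_in[OF Y(1)] X fobj_in[OF A] Y(2)]]
    show ?thesis using cat_equivalence_groupoid iff[OF Y(1)] gr[OF Y(1)] by blast
  qed
  then show ?thesis
    unfolding groupoidal_def K.h2c_simps L.h2c_simps using iff fobj_in by blast
qed

text \<open>With an inverse r of the local equivalence, f ~ r(Ff) ~ r(Fg) ~ g.\<close>

lemma ipath_fmap_iff:
  assumes o: "A \<in> obj K" "B \<in> obj K" and fg: "f \<in> functors K A B" "g \<in> functors K A B"
  shows "ipath (Fun L (fobj F A) (fobj F B)) (fmap F A B 0 f) (fmap F A B 0 g) \<longleftrightarrow> ipath (Fun K A B) f g"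
proof
  obtain r where r: "smap (Fun L (fobj F A) (fobj F B)) (Fun K A B) r"
    and h: "ihomotopy (Fun K A B) (Fun K A B) (\<lambda>n x. x) (\<lambda>n x. r n (fmap F A B n x))"
    using local_equivalence[OF o] unfolding qc_equivalence_iff by blast
  assume "ipath (Fun L (fobj F A) (fobj F B)) (fmap F A B 0 f) (fmap F A B 0 g)"
  note p = ipath_smap[OF this r]
  show "ipath (Fun K A B) f g"
    using K.ipath_trans[OF o ihomotopy_ipath[OF h fg(1)]
        K.ipath_trans[OF o p ipath_sym[OF ihomotopy_ipath[OF h fg(2)]]]] .
qed (rule ipath_smap[OF _ smap_fmap[OF o]])

text \<open>The preimage up to a path is the value at h of an inverse of the local
  equivalence.\<close>

lemma fmap_full:
  assumes o: "A \<in> obj K" "B \<in> obj K" and h: "h \<in> functors L (fobj F A) (fobj F B)"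
  obtains f where "f \<in> functors K A B" "ipath (Fun L (fobj F A) (fobj F B)) (fmap F A B 0 f) h"
proof -
  obtain r where r: "smap (Fun L (fobj F A) (fobj F B)) (Fun K A B) r"
    and k: "ihomotopy (Fun L (fobj F A) (fobj F B)) (Fun L (fobj F A) (fobj F B))
      (\<lambda>n y. fmap F A B n (r n y)) (\<lambda>n y. y)"
    using local_equivalence[OF o] unfolding qc_equivalence_iff by blast
  show thesis using that[OF smap_in[OF r h]] ihomotopy_ipath[OF k h] by blast
qed

lemma is_equivalence_fmap_iff:
  assumes o: "A \<in> obj K" "B \<in> obj K" and f: "f \<in> functors K A B"
  shows "is_equivalence K A B f \<longleftrightarrow> is_equivalence L (fobj F A) (fobj F B) (fmap F A B 0 f)"
proof -
  note oF = fobj_in[OF o(1)] fobj_in[OF o(2)] and Ff = fmap_in[OF o f]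
  have inv: "ipath (Fun K A A) (ident K A) (comp0 K A B A g f) \<and> ipath (Fun K B B) (comp0 K B A B f g) (ident K B)
    \<longleftrightarrow> ipath (Fun L (fobj F A) (fobj F A)) (ident L (fobj F A))
          (comp0 L (fobj F A) (fobj F B) (fobj F A) (fmap F B A 0 g) (fmap F A B 0 f)) \<and>
        ipath (Fun L (fobj F B) (fobj F B))
          (comp0 L (fobj F B) (fobj F A) (fobj F B) (fmap F A B 0 f) (fmap F B A 0 g)) (ident L (fobj F B))"
    if g: "g \<in> functors K B A" for g
    using ipath_fmap_iff[OF o(1,1) K.ident_in[OF o(1)] K.ecomp_in[OF o o(1) g f]]
      ipath_fmap_iff[OF o(2,2) K.ecomp_in[OF o(2) o f g] K.ident_in[OF o(2)]]
      fmap_comp[OF o o(1) f g] fmap_comp[OF o(2) o g f] fmap_ident[OF o(1)] fmap_ident[OF o(2)] by simp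
  show ?thesis
  proof
    assume "is_equivalence K A B f"
    then show "is_equivalence L (fobj F A) (fobj F B) (fmap F A B 0 f)"
      unfolding K.is_equivalence_iff[OF o f] L.is_equivalence_iff[OF oF Ff]
      using inv fmap_in[OF o(2,1)] by blast
  next
    assume "is_equivalence L (fobj F A) (fobj F B) (fmap F A B 0 f)"
    then obtain g' where g': "g' \<in> functors L (fobj F B) (fobj F A)"
      "ipath (Fun L (fobj F A) (fobj F A)) (ident L (fobj F A)) (comp0 L (fobj F A) (fobj F B) (fobj F A) g' (fmap F A B 0 f))"
      "ipath (Fun L (fobj F B) (fobj F B)) (comp0 L (fobj F B) (fobj F A) (fobj F B) (fmap F A B 0 f) g') (ident L (fobj F B))"
      unfolding L.is_equivalence_iff[OF oF Ff] by blast
    \<comment> \<open>The inverse g' of Ff need not be of the form Fg. It is joined by a path to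
      such a functor, and the two paths witnessing invertibility are adjusted by
      concatenation.\<close>
    obtain g where g: "g \<in> functors K B A" "ipath (Fun L (fobj F B) (fobj F A)) (fmap F B A 0 g) g'"
      using fmap_full[OF o(2,1) g'(1)] by blast
    have "ipath (Fun L (fobj F A) (fobj F A)) (ident L (fobj F A))
          (comp0 L (fobj F A) (fobj F B) (fobj F A) (fmap F B A 0 g) (fmap F A B 0 f))"
      using L.ipath_trans[OF oF(1,1) g'(2) ipath_sym[OF L.ipath_comp_right[OF oF oF(1) Ff g(2)]]] .
    moreover have "ipath (Fun L (fobj F B) (fobj F B))
          (comp0 L (fobj F B) (fobj F A) (fobj F B) (fmap F A B 0 f) (fmap F B A 0 g)) (ident L (fobj F B))"
      using L.ipath_trans[OF oF(2,2) L.ipath_comp_left[OF oF(2) oF Ff g(2)] g'(3)] .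
    ultimately show "is_equivalence K A B f"
      unfolding K.is_equivalence_iff[OF o f] using inv[OF g(1)] g(1) by blast
  qed
qed

lemma equivalent_fobj_iff:
  assumes o: "A \<in> obj K" "B \<in> obj K"
  shows "equivalent K A B \<longleftrightarrow> equivalent L (fobj F A) (fobj F B)"
proof
  assume "equivalent K A B"
  then obtain f where f: "is_equivalence K A B f" unfolding equivalent_def by blast
  then have "f \<in> functors K A B" by (simp add: is_equivalence_def)
  then show "equivalent L (fobj F A) (fobj F B)"
    using f is_equivalence_fmap_iff[OF o] unfolding equivalent_def by blast
next
  assume "equivalent L (fobj F A) (fobj F B)"
  then obtain h where h: "is_equivalence L (fobj F A) (fobj F B) h" unfolding equivalent_def by blast
  then have "h \<in> functors L (fobj F A) (fobj F B)" by (simp add: is_equivalence_def)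
  then obtain f where f: "f \<in> functors K A B" "ipath (Fun L (fobj F A) (fobj F B)) (fmap F A B 0 f) h"
    using fmap_full[OF o] by blast
  have "is_equivalence L (fobj F A) (fobj F B) (fmap F A B 0 f)"
    using L.is_equivalence_ipath[OF fobj_in[OF o(1)] fobj_in[OF o(2)] ipath_sym[OF f(2)] h] .
  then show "equivalent K A B"
    using f(1) is_equivalence_fmap_iff[OF o] unfolding equivalent_def by blast
qed

text \<open>The functor being pulled back is an isofibration by \<open>comma_leg_isofib\<close>, so
  F preserves the pullback that defines the comma. The base FZ is then exchanged for W along j,
  which is invertible as a comparison of products.\<close>

lemma fmap_comma:
  assumes D: "is_comma K A B C f g Z c b D d"
    and f: "f \<in> functors K B A" and g: "g \<in> functors K C A"
    and W: "is_product L (fobj F C) (fobj F B) W c' b'"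
    and j: "j \<in> functors L (fobj F Z) W" "comp0 L (fobj F Z) W (fobj F C) c' j = fmap F Z C 0 c"
      "comp0 L (fobj F Z) W (fobj F B) b' j = fmap F Z B 0 b"
  shows "is_comma L (fobj F A) (fobj F B) (fobj F C) (fmap F B A 0 f) (fmap F C A 0 g) W c' b'
    (fobj F D) (comp0 L (fobj F D) (fobj F Z) W j (fmap F D Z 0 d))"
proof -
  let ?A = "fobj F A" and ?B = "fobj F B" and ?C = "fobj F C" and ?Z = "fobj F Z"
  obtain Y y1 y0 A2 t p h q where
    Z: "is_product K C B Z c b" and
    Y: "is_product K A A Y y1 y0" and A2: "is_cotensor K (std_simplex 1) A A2 t" and
    p: "p \<in> functors K A2 Y" "comp0 K A2 Y A y1 p = t 0 [1]" "comp0 K A2 Y A y0 p = t 0 [0]" and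
    h: "h \<in> functors K Z Y" "comp0 K Z Y A y1 h = comp0 K Z C A g c" "comp0 K Z Y A y0 h = comp0 K Z B A f b" and
    P: "is_pullback K Z A2 Y h p D d q"
    using D unfolding is_comma_def by blast
  have o: "A \<in> obj K" "B \<in> obj K" "C \<in> obj K" "Z \<in> obj K" "Y \<in> obj K" "A2 \<in> obj K"
    and cb: "c \<in> functors K Z C" "b \<in> functors K Z B"
    and y: "y1 \<in> functors K Y A" "y0 \<in> functors K Y A"
    using Z Y A2 by (simp_all add: is_product_def is_cotensor_def)
  have oW: "W \<in> obj L" and cb': "c' \<in> functors L W ?C" "b' \<in> functors L W ?B"
    using W by (simp_all add: is_product_def)
  note oF = o[THEN fobj_in]
  note PF = fmap_pullback[OF P K.comma_leg_isofib[OF Y A2 p]]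
  obtain j' where j': "j' \<in> functors L W ?Z" "comp0 L ?Z W ?Z j' j = ident L ?Z" "comp0 L W ?Z W j j' = ident L W"
    using L.product_arrow_iso[OF fmap_product[OF Z] W j] by blast
  note Fc = fmap_in[OF o(4,3) cb(1)] and Fb = fmap_in[OF o(4,2) cb(2)]
  have c'j: "comp0 L W ?Z ?C (fmap F Z C 0 c) j' = c'"
    using L.ecomp_assoc[OF oW oF(4) oW oF(3) j'(1) j(1) cb'(1)] j j' L.comp0_ident[OF oW oF(3) cb'(1)] by simp
  have b'j: "comp0 L W ?Z ?B (fmap F Z B 0 b) j' = b'"
    using L.ecomp_assoc[OF oW oF(4) oW oF(2) j'(1) j(1) cb'(2)] j j' L.comp0_ident[OF oW oF(2) cb'(2)] by simp
  note Fh = fmap_in[OF o(4,5) h(1)] and Fy = fmap_in[OF o(5,1) y(1)] fmap_in[OF o(5,1) y(2)]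
    and Fg = fmap_in[OF o(3,1) g] and Ff = fmap_in[OF o(2,1) f]
  \<comment> \<open>Fh precomposed with j' has the components (Fg)c' and (Ff)b', so it is the
    product functor out of W that the comma in the target requires.\<close>
  have "comp0 L W (fobj F Y) ?A (fmap F Y A 0 y1) (comp0 L W ?Z (fobj F Y) (fmap F Z Y 0 h) j') =
    comp0 L W ?Z ?A (fmap F Z A 0 (comp0 K Z Y A y1 h)) j'"
    using L.ecomp_assoc[OF oW oF(4,5,1) j'(1) Fh Fy(1)] fmap_comp[OF o(4,5,1) h(1) y(1)] by simp
  also have "\<dots> = comp0 L W ?C ?A (fmap F C A 0 g) c'"
    using h(2) fmap_comp[OF o(4,3,1) cb(1) g] L.ecomp_assoc[OF oW oF(4,3,1) j'(1) Fc Fg] c'j by simp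
  finally have h1: "comp0 L W (fobj F Y) ?A (fmap F Y A 0 y1) (comp0 L W ?Z (fobj F Y) (fmap F Z Y 0 h) j') =
    comp0 L W ?C ?A (fmap F C A 0 g) c'" .
  have "comp0 L W (fobj F Y) ?A (fmap F Y A 0 y0) (comp0 L W ?Z (fobj F Y) (fmap F Z Y 0 h) j') =
    comp0 L W ?Z ?A (fmap F Z A 0 (comp0 K Z Y A y0 h)) j'"
    using L.ecomp_assoc[OF oW oF(4,5,1) j'(1) Fh Fy(2)] fmap_comp[OF o(4,5,1) h(1) y(2)] by simp
  also have "\<dots> = comp0 L W ?B ?A (fmap F B A 0 f) b'"
    using h(3) fmap_comp[OF o(4,2,1) cb(2) f] L.ecomp_assoc[OF oW oF(4,2,1) j'(1) Fb Ff] b'j by simp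
  finally have h0: "comp0 L W (fobj F Y) ?A (fmap F Y A 0 y0) (comp0 L W ?Z (fobj F Y) (fmap F Z Y 0 h) j') =
    comp0 L W ?B ?A (fmap F B A 0 f) b'" .
  show ?thesis
    unfolding is_comma_def
  proof (intro conjI exI)
    show "is_product L ?C ?B W c' b'" by fact
    show "is_product L ?A ?A (fobj F Y) (fmap F Y A 0 y1) (fmap F Y A 0 y0)" using fmap_product[OF Y] .
    show "is_cotensor L (std_simplex 1) ?A (fobj F A2) (\<lambda>n s. fmap F A2 A n (t n s))"
      using fmap_cotensor_nat_list[OF is_sset_std_simplex A2] .
    show "fmap F A2 Y 0 p \<in> functors L (fobj F A2) (fobj F Y)" using fmap_in[OF o(6,5) p(1)] .
    show "comp0 L (fobj F A2) (fobj F Y) ?A (fmap F Y A 0 y1) (fmap F A2 Y 0 p) = fmap F A2 A 0 (t 0 [1])"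
      "comp0 L (fobj F A2) (fobj F Y) ?A (fmap F Y A 0 y0) (fmap F A2 Y 0 p) = fmap F A2 A 0 (t 0 [0])"
      using fmap_comp[OF o(6,5,1) p(1)] y p(2,3) by metis+
    show "comp0 L W ?Z (fobj F Y) (fmap F Z Y 0 h) j' \<in> functors L W (fobj F Y)"
      using L.ecomp_in[OF oW oF(4,5) Fh j'(1)] .
    show "is_pullback L W (fobj F A2) (fobj F Y) (comp0 L W ?Z (fobj F Y) (fmap F Z Y 0 h) j') (fmap F A2 Y 0 p)
      (fobj F D) (comp0 L (fobj F D) ?Z W j (fmap F D Z 0 d)) (fmap F D A2 0 q)"
      using L.pullback_iso_base[OF PF oW j(1) j'] .
  qed (fact h1 h0)+
qed

lemma equivalent_over_fmap_iff:
  assumes o: "Z \<in> obj K" "E \<in> obj K" "D \<in> obj K" and e: "e \<in> functors K E Z" and d: "d \<in> isofib K D Z"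
  shows "equivalent_over K Z E e D d \<longleftrightarrow>
    equivalent_over L (fobj F Z) (fobj F E) (fmap F E Z 0 e) (fobj F D) (fmap F D Z 0 d)"
proof
  have df: "d \<in> functors K D Z" using K.isofib_functor[OF o(3,1) d] .
  {
    assume "equivalent_over K Z E e D d"
    then obtain w where w: "is_equivalence K E D w" "comp0 K E D Z d w = e"
      unfolding equivalent_over_def by blast
    then have wf: "w \<in> functors K E D" by (simp add: is_equivalence_def)
    show "equivalent_over L (fobj F Z) (fobj F E) (fmap F E Z 0 e) (fobj F D) (fmap F D Z 0 d)"
      unfolding equivalent_over_def
      using w is_equivalence_fmap_iff[OF o(2,3) wf] fmap_comp[OF o(2,3,1) wf df] by auto
  }
  assume "equivalent_over L (fobj F Z) (fobj F E) (fmap F E Z 0 e) (fobj F D) (fmap F D Z 0 d)"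
  then obtain v where v: "is_equivalence L (fobj F E) (fobj F D) v"
    "comp0 L (fobj F E) (fobj F D) (fobj F Z) (fmap F D Z 0 d) v = fmap F E Z 0 e"
    unfolding equivalent_over_def by blast
  note oF = o[THEN fobj_in]
  have vf: "v \<in> functors L (fobj F E) (fobj F D)" using v by (simp add: is_equivalence_def)
  obtain u where u: "u \<in> functors K E D" "ipath (Fun L (fobj F E) (fobj F D)) (fmap F E D 0 u) v"
    using fmap_full[OF o(2,3) vf] by blast
  have "ipath (Fun L (fobj F E) (fobj F Z)) (fmap F E Z 0 (comp0 K E D Z d u)) (fmap F E Z 0 e)"
    using L.ipath_comp_left[OF oF(2,3,1) fmap_in[OF o(3,1) df] u(2)] v(2) fmap_comp[OF o(2,3,1) u(1) df] by simp
  then have "ipath (Fun K E Z) (comp0 K E D Z d u) e"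
    using ipath_fmap_iff[OF o(2,1) K.ecomp_in[OF o(2,3,1) df u(1)] e] by blast
  then obtain l where l: "smap walking_iso (Fun K E Z) l" "l 0 [0] = comp0 K E D Z d u" "l 0 [1] = e"
    unfolding ipath_def by blast
  obtain w where w: "ipath (Fun K E D) u w" "comp0 K E D Z d w = e"
    using K.isofib_lift_path[OF o(2,3,1) d l(1) u(1)] l(2,3) by auto
  have wf: "w \<in> functors K E D" using ipath_in[OF w(1)] by simp
  \<comment> \<open>The lifted functor w is still an equivalence: v is joined to Fu by the choice of
    u, and Fu to Fw because F preserves the lifted path.\<close>
  have "ipath (Fun L (fobj F E) (fobj F D)) v (fmap F E D 0 w)"
    using L.ipath_trans[OF oF(2,3) ipath_sym[OF u(2)]] ipath_fmap_iff[OF o(2,3) u(1) wf] w(1) by blast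
  then have "is_equivalence K E D w"
    using L.is_equivalence_ipath[OF oF(2,3) _ v(1)] is_equivalence_fmap_iff[OF o(2,3) wf] by blast
  then show "equivalent_over K Z E e D d" unfolding equivalent_over_def using w(2) by blast
qed

end

text \<open>Composition with the isomorphism between D and D' transports equivalences over one base
  to the other. On the way back, strict commutation over Z is recovered by cancelling j.\<close>

lemma (in cosmos) equivalent_over_iso:
  assumes o: "Z \<in> obj K" "Z' \<in> obj K" "E \<in> obj K" "D \<in> obj K" "D' \<in> obj K"
    and e: "e \<in> functors K E Z" and d: "d \<in> functors K D Z" and d': "d' \<in> functors K D' Z'"
    and j: "is_iso K Z Z' j" and i: "isomorphic_over K Z' D' d' D (comp0 K D Z Z' j d)"
  shows "equivalent_over K Z E e D d \<longleftrightarrow> equivalent_over K Z' E (comp0 K E Z Z' j e) D' d'"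
proof -
  obtain j' where j: "j \<in> functors K Z Z'" "j' \<in> functors K Z' Z" "comp0 K Z Z' Z j' j = ident K Z"
    using j unfolding is_iso_def by blast
  obtain \<theta> \<theta>' where \<theta>: "is_iso K D' D \<theta>" "\<theta> \<in> functors K D' D" "\<theta>' \<in> functors K D D'"
    "comp0 K D' D D' \<theta>' \<theta> = ident K D'" "comp0 K D D' D \<theta> \<theta>' = ident K D"
    "comp0 K D' D Z' (comp0 K D Z Z' j d) \<theta> = d'"
    using i unfolding isomorphic_over_def is_iso_def by blast
  have \<theta>i: "is_iso K D D' \<theta>'" unfolding is_iso_def using \<theta> by blast
  have jd: "comp0 K D Z Z' j d \<in> functors K D Z'" using ecomp_in[OF o(4,1,2) j(1) d] .
  show ?thesis
  proof
    assume "equivalent_over K Z E e D d"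
    then obtain w where w: "is_equivalence K E D w" "comp0 K E D Z d w = e"
      unfolding equivalent_over_def by blast
    then have wf: "w \<in> functors K E D" by (simp add: is_equivalence_def)
    have v: "comp0 K E D D' \<theta>' w \<in> functors K E D'" using ecomp_in[OF o(3,4,5) \<theta>(3) wf] .
    have "comp0 K E D' D \<theta> (comp0 K E D D' \<theta>' w) = w"
      using ecomp_assoc[OF o(3,4,5,4) wf \<theta>(3,2)] \<theta>(5) comp0_ident[OF o(3,4) wf] by simp
    then have "comp0 K E D' Z' d' (comp0 K E D D' \<theta>' w) = comp0 K E Z Z' j e"
      using ecomp_assoc[OF o(3,5,4,2) v \<theta>(2) jd] \<theta>(6) ecomp_assoc[OF o(3,4,1,2) wf d j(1)] w(2) by simp
    then show "equivalent_over K Z' E (comp0 K E Z Z' j e) D' d'"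
      unfolding equivalent_over_def
      using is_equivalence_comp[OF o(3,4,5) w(1) is_iso_equivalence[OF o(4,5) \<theta>i]] by blast
  next
    assume "equivalent_over K Z' E (comp0 K E Z Z' j e) D' d'"
    then obtain w where w: "is_equivalence K E D' w" "comp0 K E D' Z' d' w = comp0 K E Z Z' j e"
      unfolding equivalent_over_def by blast
    then have wf: "w \<in> functors K E D'" by (simp add: is_equivalence_def)
    have v: "comp0 K E D' D \<theta> w \<in> functors K E D" using ecomp_in[OF o(3,5,4) \<theta>(2) wf] .
    have cancel: "comp0 K E Z' Z j' (comp0 K E Z Z' j x) = x" if "x \<in> functors K E Z" for x
      using ecomp_assoc[OF o(3,1,2,1) that j(1,2)] j(3) comp0_ident[OF o(3,1) that] by simp
    have dv: "comp0 K E D Z d (comp0 K E D' D \<theta> w) \<in> functors K E Z" using ecomp_in[OF o(3,4,1) d v] .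
    have "comp0 K E Z Z' j (comp0 K E D Z d (comp0 K E D' D \<theta> w)) = comp0 K E Z Z' j e"
      using ecomp_assoc[OF o(3,5,4,2) wf \<theta>(2) jd] \<theta>(6) ecomp_assoc[OF o(3,4,1,2) v d j(1)] w(2) by simp
    then have "comp0 K E D Z d (comp0 K E D' D \<theta> w) = e" using cancel[OF dv] cancel[OF e] by metis
    then show "equivalent_over K Z E e D d"
      unfolding equivalent_over_def
      using is_equivalence_comp[OF o(3,5,4) w(1) is_iso_equivalence[OF o(5,4) \<theta>(1)]] by blast
  qed
qed

text \<open>In the clause on commas, Z and W are arbitrary products of C, B and of FC, FB, and j is
  the comparison from FZ to W; composing with j turns objects over FZ into objects over W. The
  isomorphism between the comma of Ff, Fg and F of the comma of f, g is part of the conclusion, as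
  \<open>isomorphic_over\<close>.\<close>

theorem proposition3p6p4:
  fixes K :: "('o, 'h) cosmos" and L :: "('p, 'l) cosmos"
    and F :: "('o, 'h, 'p, 'l) cosmos_fun"
  assumes "cosmos_weak_equivalence TYPE('u::infinite) K L F"
  shows
    "biequivalence (homotopy_2_category K) (homotopy_2_category L) (homotopy_2_functor L F) \<and>
     (\<forall>A\<in>obj K. \<forall>B\<in>obj K.
        bij_on_iso_classes (thom (homotopy_2_category K) A B)
          (thom (homotopy_2_category L) (fobj F A) (fobj F B))
          (tfun1 (homotopy_2_functor L F) A B)) \<and>
     (\<forall>A\<in>obj K. groupoidal K A \<longleftrightarrow> groupoidal L (fobj F A)) \<and>
     (\<forall>A\<in>obj K. \<forall>B\<in>obj K. equivalent K A B \<longleftrightarrow> equivalent L (fobj F A) (fobj F B)) \<and>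
     (\<forall>A\<in>obj K. \<forall>B\<in>obj K. \<forall>f\<in>functors K A B.
        is_equivalence K A B f \<longleftrightarrow> is_equivalence L (fobj F A) (fobj F B) (fmap F A B 0 f)) \<and>
     (\<forall>A\<in>obj K. \<forall>B\<in>obj K. \<forall>C\<in>obj K. \<forall>f\<in>functors K B A. \<forall>g\<in>functors K C A.
      \<forall>Z c b E e D d W c' b' j D' d'.
        is_product K C B Z c b \<longrightarrow> E \<in> obj K \<longrightarrow> e \<in> isofib K E Z \<longrightarrow>
        is_comma K A B C f g Z c b D d \<longrightarrow>
        is_product L (fobj F C) (fobj F B) W c' b' \<longrightarrow>
        j \<in> functors L (fobj F Z) W \<longrightarrow>
        comp0 L (fobj F Z) W (fobj F C) c' j = fmap F Z C 0 c \<longrightarrow>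
        comp0 L (fobj F Z) W (fobj F B) b' j = fmap F Z B 0 b \<longrightarrow>
        is_comma L (fobj F A) (fobj F B) (fobj F C) (fmap F B A 0 f) (fmap F C A 0 g)
          W c' b' D' d' \<longrightarrow>
        isomorphic_over L W
          D' d' (fobj F D) (comp0 L (fobj F D) (fobj F Z) W j (fmap F D Z 0 d)) \<and>
        (equivalent_over K Z E e D d \<longleftrightarrow>
         equivalent_over L W
           (fobj F E) (comp0 L (fobj F E) (fobj F Z) W j (fmap F E Z 0 e)) D' d'))"
proof -
  have "infinity_cosmos TYPE('u) K" "infinity_cosmos TYPE('u) L"
    using assms by (simp_all add: cosmos_weak_equivalence_def cosmos_functor_def)
  then interpret cosmos_weq "TYPE('u)" K L F
    using assms by unfold_locales
  have bij: "bij_on_iso_classes (thom (homotopy_2_category K) A B)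
      (thom (homotopy_2_category L) (fobj F A) (fobj F B)) (tfun1 (homotopy_2_functor L F) A B)"
    if "A \<in> obj K" "B \<in> obj K" for A B
    using cat_equivalence_bij_on_iso_classes[OF hom_cat_equivalence[OF that]]
    by (simp add: K.h2c_simps L.h2c_simps homotopy_2_functor_def)
  have comma: "isomorphic_over L W D' d' (fobj F D) (comp0 L (fobj F D) (fobj F Z) W j (fmap F D Z 0 d)) \<and>
      (equivalent_over K Z E e D d \<longleftrightarrow>
       equivalent_over L W (fobj F E) (comp0 L (fobj F E) (fobj F Z) W j (fmap F E Z 0 e)) D' d')"
    if f: "f \<in> functors K B A" and g: "g \<in> functors K C A"
      and Z: "is_product K C B Z c b" and E: "E \<in> obj K" and e: "e \<in> isofib K E Z"
      and D: "is_comma K A B C f g Z c b D d" and W: "is_product L (fobj F C) (fobj F B) W c' b'"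
      and j: "j \<in> functors L (fobj F Z) W" "comp0 L (fobj F Z) W (fobj F C) c' j = fmap F Z C 0 c"
        "comp0 L (fobj F Z) W (fobj F B) b' j = fmap F Z B 0 b"
      and D': "is_comma L (fobj F A) (fobj F B) (fobj F C) (fmap F B A 0 f) (fmap F C A 0 g) W c' b' D' d'"
    for A B C f g Z c b E e D d W c' b' j D' d'
  proof -
    have o: "Z \<in> obj K" "D \<in> obj K" "W \<in> obj L" "D' \<in> obj L" "d' \<in> functors L D' W"
      using Z W D D' by (auto simp: is_product_def is_comma_def is_pullback_def)
    have d: "d \<in> isofib K D Z" using K.comma_isofib[OF D] .
    have ef: "e \<in> functors K E Z" and df: "d \<in> functors K D Z"
      using K.isofib_functor o E d e by blast+
    have iso: "isomorphic_over L W D' d' (fobj F D) (comp0 L (fobj F D) (fobj F Z) W j (fmap F D Z 0 d))"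
      using L.comma_unique[OF D' fmap_comma[OF D f g W j]] .
    have "is_iso L (fobj F Z) W j"
      using L.product_arrow_iso[OF fmap_product[OF Z] W j] j(1) unfolding is_iso_def by blast
    from L.equivalent_over_iso[OF fobj_in[OF o(1)] o(3) fobj_in[OF E] fobj_in[OF o(2)] o(4)
        fmap_in[OF E o(1) ef] fmap_in[OF o(2,1) df] o(5) this iso]
    show ?thesis using iso equivalent_over_fmap_iff[OF o(1) E o(2) ef d] by blast
  qed
  show ?thesis
    by (intro conjI ballI allI impI; (rule biequivalence_h2f bij groupoidal_iff equivalent_fobj_iff
        is_equivalence_fmap_iff comma[THEN conjunct1] comma[THEN conjunct2]); assumption)
qed

end
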